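(* Let $k$ be a field and let $\Delta$ be a simplicial complex on the vertex set $[n]=\{1,\dots,n\}$. Let $A=k[\Delta]$ be its Stanley--Reisner ring, of Krull dimension $d\ge 2$, and put $c=\operatorname{codim} A=n-d$. Suppose that $\Delta$ is pure. If $e(A)\ge \binom{n}{c}-2c+1$, then $A$ is Cohen--Macaulay.
   Context: A simplicial complex $\Delta$ on $[n]$ is a family of subsets of $[n]$ (faces) closed under taking subsets, with $\{i\}\in\Delta$ for all $i\in[n]$. The Stanley--Reisner ring is $k[\Delta]=S/I_\Delta$, where $S=k[X_1,\dots,X_n]$ with $\deg X_i=1$ and $I_\Delta$ is generated by all squarefree monomials $X_{i_1}\cdots X_{i_p}$ with $\{i_1,\dots,i_p\}\notin\Delta$. The dimension of a face $F$ is $|F|-1$, facets are maximal faces, and $\dim k[\Delta]=\dim\Delta+1=d$. The multiplicity $e(A)$ equals the number of facets $F$ of $\Delta$ with $\dim F=d-1$. $\Delta$ is pure if all its facets have the same dimension. *)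

theory Defs
  imports
    "HOL-Library.Poly_Mapping"
    "HOL-Library.Extended_Nat"
    "HOL-Computational_Algebra.Polynomial"
    "HOL-Algebra.QuotRing"
    "HOL-Algebra.Ring_Divisibility"
    "HOL-Algebra.Embedded_Algebras"
begin

section \<open>Simplicial complexes\<close>

definition simplicial_complex :: "nat \<Rightarrow> nat set set \<Rightarrow> bool" where
  "simplicial_complex n \<Delta> \<longleftrightarrow>
     \<Delta> \<subseteq> Pow {1..n} \<and> (\<forall>F\<in>\<Delta>. \<forall>G. G \<subseteq> F \<longrightarrow> G \<in> \<Delta>) \<and> (\<forall>i\<in>{1..n}. {i} \<in> \<Delta>)"

definition facets :: "'v set set \<Rightarrow> 'v set set" where
  "facets \<Delta> = {F \<in> \<Delta>. \<forall>G\<in>\<Delta>. F \<subseteq> G \<longrightarrow> G = F}"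

definition face_dim :: "'v set \<Rightarrow> int" where
  "face_dim F = int (card F) - 1"

definition pure_complex :: "'v set set \<Rightarrow> bool" where
  "pure_complex \<Delta> \<longleftrightarrow> (\<forall>F\<in>facets \<Delta>. \<forall>G\<in>facets \<Delta>. face_dim F = face_dim G)"

section \<open>Krull dimension, depth and Cohen--Macaulay rings\<close>

text \<open>A chain of length \<open>r\<close> has \<open>r + 1\<close> terms \<open>P 0, \<dots>, P r\<close>.\<close>

definition prime_chain :: "('a, 'b) ring_scheme \<Rightarrow> nat \<Rightarrow> (nat \<Rightarrow> 'a set) \<Rightarrow> bool" where
  "prime_chain R r P \<longleftrightarrow> (\<forall>i\<le>r. primeideal (P i) R) \<and> (\<forall>i<r. P i \<subset> P (Suc i))"

text \<open>The zero ring has no prime ideals and gets dimension \<open>0\<close> here, since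
  \<^typ>\<open>enat\<close> has no negative elements.\<close>

definition krull_dim :: "('a, 'b) ring_scheme \<Rightarrow> enat" where
  "krull_dim R = Sup {enat r | r. \<exists>P. prime_chain R r P}"

definition height :: "('a, 'b) ring_scheme \<Rightarrow> 'a set \<Rightarrow> enat" where
  "height R Q = Sup {enat r | r. \<exists>P. prime_chain R r P \<and> P r = Q}"

text \<open>Each \<open>xs ! i\<close> is a nonzerodivisor modulo the ideal generated by its predecessors,
  and the whole sequence generates a proper ideal.\<close>

definition regular_sequence :: "('a, 'b) ring_scheme \<Rightarrow> 'a list \<Rightarrow> bool" where
  "regular_sequence R xs \<longleftrightarrow>
     set xs \<subseteq> carrier R \<and>
     (\<forall>i<length xs. \<forall>a\<in>carrier R.
        xs ! i \<otimes>\<^bsub>R\<^esub> a \<in> Idl\<^bsub>R\<^esub> (set (take i xs)) \<longrightarrow> a \<in> Idl\<^bsub>R\<^esub> (set (take i xs))) \<and>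
     Idl\<^bsub>R\<^esub> (set xs) \<noteq> carrier R"

definition depth :: "('a, 'b) ring_scheme \<Rightarrow> 'a set \<Rightarrow> enat" where
  "depth R I = Sup {enat (length xs) | xs. regular_sequence R xs \<and> set xs \<subseteq> I}"

text \<open>The textbook definition of Kaplansky (\<^emph>\<open>Commutative Rings\<close>, Section 3-1) and Eisenbud
  (\<^emph>\<open>Commutative Algebra\<close>, Section 18.2): for every maximal ideal \<open>M\<close>, the maximal length of a
  regular sequence in \<open>M\<close> is the height of \<open>M\<close>. These numbers are the depth and the
  dimension of the localization of the ring at \<open>M\<close>.\<close>

definition cohen_macaulay_ring :: "('a, 'b) ring_scheme \<Rightarrow> bool" where
  "cohen_macaulay_ring R \<longleftrightarrow>
     cring R \<and> noetherian_ring R \<and> (\<forall>M. maximalideal M R \<longrightarrow> depth R M = height R M)"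

section \<open>Multiplicity of a graded algebra\<close>

text \<open>\<open>K\<close> is a subfield of the ring \<open>R\<close>, and \<open>G m\<close> is the homogeneous component
  of degree \<open>m\<close>.\<close>

definition hilbert_function ::
    "('a, 'b) ring_scheme \<Rightarrow> 'a set \<Rightarrow> (nat \<Rightarrow> 'a set) \<Rightarrow> nat \<Rightarrow> nat" where
  "hilbert_function R K G m = ring.dim R K (G m)"

definition hilbert_polynomial ::
    "('a, 'b) ring_scheme \<Rightarrow> 'a set \<Rightarrow> (nat \<Rightarrow> 'a set) \<Rightarrow> real poly" where
  "hilbert_polynomial R K G =
     (THE p. \<forall>\<^sub>F m in sequentially. poly p (real m) = real (hilbert_function R K G m))"

text \<open>For \<open>R\<close> of dimension \<open>d > 0\<close>, the Hilbert polynomial has degree \<open>d - 1\<close> and leading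
  coefficient \<open>e / (d - 1)!\<close>, where \<open>e\<close> is the multiplicity. The usual separate convention
  for \<open>d = 0\<close> is not covered.\<close>

definition hilbert_multiplicity ::
    "('a, 'b) ring_scheme \<Rightarrow> 'a set \<Rightarrow> (nat \<Rightarrow> 'a set) \<Rightarrow> real" where
  "hilbert_multiplicity R K G =
     (let d = the_enat (krull_dim R)
      in fact (d - 1) * Polynomial.coeff (hilbert_polynomial R K G) (d - 1))"

section \<open>Stanley--Reisner rings\<close>

text \<open>A polynomial maps exponent vectors to coefficients; multiplication on this type
  is convolution.\<close>

type_synonym 'k mpoly = "(nat \<Rightarrow>\<^sub>0 nat) \<Rightarrow>\<^sub>0 'k"

definition indet :: "nat \<Rightarrow> 'k::comm_ring_1 mpoly" where
  "indet i = Poly_Mapping.single (Poly_Mapping.single i 1) 1"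

definition mpoly_ring :: "nat \<Rightarrow> 'k::comm_ring_1 mpoly ring" where
  "mpoly_ring n =
     \<lparr>carrier = {p. \<forall>t\<in>Poly_Mapping.keys p. Poly_Mapping.keys t \<subseteq> {1..n}},
      mult = (*), one = 1, zero = 0, add = (+)\<rparr>"

definition homogeneous :: "nat \<Rightarrow> 'k::zero mpoly \<Rightarrow> bool" where
  "homogeneous m p \<longleftrightarrow>
     (\<forall>t\<in>Poly_Mapping.keys p. (\<Sum>i\<in>Poly_Mapping.keys t. Poly_Mapping.lookup t i) = m)"

definition stanley_reisner_ideal :: "nat \<Rightarrow> nat set set \<Rightarrow> 'k::field mpoly set" where
  "stanley_reisner_ideal n \<Delta> =
     Idl\<^bsub>mpoly_ring n\<^esub> {\<Prod>i\<in>F. indet i | F. F \<subseteq> {1..n} \<and> F \<notin> \<Delta>}"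

definition stanley_reisner_ring :: "nat \<Rightarrow> nat set set \<Rightarrow> 'k::field mpoly set ring" where
  "stanley_reisner_ring n \<Delta> = mpoly_ring n Quot stanley_reisner_ideal n \<Delta>"

definition sr_scalars :: "nat \<Rightarrow> nat set set \<Rightarrow> 'k::field mpoly set set" where
  "sr_scalars n \<Delta> =
     range (\<lambda>a. stanley_reisner_ideal n \<Delta> +>\<^bsub>mpoly_ring n\<^esub> Poly_Mapping.single 0 a)"

definition sr_component :: "nat \<Rightarrow> nat set set \<Rightarrow> nat \<Rightarrow> 'k::field mpoly set set" where
  "sr_component n \<Delta> m =
     {stanley_reisner_ideal n \<Delta> +>\<^bsub>mpoly_ring n\<^esub> f | f. f \<in> carrier (mpoly_ring n) \<and> homogeneous m f}"

definition sr_multiplicity :: "'k::field itself \<Rightarrow> nat \<Rightarrow> nat set set \<Rightarrow> real" where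
  "sr_multiplicity _ n \<Delta> =
     hilbert_multiplicity (stanley_reisner_ring n \<Delta> :: 'k mpoly set ring)
       (sr_scalars n \<Delta>) (sr_component n \<Delta>)"

lemma cring_mpoly_ring: "cring (mpoly_ring n :: 'k::comm_ring_1 mpoly ring)"
proof -
  define C :: "'k mpoly set"
    where "C = {p. \<forall>t\<in>Poly_Mapping.keys p. Poly_Mapping.keys t \<subseteq> {1..n}}"
  have mult: "p * q \<in> C" if pq: "p \<in> C" "q \<in> C" for p q
    unfolding C_def
  proof (intro CollectI ballI)
    fix t assume "t \<in> Poly_Mapping.keys (p * q)"
    then obtain u v where uv: "t = u + v" "u \<in> Poly_Mapping.keys p" "v \<in> Poly_Mapping.keys q"
      using keys_mult[of p q] by blast
    then show "Poly_Mapping.keys t \<subseteq> {1..n}"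
      using pq keys_add[of u v] unfolding C_def by blast
  qed
  have add: "p + q \<in> C" if "p \<in> C" "q \<in> C" for p q
    using that keys_add[of p q] unfolding C_def by blast
  have "0 \<in> C" "1 \<in> C" "\<And>p. p \<in> C \<Longrightarrow> - p \<in> C"
    by (auto simp: C_def)
  moreover have "mpoly_ring n = \<lparr>carrier = C, mult = (*), one = 1, zero = 0, add = (+)\<rparr>"
    by (simp add: mpoly_ring_def C_def)
  ultimately show ?thesis
  proof (intro cringI abelian_groupI comm_monoidI, goal_cases)
    case (6 x)
    then show ?case
      by (intro bexI[of _ "- x"]) auto
  qed (auto simp: algebra_simps mult add)
qed

lemma ideal_stanley_reisner_ideal:
  "ideal (stanley_reisner_ideal n \<Delta> :: 'k::field mpoly set) (mpoly_ring n)"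
proof -
  interpret cring "mpoly_ring n :: 'k mpoly ring" by (rule cring_mpoly_ring)
  have "(\<Prod>i\<in>F. indet i) \<in> carrier (mpoly_ring n :: 'k mpoly ring)" if "F \<subseteq> {1..n}" for F
    using finite_subset[OF that finite_atLeastAtMost] that
  proof (induction F rule: finite_induct)
    case empty
    show ?case using one_closed by (simp add: mpoly_ring_def)
  next
    case (insert i F)
    have "indet i \<in> carrier (mpoly_ring n :: 'k mpoly ring)"
      using insert.prems by (simp add: mpoly_ring_def indet_def)
    then show ?case
      using m_closed[of "indet i" "\<Prod>i\<in>F. indet i"] insert by (simp add: mpoly_ring_def)
  qed
  then show ?thesis
    unfolding stanley_reisner_ideal_def by (intro genideal_ideal) auto
qed

lemma cring_stanley_reisner_ring:
  "cring (stanley_reisner_ring n \<Delta> :: 'k::field mpoly set ring)"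
  unfolding stanley_reisner_ring_def
  by (rule ideal.quotient_is_cring[OF ideal_stanley_reisner_ideal cring_mpoly_ring])

end

theory Submission
  imports Defs
begin

text \<open>The hypotheses say that at most \<open>2 c - 1\<close> of the \<open>d\<close>-subsets of \<open>[n]\<close> are missing from
  \<open>\<Delta>\<close>, and this bound is inherited by the link and the deletion of a suitable vertex, so that \<open>\<Delta>\<close> is
  vertex decomposable.

  For a maximal ideal \<open>M\<close> of the polynomial ring, the Nullstellensatz gives polynomials
  \<open>z i = q i (X i) \<in> M\<close> with \<open>q i \<noteq> 0\<close> and \<open>q i (0) = 0\<close>. On the polynomial ring of a facet, the elementary
  symmetric polynomials of the \<open>z i\<close>, in decreasing degree \<open>d, \<dots>, 1\<close>, form a regular sequence, because the
  one of top degree is the product of the \<open>z i\<close>. The vertex decomposition filters the Stanley--Reisner ring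
  by such polynomial rings, so the sequence stays regular and the depth at \<open>M\<close> is at least \<open>d\<close>.

  The depth at a prime ideal is at most its height, which is at most the Krull dimension \<open>d\<close>. The
  upper bound for the dimension of a polynomial ring is not needed: if \<open>\<Delta>\<close> had no face with \<open>d\<close>
  elements, the coefficient defining the multiplicity would vanish, against the hypothesis.\<close>

hide_const (open) UnivPoly.coeff UnivPoly.monom Module.smult

text \<open>The regular sequence has to lie in an arbitrary maximal ideal over an arbitrary field,
  and one and the same sequence must work on every piece of the filtration. The z i themselves do
  not serve: there are n of them, and which d of them survive depends on the facet. Elementary
  symmetric polynomials treat all variables alike. Modulo the ideal of a facet F the z i with i
  outside F vanish, since q i has zero constant term, and what remains are the symmetric polynomials
  of the z i with i in F. The constant 2 c - 1 is what the induction can carry. A blocked pair costs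
  c missing sets, so two of them with disjoint costs exceed the bound; deleting a vertex lowers c by
  one and has to remove two missing sets; and a vertex that is lost in passing to a link accounts
  for two. In the Nullstellensatz, maximality is not visibly inherited by the contraction to fewer
  variables, whereas being a Goldman prime is. The latter is therefore carried down one variable at
  a time, until only X i is left and must be algebraic over the field.\<close>

abbreviation keys :: "('a \<Rightarrow>\<^sub>0 'b::zero) \<Rightarrow> 'a set" where
  "keys \<equiv> Poly_Mapping.keys"

abbreviation lookup :: "('a \<Rightarrow>\<^sub>0 'b::zero) \<Rightarrow> 'a \<Rightarrow> 'b" where
  "lookup \<equiv> Poly_Mapping.lookup"

abbreviation single :: "'a \<Rightarrow> 'b \<Rightarrow> 'a \<Rightarrow>\<^sub>0 'b::zero" where
  "single \<equiv> Poly_Mapping.single"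

section \<open>Prime ideals, regular sequences and quotients\<close>

lemma (in cring) mem_add_PIdl_iff:
  "x \<in> J <+> PIdl a \<longleftrightarrow> (\<exists>p\<in>J. \<exists>r\<in>carrier R. x = p \<oplus> r \<otimes> a)"
  by (auto simp: set_add_def' cgenideal_def)

text \<open>An ideal \<open>P\<close> maximal among those that contain \<open>I\<close> and miss
  \<open>S\<close> is prime: for \<open>a\<close>, \<open>b\<close> outside \<open>P\<close> both
  \<open>P + (a)\<close> and \<open>P + (b)\<close> meet \<open>S\<close>, and the product of the
  two common elements lies in \<open>S\<close>, but also in \<open>P\<close> if \<open>a b\<close>
  does.\<close>

lemma (in cring) exists_primeideal_avoiding:
  assumes I: "ideal I R" and S: "S \<subseteq> carrier R" "\<one> \<in> S" "S \<inter> I = {}"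
    and mult: "\<And>s t. s \<in> S \<Longrightarrow> t \<in> S \<Longrightarrow> s \<otimes> t \<in> S"
  shows "\<exists>P. primeideal P R \<and> I \<subseteq> P \<and> S \<inter> P = {}"
proof -
  define A where "A = {J. ideal J R \<and> I \<subseteq> J \<and> S \<inter> J = {}}"
  have "\<exists>M\<in>A. \<forall>X\<in>A. M \<subseteq> X \<longrightarrow> X = M"
  proof (rule subset_Zorn_nonempty)
    show "A \<noteq> {}" using I S by (auto simp: A_def)
  next
    fix C assume C: "C \<noteq> {}" "subset.chain A C"
    then have "subset.chain {I. ideal I R} C"
      by (auto simp: A_def pred_on.chain_def)
    then have "ideal (\<Union>C) R"
      using chain_Union_is_ideal[of C] C by simp
    with C show "\<Union>C \<in> A"
      by (auto simp: A_def pred_on.chain_def)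
  qed
  then obtain P where PA: "P \<in> A" and PM: "\<forall>X\<in>A. P \<subseteq> X \<longrightarrow> X = P" ..
  then have P: "ideal P R" "I \<subseteq> P" "S \<inter> P = {}" by (simp_all add: A_def)
  have max: "J = P" if "ideal J R" "P \<subseteq> J" "S \<inter> J = {}" for J
    using PM P(2) that unfolding A_def by simp
  interpret P: ideal P R by fact
  have key: "\<exists>p\<in>P. \<exists>r\<in>carrier R. p \<oplus> r \<otimes> a \<in> S" if a: "a \<in> carrier R" "a \<notin> P" for a
  proof (rule ccontr)
    assume neg: "\<not> ?thesis"
    have "P <+> PIdl a = P"
    proof (rule max)
      show "ideal (P <+> PIdl a) R"
        using P a by (intro add_ideals cgenideal_ideal)
      show "P \<subseteq> P <+> PIdl a"
      proof
        fix x assume "x \<in> P"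
        moreover from this have "x = x \<oplus> \<zero> \<otimes> a" using a P.Icarr by auto
        ultimately show "x \<in> P <+> PIdl a" unfolding mem_add_PIdl_iff by blast
      qed
      show "S \<inter> (P <+> PIdl a) = {}"
        using neg by (auto simp: mem_add_PIdl_iff)
    qed
    moreover have "a \<in> P <+> PIdl a"
    proof -
      have "a = \<zero> \<oplus> \<one> \<otimes> a" using a by auto
      then show ?thesis unfolding mem_add_PIdl_iff using P.zero_closed one_closed by blast
    qed
    ultimately show False using a by simp
  qed
  have "primeideal P R"
  proof (rule primeidealI)
    show "ideal P R" "cring R" by (fact P is_cring)+
    show "carrier R \<noteq> P" using P S by auto
  next
    fix a b assume ab: "a \<in> carrier R" "b \<in> carrier R" "a \<otimes> b \<in> P"
    show "a \<in> P \<or> b \<in> P"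
    proof (rule ccontr)
      assume "\<not> ?thesis"
      then obtain p r q s where *: "p \<in> P" "r \<in> carrier R" "p \<oplus> r \<otimes> a \<in> S"
         "q \<in> P" "s \<in> carrier R" "q \<oplus> s \<otimes> b \<in> S"
        using key[of a] key[of b] ab by blast
      have c: "p \<in> carrier R" "q \<in> carrier R" using * P.a_subset by auto
      have "(p \<oplus> r \<otimes> a) \<otimes> (q \<oplus> s \<otimes> b) = p \<otimes> (q \<oplus> s \<otimes> b) \<oplus> (r \<otimes> a \<otimes> q \<oplus> (r \<otimes> s) \<otimes> (a \<otimes> b))"
        using * ab c by algebra
      also have "\<dots> \<in> P"
      proof (intro P.a_closed)
        show "p \<otimes> (q \<oplus> s \<otimes> b) \<in> P" by (rule P.I_r_closed) (use * ab c in auto)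
        show "r \<otimes> a \<otimes> q \<in> P" by (rule P.I_l_closed) (use * ab c in auto)
        show "(r \<otimes> s) \<otimes> (a \<otimes> b) \<in> P" by (rule P.I_l_closed) (use * ab c in auto)
      qed
      finally show False using mult[OF *(3,6)] P by auto
    qed
  qed
  with P show ?thesis by blast
qed

text \<open>Localization in disguise: the products of a power of \<open>x\<close> with an element
  outside \<open>P\<close> form a multiplicative set that misses \<open>I\<close>, since powers of
  \<open>x\<close> cancel modulo \<open>I\<close>. A prime ideal avoiding this set lies in
  \<open>P\<close> and omits \<open>x\<close>, so the inclusion is strict.\<close>

lemma (in cring) primeideal_below_nonzerodivisor:
  assumes P: "primeideal P R" and I: "ideal I R" "I \<subseteq> P" and x: "x \<in> P"
    and nzd: "\<And>a. a \<in> carrier R \<Longrightarrow> x \<otimes> a \<in> I \<Longrightarrow> a \<in> I"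
  shows "\<exists>Q. primeideal Q R \<and> I \<subseteq> Q \<and> Q \<subset> P"
proof -
  interpret P: primeideal P R by fact
  have xc: "x \<in> carrier R" using x P.a_subset by auto
  define S where "S = {x [^] (k::nat) \<otimes> s | k s. s \<in> carrier R - P}"
  have one: "\<one> \<in> carrier R - P"
    using P.I_notcarr P.one_imp_carrier by auto
  have nzd': "a \<in> I" if "a \<in> carrier R" "x [^] (k::nat) \<otimes> a \<in> I" for a k
    using that
  proof (induction k arbitrary: a)
    case (Suc k)
    have "x [^] k \<otimes> (x \<otimes> a) \<in> I" using Suc.prems xc by (simp add: m_assoc)
    then have "x \<otimes> a \<in> I" using Suc.IH[of "x \<otimes> a"] Suc.prems xc m_closed by blast
    then show ?case using nzd[of a] Suc.prems by blast
  qed auto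
  have "\<exists>Q. primeideal Q R \<and> I \<subseteq> Q \<and> S \<inter> Q = {}"
  proof (rule exists_primeideal_avoiding[OF I(1)])
    show "S \<subseteq> carrier R" using xc by (auto simp: S_def)
    show "\<one> \<in> S"
    proof -
      have "x [^] (0::nat) \<otimes> \<one> \<in> S" unfolding S_def using one by blast
      then show ?thesis by simp
    qed
    show "S \<inter> I = {}"
    proof (rule ccontr)
      assume "S \<inter> I \<noteq> {}"
      then obtain k s where "x [^] (k::nat) \<otimes> s \<in> I" "s \<in> carrier R - P"
        unfolding S_def by blast
      with nzd'[of s k] I show False by blast
    qed
  next
    fix s t assume "s \<in> S" "t \<in> S"
    then obtain k l u v where *: "s = x [^] (k::nat) \<otimes> u" "t = x [^] (l::nat) \<otimes> v"
       "u \<in> carrier R - P" "v \<in> carrier R - P" unfolding S_def by auto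
    have "s \<otimes> t = x [^] (k + l) \<otimes> (u \<otimes> v)"
      using * xc by (simp add: nat_pow_mult[symmetric] m_ac)
    moreover have "u \<otimes> v \<in> carrier R - P" using * P.I_prime[of u v] by auto
    ultimately show "s \<otimes> t \<in> S" unfolding S_def by blast
  qed
  then obtain Q where Q: "primeideal Q R" "I \<subseteq> Q" "S \<inter> Q = {}" by blast
  interpret Q: primeideal Q R by fact
  have "s \<in> S" if "s \<in> carrier R - P" for s
    proof -
    have "x [^] (0::nat) \<otimes> s \<in> S" unfolding S_def using that by blast
    then show ?thesis using that by simp
  qed
  then have QP: "Q \<subseteq> P" using Q Q.a_subset by blast
  have "x [^] (1::nat) \<otimes> \<one> \<in> S" unfolding S_def using one by blast
  then have "x \<in> S" using xc by simp
  then have "x \<notin> Q" using Q by blast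
  then have "Q \<subset> P" using QP x by auto
  then show ?thesis using Q(1,2) by (intro exI[of _ Q] conjI)
qed

text \<open>The chain is built downwards from \<open>M\<close>: the last element is a nonzerodivisor
  modulo the others, which gives a prime ideal strictly below \<open>M\<close> that still contains
  the others. Hence the induction from the right, with \<open>M\<close> arbitrary.\<close>

lemma (in cring) regular_sequence_prime_chain:
  assumes "primeideal M R" "regular_sequence R xs" "Idl (set xs) \<subseteq> M"
  shows "\<exists>P. prime_chain R (length xs) P \<and> P (length xs) = M"
  using assms
proof (induction xs arbitrary: M rule: rev_induct)
  case Nil
  then show ?case by (intro exI[of _ "\<lambda>_. M"]) (auto simp: prime_chain_def)
next
  case (snoc x xs)
  from snoc.prems have reg: "set (xs @ [x]) \<subseteq> carrier R"
     "\<And>i a. i < length (xs @ [x]) \<Longrightarrow> a \<in> carrier R \<Longrightarrow>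
        (xs @ [x]) ! i \<otimes> a \<in> Idl (set (take i (xs @ [x]))) \<Longrightarrow> a \<in> Idl (set (take i (xs @ [x])))"
     "Idl (set (xs @ [x])) \<noteq> carrier R"
    unfolding regular_sequence_def by auto
  have sub: "Idl (set xs) \<subseteq> Idl (set (xs @ [x]))"
    using reg(1) genideal_self[OF reg(1)] by (intro genideal_minimal genideal_ideal) auto
  have "\<exists>Q. primeideal Q R \<and> Idl (set xs) \<subseteq> Q \<and> Q \<subset> M"
  proof (rule primeideal_below_nonzerodivisor)
    show "primeideal M R" by fact
    show "ideal (Idl (set xs)) R" using reg by (intro genideal_ideal) auto
    show "Idl (set xs) \<subseteq> M" using sub snoc.prems by blast
    show "x \<in> M" using snoc.prems genideal_self[OF reg(1)] by auto
    show "a \<in> Idl (set xs)" if "a \<in> carrier R" "x \<otimes> a \<in> Idl (set xs)" for a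
      using reg(2)[of "length xs" a] that by simp
  qed
  then obtain Q where Q: "primeideal Q R" "Idl (set xs) \<subseteq> Q" "Q \<subset> M" by blast
  have "regular_sequence R xs"
    unfolding regular_sequence_def
  proof (intro conjI allI impI ballI)
    show "set xs \<subseteq> carrier R" using reg by auto
    show "Idl (set xs) \<noteq> carrier R"
      using Q primeideal.I_notcarr[OF Q(1)] ideal.Icarr[OF primeideal.axioms(1)[OF Q(1)]] by blast
    show "a \<in> Idl (set (take i xs))" if "i < length xs" "a \<in> carrier R" "xs ! i \<otimes> a \<in> Idl (set (take i xs))" for i a
      using reg(2)[of i a] that by (simp add: nth_append)
  qed
  from snoc.IH[OF Q(1) this Q(2)] obtain P where P: "prime_chain R (length xs) P" "P (length xs) = Q" by blast
  define P' where "P' = P(Suc (length xs) := M)"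
  have "prime_chain R (Suc (length xs)) P'"
    unfolding prime_chain_def
  proof (intro conjI allI impI)
    show "primeideal (P' i) R" if "i \<le> Suc (length xs)" for i
      using that P snoc.prems(1) unfolding P'_def prime_chain_def by (auto simp: le_Suc_eq)
    show "P' i \<subset> P' (Suc i)" if "i < Suc (length xs)" for i
      using that P Q unfolding P'_def prime_chain_def by (auto simp: less_Suc_eq)
  qed
  then show ?case by (intro exI[of _ P'] conjI) (simp, simp add: P'_def)
qed

lemma (in cring) depth_le_height:
  assumes M: "primeideal M R"
  shows "depth R M \<le> height R M"
  unfolding depth_def
proof (rule Sup_least, clarify)
  fix xs assume xs: "regular_sequence R xs" "set xs \<subseteq> M"
  have "Idl (set xs) \<subseteq> M" using M xs by (intro genideal_minimal primeideal.axioms)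
  from regular_sequence_prime_chain[OF M xs(1) this]
  show "enat (length xs) \<le> height R M"
    unfolding height_def by (intro Sup_upper) auto
qed

lemma height_le_krull_dim: "height R M \<le> krull_dim R"
  unfolding height_def krull_dim_def by (rule Sup_subset_mono) auto

lemma (in cring) Idl_subset_Idl:
  assumes "A \<subseteq> Idl B" "B \<subseteq> carrier R"
  shows "Idl A \<subseteq> Idl B"
  using assms by (intro genideal_minimal genideal_ideal)

section \<open>Ideals of a quotient ring and ideals containing the kernel\<close>

locale cring_ideal = cring R + I: ideal I R for R (structure) and I
begin

lemma R: "cring R" and I: "ideal I R" by (fact is_cring I.is_ideal)+

lemma cring_Quot: "cring (R Quot I)" by (rule I.quotient_is_cring[OF R])

lemmas ring_Quot = cring.axioms(1)[OF cring_Quot]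

lemma coset_mult:
  "a \<in> carrier R \<Longrightarrow> b \<in> carrier R \<Longrightarrow> (I +> a) \<otimes>\<^bsub>R Quot I\<^esub> (I +> b) = I +> (a \<otimes> b)"
  using I.rcoset_mult_add by (simp add: FactRing_def)

lemma zero_Quot: "\<zero>\<^bsub>R Quot I\<^esub> = I"
  by (simp add: FactRing_def)

lemma carrier_Quot: "carrier (R Quot I) = (+>) I ` carrier R"
  by (auto simp: FactRing_def A_RCOSETS_def')

lemma coset_in_image_iff:
  assumes J: "ideal J R" "I \<subseteq> J" and a: "a \<in> carrier R"
  shows "I +> a \<in> (+>) I ` J \<longleftrightarrow> a \<in> J"
proof
  assume "I +> a \<in> (+>) I ` J"
  then obtain b where b: "b \<in> J" "I +> a = I +> b" by auto
  interpret J: ideal J R by fact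
  have bc: "b \<in> carrier R" using b J.Icarr by auto
  have "a \<ominus> b \<in> I"
    using b(2) quotient_eq_iff_same_a_r_cos[OF I a bc] by simp
  then have "(a \<ominus> b) \<oplus> b \<in> J" using b(1) J(2) by (intro J.a_closed) blast+
  also have "(a \<ominus> b) \<oplus> b = a" using a bc by algebra
  finally show "a \<in> J" .
qed (rule imageI)

lemma ideal_coset_vimage: "ideal J (R Quot I) \<Longrightarrow> ideal {a \<in> carrier R. I +> a \<in> J} R"
  by (rule ring_hom_ring.ideal_vimage[OF I.rcos_ring_hom_ring])

lemma subset_coset_vimage: "ideal J (R Quot I) \<Longrightarrow> I \<subseteq> {a \<in> carrier R. I +> a \<in> J}"
proof
  fix a assume J: "ideal J (R Quot I)" and a: "a \<in> I"
  have "I +> a = \<zero>\<^bsub>R Quot I\<^esub>"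
    unfolding zero_Quot using a by (rule I.a_rcos_const)
  then show "a \<in> {a \<in> carrier R. I +> a \<in> J}"
    using a I.Icarr additive_subgroup.zero_closed[OF ideal.axioms(1)[OF J]] by auto
qed

text \<open>Regularity of a sequence of cosets can thus be tested in \<open>R\<close>, with
  \<open>I\<close> added to the generators.\<close>

lemma coset_in_Idl_iff:
  assumes S: "S \<subseteq> carrier R" and a: "a \<in> carrier R"
  shows "I +> a \<in> Idl\<^bsub>R Quot I\<^esub> ((+>) I ` S) \<longleftrightarrow> a \<in> Idl (I \<union> S)"
proof -
  have sub: "I \<union> S \<subseteq> carrier R" using S I.Icarr by auto
  have subQ: "(+>) I ` S \<subseteq> carrier (R Quot I)" using S by (auto simp: carrier_Quot)
  have id: "ideal (Idl (I \<union> S)) R" using sub by (rule genideal_ideal)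
  have idQ: "ideal (Idl\<^bsub>R Quot I\<^esub> ((+>) I ` S)) (R Quot I)" using subQ by (rule ring.genideal_ideal[OF ring_Quot])
  show ?thesis
  proof
    assume *: "I +> a \<in> Idl\<^bsub>R Quot I\<^esub> ((+>) I ` S)"
    have "Idl\<^bsub>R Quot I\<^esub> ((+>) I ` S) \<subseteq> (+>) I ` (Idl (I \<union> S))"
      using genideal_self[OF sub] by (intro ring.genideal_minimal[OF ring_Quot] ring_ideal_imp_quot_ideal id I) auto
    with * have "I +> a \<in> (+>) I ` (Idl (I \<union> S))" by auto
    then show "a \<in> Idl (I \<union> S)"
      using coset_in_image_iff[OF id _ a] genideal_self[OF sub] by auto
  next
    assume *: "a \<in> Idl (I \<union> S)"
    have "Idl (I \<union> S) \<subseteq> {a \<in> carrier R. I +> a \<in> Idl\<^bsub>R Quot I\<^esub> ((+>) I ` S)}"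
      using subset_coset_vimage[OF idQ] ring.genideal_self[OF ring_Quot subQ] S
      by (intro genideal_minimal ideal_coset_vimage idQ) auto
    with * show "I +> a \<in> Idl\<^bsub>R Quot I\<^esub> ((+>) I ` S)" by auto
  qed
qed

lemma primeideal_coset_image:
  assumes J: "primeideal J R" "I \<subseteq> J"
  shows "primeideal ((+>) I ` J) (R Quot I)"
proof (rule primeidealI)
  interpret J: primeideal J R by fact
  have idJ: "ideal J R" by (rule J.is_ideal)
  show "ideal ((+>) I ` J) (R Quot I)" using I idJ by (rule ring_ideal_imp_quot_ideal)
  show "cring (R Quot I)" by (rule cring_Quot)
  show "carrier (R Quot I) \<noteq> (+>) I ` J"
  proof
    assume "carrier (R Quot I) = (+>) I ` J"
    then have "I +> \<one> \<in> (+>) I ` J" by (auto simp: carrier_Quot)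
    then have "\<one> \<in> J" using coset_in_image_iff[OF idJ J(2)] by auto
    then show False using J.I_notcarr J.one_imp_carrier by auto
  qed
  fix x y assume "x \<in> carrier (R Quot I)" "y \<in> carrier (R Quot I)" "x \<otimes>\<^bsub>R Quot I\<^esub> y \<in> (+>) I ` J"
  then obtain a b where ab: "a \<in> carrier R" "b \<in> carrier R" "x = I +> a" "y = I +> b"
      "I +> (a \<otimes> b) \<in> (+>) I ` J"
    by (auto simp: carrier_Quot coset_mult)
  then have "a \<otimes> b \<in> J" using coset_in_image_iff[OF idJ J(2)] by auto
  then show "x \<in> (+>) I ` J \<or> y \<in> (+>) I ` J"
    using J.I_prime[of a b] ab by auto
qed

lemma primeideal_coset_vimage:
  assumes J: "primeideal J (R Quot I)"
  shows "primeideal {a \<in> carrier R. I +> a \<in> J} R"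
proof (rule primeidealI)
  interpret J: primeideal J "R Quot I" by fact
  show "ideal {a \<in> carrier R. I +> a \<in> J} R" by (rule ideal_coset_vimage) (rule J.is_ideal)
  show "carrier R \<noteq> {a \<in> carrier R. I +> a \<in> J}"
    using J.I_notcarr J.a_subset by (auto simp: carrier_Quot)
  show "a \<in> {a \<in> carrier R. I +> a \<in> J} \<or> b \<in> {a \<in> carrier R. I +> a \<in> J}"
    if "a \<in> carrier R" "b \<in> carrier R" "a \<otimes> b \<in> {a \<in> carrier R. I +> a \<in> J}" for a b
    using that J.I_prime[of "I +> a" "I +> b"] by (auto simp: carrier_Quot coset_mult)
qed (rule R)

lemma noetherian_Quot:
  assumes "noetherian_ring R"
  shows "noetherian_ring (R Quot I)"
proof (rule ring.noetherian_ringI[OF ring_Quot])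
  fix J assume J: "ideal J (R Quot I)"
  define J' where "J' = {a \<in> carrier R. I +> a \<in> J}"
  have J': "ideal J' R" "I \<subseteq> J'"
    unfolding J'_def using J by (rule ideal_coset_vimage, rule subset_coset_vimage)
  obtain A where A: "A \<subseteq> carrier R" "finite A" "J' = Idl A"
    using noetherian_ring.finetely_gen[OF assms J'(1)] by blast
  have AQ: "(+>) I ` A \<subseteq> carrier (R Quot I)" using A by (auto simp: carrier_Quot)
  have "J = Idl\<^bsub>R Quot I\<^esub> ((+>) I ` A)"
  proof
    show "J \<subseteq> Idl\<^bsub>R Quot I\<^esub> ((+>) I ` A)"
    proof
      fix x assume x: "x \<in> J"
      then have "x \<in> carrier (R Quot I)" using ideal.Icarr[OF J] by auto
      then obtain a where a: "a \<in> carrier R" "x = I +> a" by (auto simp: carrier_Quot)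
      with x have "a \<in> Idl A" using A by (auto simp: J'_def)
      moreover have "Idl A \<subseteq> Idl (I \<union> A)"
        using A I.a_subset by (intro Idl_subset_Idl order_trans[OF _ genideal_self]) auto
      ultimately show "x \<in> Idl\<^bsub>R Quot I\<^esub> ((+>) I ` A)"
        using coset_in_Idl_iff[OF A(1) a(1)] a by auto
    qed
    show "Idl\<^bsub>R Quot I\<^esub> ((+>) I ` A) \<subseteq> J"
      using genideal_self[OF A(1)] A(3) by (intro ring.genideal_minimal[OF ring_Quot] J) (auto simp: J'_def)
  qed
  then show "\<exists>A\<subseteq>carrier (R Quot I). finite A \<and> J = Idl\<^bsub>R Quot I\<^esub> A" using A AQ by blast
qed

end

section \<open>Subrings of a commutative ring type\<close>

text \<open>Polynomial rings in different sets of variables share one type, so a ring is given by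
  its carrier alone. Calculations use the type class, and the algebra library is reached through
  \<open>ring_of\<close>.\<close>

definition ring_of :: "'a::comm_ring_1 set \<Rightarrow> 'a ring" where
  "ring_of R = \<lparr>carrier = R, mult = (*), one = 1, zero = 0, add = (+)\<rparr>"

lemma ring_of_simps [simp]:
  "carrier (ring_of R) = R" "x \<otimes>\<^bsub>ring_of R\<^esub> y = x * y" "x \<oplus>\<^bsub>ring_of R\<^esub> y = x + y"
  "\<one>\<^bsub>ring_of R\<^esub> = 1" "\<zero>\<^bsub>ring_of R\<^esub> = 0"
  by (simp_all add: ring_of_def)

locale subring_set =
  fixes R :: "'a::comm_ring_1 set"
  assumes one_mem: "1 \<in> R"
    and diff_mem: "a \<in> R \<Longrightarrow> b \<in> R \<Longrightarrow> a - b \<in> R"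
    and mult_mem: "a \<in> R \<Longrightarrow> b \<in> R \<Longrightarrow> a * b \<in> R"
begin

lemma zero_mem: "0 \<in> R"
  using diff_mem[OF one_mem one_mem] by simp

lemma uminus_mem: "a \<in> R \<Longrightarrow> - a \<in> R"
  using diff_mem[OF zero_mem] by force

lemma add_mem: "a \<in> R \<Longrightarrow> b \<in> R \<Longrightarrow> a + b \<in> R"
  using diff_mem[of a "- b"] uminus_mem[of b] by simp

lemma power_mem: "a \<in> R \<Longrightarrow> a ^ k \<in> R"
  by (induction k) (auto simp: one_mem mult_mem)

lemma sum_mem: "(\<And>i. i \<in> A \<Longrightarrow> f i \<in> R) \<Longrightarrow> sum f A \<in> R"
  by (induction A rule: infinite_finite_induct) (auto simp: zero_mem add_mem)

lemma prod_mem: "(\<And>i. i \<in> A \<Longrightarrow> f i \<in> R) \<Longrightarrow> prod f A \<in> R"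
  by (induction A rule: infinite_finite_induct) (auto simp: one_mem mult_mem)

lemma cring_ring_of: "cring (ring_of R)"
proof (intro cringI abelian_groupI comm_monoidI, goal_cases)
  case (6 x)
  then show ?case
    by (intro bexI[of _ "- x"]) (auto simp: uminus_mem)
qed (auto simp: algebra_simps add_mem mult_mem zero_mem one_mem)

end

definition ideal_in :: "'a::comm_ring_1 set \<Rightarrow> 'a set \<Rightarrow> bool" where
  "ideal_in R I \<longleftrightarrow> I \<subseteq> R \<and> 0 \<in> I \<and> (\<forall>a\<in>I. \<forall>b\<in>I. a + b \<in> I) \<and> (\<forall>a\<in>I. \<forall>r\<in>R. a * r \<in> I)"

definition prime_in :: "'a::comm_ring_1 set \<Rightarrow> 'a set \<Rightarrow> bool" where
  "prime_in R P \<longleftrightarrow> ideal_in R P \<and> 1 \<notin> P \<and> (\<forall>a\<in>R. \<forall>b\<in>R. a * b \<in> P \<longrightarrow> a \<in> P \<or> b \<in> P)"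

lemma ideal_inD:
  assumes "ideal_in R I"
  shows "a \<in> I \<Longrightarrow> a \<in> R" "0 \<in> I" "a \<in> I \<Longrightarrow> b \<in> I \<Longrightarrow> a + b \<in> I"
    "a \<in> I \<Longrightarrow> r \<in> R \<Longrightarrow> a * r \<in> I" "a \<in> I \<Longrightarrow> r \<in> R \<Longrightarrow> r * a \<in> I"
  using assms by (auto simp: ideal_in_def mult.commute[of r a])

context subring_set
begin

lemma ideal_in_uminus: "ideal_in R I \<Longrightarrow> a \<in> I \<Longrightarrow> - a \<in> I"
  using ideal_inD(4)[of R I a "-1"] uminus_mem[OF one_mem] by simp

lemma ideal_in_diff: "ideal_in R I \<Longrightarrow> a \<in> I \<Longrightarrow> b \<in> I \<Longrightarrow> a - b \<in> I"
  using ideal_inD(3)[of R I a "-b"] ideal_in_uminus[of I b] by simp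

lemma ideal_in_sum: "ideal_in R I \<Longrightarrow> (\<And>i. i \<in> A \<Longrightarrow> f i \<in> I) \<Longrightarrow> sum f A \<in> I"
  by (induction A rule: infinite_finite_induct) (auto simp: ideal_inD)

lemma ideal_iff: "ideal I (ring_of R) \<longleftrightarrow> ideal_in R I"
proof
  assume "ideal I (ring_of R)"
  then interpret I: ideal I "ring_of R" .
  show "ideal_in R I"
    unfolding ideal_in_def
    using I.a_subset additive_subgroup.zero_closed[OF I.is_additive_subgroup, unfolded ring_of_simps]
      additive_subgroup.a_closed[OF I.is_additive_subgroup, unfolded ring_of_simps]
      I.I_r_closed[unfolded ring_of_simps] by auto
next
  assume I: "ideal_in R I"
  interpret cring "ring_of R" by (rule cring_ring_of)
  have minus: "\<ominus>\<^bsub>ring_of R\<^esub> a = - a" if "a \<in> R" for a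
    using that by (intro minus_equality) (auto simp: uminus_mem)
  show "ideal I (ring_of R)"
  proof (intro idealI ring_axioms subgroup.intro)
    fix a assume "a \<in> I"
    then have "inv\<^bsub>add_monoid (ring_of R)\<^esub> a = - a"
      using minus[of a] ideal_inD(1)[OF I] by (simp add: a_inv_def)
    then show "inv\<^bsub>add_monoid (ring_of R)\<^esub> a \<in> I"
      using \<open>a \<in> I\<close> ideal_in_uminus[OF I] by simp
  qed (use ideal_inD[OF I] in auto)
qed

lemma primeideal_iff: "primeideal P (ring_of R) \<longleftrightarrow> prime_in R P"
proof
  assume "primeideal P (ring_of R)"
  then interpret P: primeideal P "ring_of R" .
  have "1 \<notin> P" using P.one_imp_carrier P.I_notcarr by auto
  then show "prime_in R P"
    unfolding prime_in_def using P.I_prime P.is_ideal by (auto simp: ideal_iff)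
next
  assume P: "prime_in R P"
  show "primeideal P (ring_of R)"
    by (rule primeidealI) (use P one_mem cring_ring_of in \<open>auto simp: prime_in_def ideal_iff\<close>)
qed

section \<open>Weakly regular sequences modulo an ideal\<close>

definition adj :: "'a set \<Rightarrow> 'a \<Rightarrow> 'a set" where
  "adj I f = {i + f * b | i b. i \<in> I \<and> b \<in> R}"

definition colon :: "'a set \<Rightarrow> 'a \<Rightarrow> 'a set" where
  "colon I y = {a \<in> R. y * a \<in> I}"

definition nzd :: "'a set \<Rightarrow> 'a \<Rightarrow> bool" where
  "nzd I f \<longleftrightarrow> (\<forall>a\<in>R. f * a \<in> I \<longrightarrow> a \<in> I)"

text \<open>None of the ideals is required to be proper, so every sequence is weakly regular modulo
  \<open>R\<close> itself. Extensions may then have a zero end; properness is supplied only in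
  \<open>regular_sequence_Quot\<close>.\<close>

fun wreg :: "'a set \<Rightarrow> 'a list \<Rightarrow> bool" where
  "wreg I [] = True"
| "wreg I (f # fs) = (nzd I f \<and> wreg (adj I f) fs)"

lemma adjI: "i \<in> I \<Longrightarrow> b \<in> R \<Longrightarrow> i + f * b \<in> adj I f"
  by (auto simp: adj_def)

lemma adjE:
  assumes "a \<in> adj I f"
  obtains i b where "a = i + f * b" "i \<in> I" "b \<in> R"
  using assms by (auto simp: adj_def)

lemma nzdD: "nzd I f \<Longrightarrow> a \<in> R \<Longrightarrow> f * a \<in> I \<Longrightarrow> a \<in> I"
  by (auto simp: nzd_def)

lemma ideal_adj:
  assumes I: "ideal_in R I" and f: "f \<in> R"
  shows "ideal_in R (adj I f)"
  unfolding ideal_in_def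
proof (intro conjI ballI)
  show "adj I f \<subseteq> R" using ideal_inD(1)[OF I] f by (auto simp: adj_def add_mem mult_mem)
  show "0 \<in> adj I f" using adjI[OF ideal_inD(2)[OF I] zero_mem, of f] by simp
next
  fix a b assume "a \<in> adj I f" "b \<in> adj I f"
  then obtain i j u v where "a = i + f * u" "b = j + f * v" "i \<in> I" "j \<in> I" "u \<in> R" "v \<in> R"
    by (auto elim!: adjE)
  then have "a + b = (i + j) + f * (u + v)" "i + j \<in> I" "u + v \<in> R"
    using ideal_inD(3)[OF I] by (auto simp: algebra_simps add_mem)
  then show "a + b \<in> adj I f" using adjI by metis
next
  fix a r assume "a \<in> adj I f" and r: "r \<in> R"
  then obtain i u where "a = i + f * u" "i \<in> I" "u \<in> R" by (auto elim!: adjE)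
  then have "a * r = i * r + f * (u * r)" "i * r \<in> I" "u * r \<in> R"
    using ideal_inD(4)[OF I] r by (auto simp: algebra_simps mult_mem)
  then show "a * r \<in> adj I f" using adjI by metis
qed

lemma adj_superset: "I \<subseteq> adj I f"
  using adjI[OF _ zero_mem, of _ I f] by auto

lemma mem_adj: "ideal_in R I \<Longrightarrow> f \<in> adj I f"
  using adjI[of 0 I 1 f] ideal_inD(2)[of R I] one_mem by auto

lemma adj_minimal:
  assumes "ideal_in R J" "I \<subseteq> J" "f \<in> J"
  shows "adj I f \<subseteq> J"
  using assms by (auto elim!: adjE intro!: ideal_inD(3,4)[OF assms(1)])

lemma adj_carrier: "f \<in> R \<Longrightarrow> adj R f = R"
  using adj_superset[of R f] by (auto elim!: adjE intro: add_mem mult_mem)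

lemma wreg_carrier: "set fs \<subseteq> R \<Longrightarrow> wreg R fs"
  by (induction fs) (auto simp: nzd_def adj_carrier)

lemma adj_one: "ideal_in R I \<Longrightarrow> adj I 1 = R"
proof -
  assume I: "ideal_in R I"
  have "a \<in> adj I 1" if "a \<in> R" for a
    using adjI[OF ideal_inD(2)[OF I] that, of 1] by simp
  then show ?thesis using ideal_inD(1)[OF ideal_adj[OF I one_mem]] by blast
qed

lemma adj_commute: "adj (adj I f) g = adj (adj I g) f"
proof -
  have "adj (adj I f) g \<subseteq> adj (adj I g) f" for f g
  proof
    fix a assume "a \<in> adj (adj I f) g"
    then obtain i u v where "a = (i + f * u) + g * v" and *: "i \<in> I" "u \<in> R" "v \<in> R"
      by (auto elim!: adjE)
    then have "a = (i + g * v) + f * u" by (simp add: algebra_simps)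
    then show "a \<in> adj (adj I g) f" using * adjI by metis
  qed
  then show ?thesis by blast
qed

lemma adj_cong:
  assumes I: "ideal_in R I" and "f \<in> R" "g \<in> R" "f - g \<in> I"
  shows "adj I f = adj I g"
proof -
  have *: "adj I f \<subseteq> adj I g" if "f \<in> R" "g \<in> R" "f - g \<in> I" for f g
  proof (rule adj_minimal)
    show "ideal_in R (adj I g)" using I that by (intro ideal_adj)
    show "I \<subseteq> adj I g" by (rule adj_superset)
    show "f \<in> adj I g" using adjI[OF that(3) one_mem, of g] by simp
  qed
  have "g - f \<in> I" using ideal_in_uminus[OF I assms(4)] by simp
  then show ?thesis using * assms by blast
qed

lemma nzd_cong:
  assumes I: "ideal_in R I" and "f - g \<in> I" "nzd I g"
  shows "nzd I f"
  unfolding nzd_def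
proof (intro ballI impI)
  fix a assume a: "a \<in> R" "f * a \<in> I"
  have "g * a = f * a - (f - g) * a" by (simp add: algebra_simps)
  also have "\<dots> \<in> I" using a assms(2) ideal_inD(4)[OF I] by (intro ideal_in_diff I) auto
  finally show "a \<in> I" using assms(3) a by (auto simp: nzd_def)
qed

lemma nzd_one: "nzd I 1"
  by (simp add: nzd_def)

lemma nzd_mult: "f \<in> R \<Longrightarrow> g \<in> R \<Longrightarrow> nzd I f \<Longrightarrow> nzd I g \<Longrightarrow> nzd I (f * g)"
  unfolding nzd_def mult.assoc using mult_mem by blast

lemma nzd_prod: "finite W \<Longrightarrow> (\<And>i. i \<in> W \<Longrightarrow> z i \<in> R \<and> nzd I (z i)) \<Longrightarrow> nzd I (prod z W)"
  by (induction W rule: finite_induct) (simp_all add: nzd_one nzd_mult prod_mem)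

text \<open>Exactness on the left survives modulo \<open>f\<close>: if \<open>y a = i + f c\<close>,
  then \<open>f c\<close> lies in \<open>I + y R\<close>, so \<open>c = j + y b\<close> by
  regularity of \<open>f\<close> there, and \<open>y (a - f b)\<close> lies in
  \<open>I\<close>.\<close>

lemma colon_adj:
  assumes I: "ideal_in R I" and f: "f \<in> R" and y: "y \<in> R" and nzd: "nzd (adj I y) f"
  shows "colon (adj I f) y = adj (colon I y) f"
proof
  show "adj (colon I y) f \<subseteq> colon (adj I f) y"
  proof
    fix a assume "a \<in> adj (colon I y) f"
    then obtain c b where *: "a = c + f * b" "c \<in> R" "y * c \<in> I" "b \<in> R"
      by (auto elim!: adjE simp: colon_def)
    then have "y * a = y * c + f * (y * b)" by (simp add: algebra_simps)
    then show "a \<in> colon (adj I f) y"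
      using * y f adjI[of "y * c" I "y * b" f] by (auto simp: colon_def add_mem mult_mem)
  qed
next
  show "colon (adj I f) y \<subseteq> adj (colon I y) f"
  proof
    fix a assume "a \<in> colon (adj I f) y"
    then obtain i c where *: "a \<in> R" "y * a = i + f * c" "i \<in> I" "c \<in> R"
      by (auto elim!: adjE simp: colon_def)
    have "f * c = - i + y * a" using * by simp
    then have "f * c \<in> adj I y" using adjI[OF ideal_in_uminus[OF I *(3)] *(1), of y] by simp
    then have "c \<in> adj I y" using nzdD[OF nzd *(4)] by simp
    then obtain j b where c: "c = j + y * b" "j \<in> I" "b \<in> R" by (auto elim!: adjE)
    have "y * (a - f * b) = i + j * f" using * c by (simp add: algebra_simps)
    also have "\<dots> \<in> I" using * c ideal_inD[OF I] f by auto
    finally have "a - f * b \<in> colon I y" using * c f by (auto simp: colon_def diff_mem mult_mem)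
    then have "(a - f * b) + f * b \<in> adj (colon I y) f" using c(3) by (rule adjI)
    then show "a \<in> adj (colon I y) f" by simp
  qed
qed

text \<open>The exact sequence \<open>0 \<rightarrow> R/(I : y) \<rightarrow> R/I \<rightarrow> R/(I + yR) \<rightarrow> 0\<close>, whose first map is
  multiplication by \<open>y\<close>, stays exact modulo an element that is regular on both ends.\<close>

lemma wreg_extension:
  assumes "ideal_in R I" "y \<in> R" "set fs \<subseteq> R" "wreg (adj I y) fs" "wreg (colon I y) fs"
  shows "wreg I fs"
  using assms
proof (induction fs arbitrary: I)
  case (Cons f fs)
  note I = Cons.prems(1) and y = Cons.prems(2)
  from Cons.prems have f: "f \<in> R" and n: "nzd (adj I y) f" "nzd (colon I y) f" by auto
  have "nzd I f"
    unfolding nzd_def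
  proof (intro ballI impI)
    fix a assume a: "a \<in> R" "f * a \<in> I"
    then have "f * a \<in> adj I y" using adj_superset by blast
    then have "a \<in> adj I y" using nzdD[OF n(1) a(1)] by simp
    then obtain i b where b: "a = i + y * b" "i \<in> I" "b \<in> R" by (auto elim!: adjE)
    have "y * (f * b) = f * a - i * f" using b by (simp add: algebra_simps)
    also have "\<dots> \<in> I" using a b f ideal_inD(4)[OF I] by (intro ideal_in_diff I) auto
    finally have "f * b \<in> colon I y" using b f by (auto simp: colon_def mult_mem)
    then have "y * b \<in> I" using nzdD[OF n(2) b(3)] by (auto simp: colon_def)
    then show "a \<in> I" using b ideal_inD(3)[OF I] by simp
  qed
  moreover have "wreg (adj I f) fs"
  proof (rule Cons.IH)
    show "ideal_in R (adj I f)" using I f by (rule ideal_adj)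
    show "wreg (adj (adj I f) y) fs" using Cons.prems(4) by (simp add: adj_commute)
    show "wreg (colon (adj I f) y) fs" using Cons.prems(5) colon_adj[OF I f y n(1)] by simp
  qed (use Cons.prems in auto)
  ultimately show ?case by simp
qed auto

text \<open>With \<open>adj_adj_dvd\<close> this gives the two ends of the extension for
  multiplication by \<open>q\<close> on \<open>R/(I + z q R)\<close>: one is
  \<open>R/(I + z R)\<close>, because \<open>q\<close> cancels modulo \<open>I\<close>, the other is
  \<open>R/(I + q R)\<close>.\<close>

lemma colon_mult_eq:
  assumes I: "ideal_in R I" and q: "q \<in> R" "nzd I q" and z: "z \<in> R"
  shows "colon (adj I (z * q)) q = adj I z"
proof
  show "colon (adj I (z * q)) q \<subseteq> adj I z"
  proof
    fix a assume "a \<in> colon (adj I (z * q)) q"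
    then obtain i b where *: "a \<in> R" "q * a = i + z * q * b" "i \<in> I" "b \<in> R"
      by (auto elim!: adjE simp: colon_def)
    have "q * (a - z * b) = i" using * by (simp add: algebra_simps)
    then have "a - z * b \<in> I" using * z nzdD[OF q(2), of "a - z * b"] by (simp add: diff_mem mult_mem)
    from adjI[OF this *(4), of z] show "a \<in> adj I z" by simp
  qed
  show "adj I z \<subseteq> colon (adj I (z * q)) q"
  proof
    fix a assume "a \<in> adj I z"
    then obtain i b where *: "a = i + z * b" "i \<in> I" "b \<in> R" by (auto elim!: adjE)
    have "q * a = i * q + z * q * b" using * by (simp add: algebra_simps)
    then show "a \<in> colon (adj I (z * q)) q"
      using * q z ideal_inD(1,4)[OF I] adjI[of "i * q" I b "z * q"]
      by (auto simp: colon_def add_mem mult_mem)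
  qed
qed

lemma adj_adj_dvd:
  assumes I: "ideal_in R I" and "q \<in> R" "z \<in> R"
  shows "adj (adj I (z * q)) q = adj I q"
proof
  have q: "ideal_in R (adj I q)" using assms by (intro ideal_adj)
  show "adj (adj I (z * q)) q \<subseteq> adj I q"
    using assms mem_adj[OF I, of q] ideal_inD(5)[OF q] adj_superset[of I q]
    by (intro adj_minimal q) auto
  have "ideal_in R (adj I (z * q))" using assms by (intro ideal_adj mult_mem)
  then show "adj I q \<subseteq> adj (adj I (z * q)) q"
    using assms adj_superset mem_adj by (intro adj_minimal ideal_adj mult_mem) blast+
qed

text \<open>One factor \<open>z i\<close> is split off at a time, with the product of the others as
  the multiplier of the extension. The empty product is 1, and modulo the whole ring every sequence
  is weakly regular.\<close>

lemma wreg_adj_prod: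
  assumes I: "ideal_in R I" and W: "finite W" and fs: "set fs \<subseteq> R"
    and z: "\<And>i. i \<in> W \<Longrightarrow> z i \<in> R \<and> nzd I (z i) \<and> wreg (adj I (z i)) fs"
  shows "wreg (adj I (prod z W)) fs"
  using W z
proof (induction W rule: finite_induct)
  case empty
  then show ?case using wreg_carrier[OF fs] adj_one[OF I] by simp
next
  case (insert i W)
  have q: "prod z W \<in> R" "nzd I (prod z W)"
    using insert by (auto intro!: prod_mem nzd_prod)
  have zi: "z i \<in> R" using insert by auto
  have "wreg (adj I (z i * prod z W)) fs"
  proof (rule wreg_extension[where y = "prod z W"])
    show "ideal_in R (adj I (z i * prod z W))" using q zi by (intro ideal_adj I mult_mem)
    show "wreg (adj (adj I (z i * prod z W)) (prod z W)) fs"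
      using insert adj_adj_dvd[OF I q(1) zi] by simp
    show "wreg (colon (adj I (z i * prod z W)) (prod z W)) fs"
      using insert colon_mult_eq[OF I q zi] by simp
  qed (use q fs in auto)
  then show ?case using insert by simp
qed

section \<open>Elementary symmetric polynomials form weakly regular sequences\<close>

definition esym :: "('i \<Rightarrow> 'a) \<Rightarrow> 'i set \<Rightarrow> nat \<Rightarrow> 'a" where
  "esym z U j = (\<Sum>T | T \<subseteq> U \<and> card T = j. \<Prod>i\<in>T. z i)"

lemma esym_mem: "(\<And>i. i \<in> U \<Longrightarrow> z i \<in> R) \<Longrightarrow> esym z U j \<in> R"
  unfolding esym_def by (intro sum_mem prod_mem) auto

lemma esym_card:
  assumes "finite U"
  shows "esym z U (card U) = prod z U"
proof -
  have "{T. T \<subseteq> U \<and> card T = card U} = {U}"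
    using card_subset_eq[OF assms] by blast
  then show ?thesis by (simp add: esym_def)
qed

text \<open>A product that occurs in only one of the two sums has a factor \<open>z i\<close> with
  \<open>i\<close> in \<open>U - V\<close>. This discards a variable once \<open>z i\<close> has
  been killed, and also the variables outside a facet.\<close>

lemma esym_diff_mem:
  assumes U: "finite U" "V \<subseteq> U" and J: "ideal_in R J"
    and z: "\<And>i. i \<in> U \<Longrightarrow> z i \<in> R" "\<And>i. i \<in> U - V \<Longrightarrow> z i \<in> J"
  shows "esym z U j - esym z V j \<in> J"
proof -
  let ?A = "{T. T \<subseteq> U \<and> card T = j}" and ?B = "{T. T \<subseteq> V \<and> card T = j}"
  have fin: "finite ?A" using U by simp
  have "?B \<subseteq> ?A" using U by auto
  then have "esym z U j - esym z V j = (\<Sum>T\<in>?A - ?B. prod z T)"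
    unfolding esym_def using fin by (simp add: sum_diff)
  also have "\<dots> \<in> J"
  proof (rule ideal_in_sum[OF J])
    fix T assume T: "T \<in> ?A - ?B"
    then obtain i where i: "i \<in> T" "i \<in> U - V" by auto
    have "finite T" using T U finite_subset by auto
    then have "prod z T = z i * prod z (T - {i})" using i by (simp add: prod.remove)
    also have "\<dots> \<in> J" using z i T by (intro ideal_inD(4)[OF J] prod_mem) auto
    finally show "prod z T \<in> J" .
  qed
  finally show ?thesis .
qed

text \<open>Up to \<open>r\<close> of the \<open>z i\<close> with distinct indices form a weakly
  regular sequence modulo \<open>I\<close> in every order. All orders are demanded because filtering
  by the factors of the product may kill any one of them next.\<close>

primrec indep_on :: "nat \<Rightarrow> ('i \<Rightarrow> 'a) \<Rightarrow> 'i set \<Rightarrow> 'a set \<Rightarrow> bool" where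
  "indep_on 0 z U I = True"
| "indep_on (Suc r) z U I = (\<forall>i\<in>U. nzd I (z i) \<and> indep_on r z (U - {i}) (adj I (z i)))"

text \<open>Modulo \<open>I\<close> the top element is the product of the \<open>z i\<close>, so \<open>R\<close> modulo that product is filtered by
  the rings \<open>R/(I + z i R)\<close>. There \<open>z i\<close> vanishes, and the remaining sequence is the one of
  \<open>U - {i}\<close>.\<close>

lemma wreg_esym:
  assumes "ideal_in R I" "finite U" "card U = r" "indep_on r z U I"
    and "\<And>i. i \<in> U \<Longrightarrow> z i \<in> R" "\<And>j. f j \<in> R" "\<And>j. f j - esym z U j \<in> I"
  shows "wreg I (map f (rev [1..<Suc r]))"
  using assms
proof (induction r arbitrary: I U)
  case (Suc r)
  note I = Suc.prems(1) and z = Suc.prems(5) and f = Suc.prems(6)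
  have nzd: "nzd I (z i)" "indep_on r z (U - {i}) (adj I (z i))" if "i \<in> U" for i
    using Suc.prems(4) that by auto
  have p: "prod z U \<in> R" using z by (intro prod_mem)
  have fp: "f (Suc r) - prod z U \<in> I"
    using Suc.prems(7)[of "Suc r"] esym_card[OF Suc.prems(2), of z] Suc.prems(3) by simp
  have "nzd I (f (Suc r))"
    using nzd z Suc.prems(2) by (intro nzd_cong[OF I fp] nzd_prod) auto
  moreover have "wreg (adj I (prod z U)) (map f (rev [1..<Suc r]))"
  proof (rule wreg_adj_prod[OF I Suc.prems(2)])
    show "set (map f (rev [1..<Suc r])) \<subseteq> R" using f by auto
    fix i assume i: "i \<in> U"
    have I': "ideal_in R (adj I (z i))" using i z by (intro ideal_adj I) auto
    \<comment> \<open>The sequence \<open>f\<close> stays fixed while \<open>U\<close> shrinks, as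
      products containing \<open>z i\<close> vanish modulo \<open>z i\<close>. This is why
      \<open>f\<close> agrees with the symmetric polynomials only modulo \<open>I\<close>.\<close>
    have "wreg (adj I (z i)) (map f (rev [1..<Suc r]))"
    proof (rule Suc.IH[OF I' _ _ nzd(2)[OF i]])
      fix j
      have "esym z U j - esym z (U - {i}) j \<in> adj I (z i)"
        using Suc.prems(2) z i mem_adj[OF I] by (intro esym_diff_mem I') auto
      moreover have "f j - esym z U j \<in> adj I (z i)"
        using Suc.prems(7) adj_superset by blast
      ultimately have "(f j - esym z U j) + (esym z U j - esym z (U - {i}) j) \<in> adj I (z i)"
        by (rule ideal_inD(3)[OF I', rotated])
      then show "f j - esym z (U - {i}) j \<in> adj I (z i)" by simp
    qed (use i Suc.prems z f in auto)
    then show "z i \<in> R \<and> nzd I (z i) \<and> wreg (adj I (z i)) (map f (rev [1..<Suc r]))"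
      using nzd z i by auto
  qed
  ultimately show ?case using adj_cong[OF I f p fp] by simp
qed simp

end

section \<open>Polynomials with coefficients in a subring\<close>

definition polys :: "'a::comm_ring_1 set \<Rightarrow> 'a poly set" where
  "polys A = {p. \<forall>i. coeff p i \<in> A}"

lemma polysD: "p \<in> polys A \<Longrightarrow> coeff p i \<in> A"
  by (simp add: polys_def)

lemma polys_mono: "A \<subseteq> B \<Longrightarrow> polys A \<subseteq> polys B"
  by (auto simp: polys_def)

text \<open>The element \<open>x\<close> may satisfy relations over \<open>R\<close>, so a member of
  \<open>R[x]\<close> has no degree of its own; degrees always refer to a chosen polynomial with
  that value.\<close>

definition ring_ext :: "'a::comm_ring_1 set \<Rightarrow> 'a \<Rightarrow> 'a set" where
  "ring_ext R x = (\<lambda>p. poly p x) ` polys R"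

context subring_set
begin

lemma const_polys: "0 \<in> I \<Longrightarrow> a \<in> I \<Longrightarrow> [:a:] \<in> polys I"
  by (auto simp: polys_def coeff_pCons split: nat.split)

lemma monom_polys: "0 \<in> I \<Longrightarrow> a \<in> I \<Longrightarrow> monom a k \<in> polys I"
  by (auto simp: polys_def)

lemma pCons0_polys: "0 \<in> I \<Longrightarrow> p \<in> polys I \<Longrightarrow> pCons 0 p \<in> polys I"
  by (auto simp: polys_def coeff_pCons split: nat.split)

lemma subring_polys: "subring_set (polys R)"
proof
  show "1 \<in> polys R" using const_polys[OF zero_mem one_mem] by (simp add: one_pCons)
  show "p - q \<in> polys R" "p * q \<in> polys R" if "p \<in> polys R" "q \<in> polys R" for p q
    using that by (auto simp: polys_def coeff_mult intro!: diff_mem sum_mem mult_mem)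
qed

interpretation polys: subring_set "polys R" by (rule subring_polys)

lemma ideal_polys: "ideal_in R I \<Longrightarrow> ideal_in (polys R) (polys I)"
proof -
  assume I: "ideal_in R I"
  have "coeff (p * q) n \<in> I" if "p \<in> polys I" "q \<in> polys R" for p q n
    unfolding coeff_mult using polysD[OF that(1)] polysD[OF that(2)]
    by (intro ideal_in_sum[OF I] ideal_inD(4)[OF I])
  then show ?thesis
    using ideal_inD(1-3)[OF I] unfolding ideal_in_def by (auto simp: polys_def)
qed

lemma const_polys_iff: "0 \<in> I \<Longrightarrow> [:a:] \<in> polys I \<longleftrightarrow> a \<in> I"
  using polysD[of "[:a:]" I 0] const_polys by auto

lemma subset_ring_ext: "R \<subseteq> ring_ext R x"
  using const_polys[OF zero_mem] by (force simp: ring_ext_def)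

lemma mem_ring_ext: "x \<in> ring_ext R x"
  unfolding ring_ext_def using pCons0_polys[OF zero_mem polys.one_mem]
  by (intro image_eqI[of _ _ "[:0, 1:]"]) (auto simp: one_pCons)

lemma poly_mem_ring_ext: "p \<in> polys R \<Longrightarrow> poly p x \<in> ring_ext R x"
  by (simp add: ring_ext_def)

lemma subring_ring_ext: "subring_set (ring_ext R x)"
proof
  show "1 \<in> ring_ext R x" using subset_ring_ext one_mem by blast
  fix a b assume "a \<in> ring_ext R x" "b \<in> ring_ext R x"
  then obtain p q where "p \<in> polys R" "q \<in> polys R" "a = poly p x" "b = poly q x"
    by (auto simp: ring_ext_def)
  then show "a - b \<in> ring_ext R x" "a * b \<in> ring_ext R x"
    using poly_mem_ring_ext[of "p - q" x] poly_mem_ring_ext[of "p * q" x]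
    by (simp_all add: polys.diff_mem polys.mult_mem)
qed

section \<open>Hilbert's basis theorem\<close>

abbreviation Idl_R :: "'a set \<Rightarrow> 'a set" where
  "Idl_R A \<equiv> genideal (ring_of R) A"

lemma ideal_Idl: "A \<subseteq> R \<Longrightarrow> ideal_in R (Idl_R A)"
  using ring.genideal_ideal[OF cring.axioms(1)[OF cring_ring_of]] by (simp add: ideal_iff)

lemma Idl_superset: "A \<subseteq> R \<Longrightarrow> A \<subseteq> Idl_R A"
  using ring.genideal_self[OF cring.axioms(1)[OF cring_ring_of]] by simp

lemma Idl_minimal: "ideal_in R J \<Longrightarrow> A \<subseteq> J \<Longrightarrow> Idl_R A \<subseteq> J"
  using ring.genideal_minimal[OF cring.axioms(1)[OF cring_ring_of]] by (simp add: ideal_iff)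

text \<open>The degree is only bounded by \<open>m\<close>, so the coefficient may be zero. This
  makes the set closed under sums and, by multiplication with \<open>x\<close>, increasing in
  \<open>m\<close>.\<close>

definition lead_coeffs :: "'a \<Rightarrow> 'a set \<Rightarrow> nat \<Rightarrow> 'a set" where
  "lead_coeffs x J m = {coeff p m | p. p \<in> polys R \<and> degree p \<le> m \<and> poly p x \<in> J}"

lemma ideal_lead_coeffs:
  assumes J: "ideal_in (ring_ext R x) J"
  shows "ideal_in R (lead_coeffs x J m)"
  unfolding ideal_in_def
proof (intro conjI ballI)
  show "lead_coeffs x J m \<subseteq> R" by (auto simp: lead_coeffs_def polysD)
  show "0 \<in> lead_coeffs x J m"
    unfolding lead_coeffs_def using polys.zero_mem ideal_inD(2)[OF J]
    by (intro CollectI exI[of _ 0]) auto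
next
  fix a b assume "a \<in> lead_coeffs x J m" "b \<in> lead_coeffs x J m"
  then obtain p q where "a = coeff p m" "b = coeff q m" "p \<in> polys R" "q \<in> polys R"
     "degree p \<le> m" "degree q \<le> m" "poly p x \<in> J" "poly q x \<in> J"
    by (auto simp: lead_coeffs_def)
  then show "a + b \<in> lead_coeffs x J m"
    unfolding lead_coeffs_def using ideal_inD(3)[OF J]
    by (intro CollectI exI[of _ "p + q"]) (auto simp: polys.add_mem degree_add_le)
next
  fix a r assume "a \<in> lead_coeffs x J m" and r: "r \<in> R"
  then obtain p where p: "a = coeff p m" "p \<in> polys R" "degree p \<le> m" "poly p x \<in> J"
    by (auto simp: lead_coeffs_def)
  have "[:r:] \<in> polys R" using r zero_mem by (intro const_polys)
  moreover have "poly p x * r \<in> J"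
    using ideal_inD(4)[OF J p(4)] r subset_ring_ext by blast
  moreover have "degree (p * [:r:]) \<le> m"
    using degree_mult_le[of p "[:r:]"] p by simp
  ultimately show "a * r \<in> lead_coeffs x J m"
    unfolding lead_coeffs_def using p polys.mult_mem[of p "[:r:]"]
    by (intro CollectI exI[of _ "p * [:r:]"]) (auto simp: mult.commute)
qed

lemma lead_coeffs_Suc:
  assumes J: "ideal_in (ring_ext R x) J"
  shows "lead_coeffs x J m \<subseteq> lead_coeffs x J (Suc m)"
proof
  fix a assume "a \<in> lead_coeffs x J m"
  then obtain p where p: "a = coeff p m" "p \<in> polys R" "degree p \<le> m" "poly p x \<in> J"
    by (auto simp: lead_coeffs_def)
  have "degree (pCons 0 p) \<le> Suc m" using p by (metis Suc_le_mono degree_pCons_le le_trans)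
  moreover have "x * poly p x \<in> J" using ideal_inD(5)[OF J p(4)] mem_ring_ext by blast
  ultimately show "a \<in> lead_coeffs x J (Suc m)"
    unfolding lead_coeffs_def using p pCons0_polys[OF zero_mem p(2)]
    by (intro CollectI exI[of _ "pCons 0 p"]) auto
qed

lemma lead_coeffs_mono:
  "ideal_in (ring_ext R x) J \<Longrightarrow> m \<le> n \<Longrightarrow> lead_coeffs x J m \<subseteq> lead_coeffs x J n"
  using lift_Suc_mono_le[of "lead_coeffs x J"] lead_coeffs_Suc by blast

text \<open>From an element of \<open>K\<close> with a representative of degree at most
  \<open>m\<close>, an element of \<open>J\<close> with the same coefficient in degree
  \<open>m\<close> is subtracted; the difference has a representative of smaller degree.\<close>

lemma eq_if_lead_coeffs_subset:
  assumes J: "ideal_in (ring_ext R x) J" and K: "ideal_in (ring_ext R x) K"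
    and JK: "J \<subseteq> K" and sub: "\<And>m. lead_coeffs x K m \<subseteq> lead_coeffs x J m"
  shows "J = K"
proof -
  interpret E: subring_set "ring_ext R x" by (rule subring_ring_ext)
  have *: "poly p x \<in> J" if "p \<in> polys R" "poly p x \<in> K" "degree p < m" for p m
    using that
  proof (induction m arbitrary: p)
    case (Suc m)
    then have "coeff p m \<in> lead_coeffs x K m" by (auto simp: lead_coeffs_def)
    then obtain q where q: "coeff p m = coeff q m" "q \<in> polys R" "degree q \<le> m" "poly q x \<in> J"
      using sub by (auto simp: lead_coeffs_def)
    have pq: "poly (p - q) x \<in> K" "p - q \<in> polys R"
      using Suc.prems q JK E.ideal_in_diff[OF K] by (auto simp: polys.diff_mem)
    have "poly (p - q) x \<in> J"
    \<comment> \<open>For \<open>m = 0\<close> no smaller degree is left: both polynomials are the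
      same constant, and the difference is zero.\<close>
    proof (cases "m = 0")
      case True
      then have "degree p = 0" "degree q = 0" using Suc.prems q by auto
      then have "p = q" using q(1) True degree_0_id[of p] degree_0_id[of q] by metis
      then show ?thesis using ideal_inD(2)[OF J] by simp
    next
      case False
      have "degree (p - q) \<le> m" using Suc.prems q by (intro degree_diff_le) auto
      moreover have "degree (p - q) \<noteq> m"
      proof
        assume d: "degree (p - q) = m"
        then have "coeff (p - q) (degree (p - q)) = 0" using q by simp
        then have "p - q = 0" by (simp only: leading_coeff_0_iff)
        then show False using d False by simp
      qed
      ultimately show ?thesis using Suc.IH[OF pq(2,1)] by simp
    qed
    then have "poly (p - q) x + poly q x \<in> J" using q ideal_inD(3)[OF J] by blast
    then show ?case by simp
  qed simp
  have "K \<subseteq> J"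
  proof
    fix a assume "a \<in> K"
    then obtain p where "p \<in> polys R" "a = poly p x" "poly p x \<in> K"
      using ideal_inD(1)[OF K] unfolding ring_ext_def by blast
    then show "a \<in> J" using *[of p "Suc (degree p)"] by simp
  qed
  then show ?thesis using JK by blast
qed

text \<open>The leading-coefficient ideals form a chain that stabilizes at some \<open>k\<close>.
  Lifts of finitely many generators for each degree up to \<open>k\<close> generate an ideal
  \<open>J\<close> inside \<open>K\<close> with the same leading coefficients in those degrees,
  hence in all.\<close>

theorem hilbert_basis:
  assumes noeth: "noetherian_ring (ring_of R)"
  shows "noetherian_ring (ring_of (ring_ext R x))"
proof -
  interpret N: noetherian_ring "ring_of R" by fact
  interpret E: subring_set "ring_ext R x" by (rule subring_ring_ext)
  show ?thesis
  proof (rule ring.noetherian_ringI[OF cring.axioms(1)[OF E.cring_ring_of]])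
    fix K assume "ideal K (ring_of (ring_ext R x))"
    then have K: "ideal_in (ring_ext R x) K" by (simp add: E.ideal_iff)
    note L = ideal_lead_coeffs[OF K] and mono = lead_coeffs_mono[OF K]
    have "\<Union> (range (lead_coeffs x K)) \<in> range (lead_coeffs x K)"
    proof (rule N.ideal_chain_is_trivial)
      show "subset.chain {I. ideal I (ring_of R)} (range (lead_coeffs x K))"
        unfolding pred_on.chain_def
      proof (intro conjI ballI)
        show "range (lead_coeffs x K) \<subseteq> {I. ideal I (ring_of R)}" using L by (auto simp: ideal_iff)
        fix A B assume "A \<in> range (lead_coeffs x K)" "B \<in> range (lead_coeffs x K)"
        then obtain m n where "A = lead_coeffs x K m" "B = lead_coeffs x K n" by auto
        then show "(\<subset>)\<^sup>=\<^sup>= A B \<or> (\<subset>)\<^sup>=\<^sup>= B A"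
          using mono[of m n] mono[of n m] linear[of m n] by auto
      qed
    qed simp
    then obtain k where k: "\<Union> (range (lead_coeffs x K)) = lead_coeffs x K k" by blast
    have "\<exists>A. A \<subseteq> R \<and> finite A \<and> lead_coeffs x K m = Idl_R A" for m
      using N.finetely_gen[of "lead_coeffs x K m"] L by (auto simp: ideal_iff)
    then obtain A where A: "\<And>m. A m \<subseteq> R" "\<And>m. finite (A m)" "\<And>m. lead_coeffs x K m = Idl_R (A m)"
      by metis
    define P where "P m a = (SOME p. coeff p m = a \<and> p \<in> polys R \<and> degree p \<le> m \<and> poly p x \<in> K)" for m a
    have P: "coeff (P m a) m = a \<and> P m a \<in> polys R \<and> degree (P m a) \<le> m \<and> poly (P m a) x \<in> K"
      if "a \<in> A m" for a m
    proof -
      have "a \<in> lead_coeffs x K m" using that A Idl_superset by blast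
      then have "\<exists>p. coeff p m = a \<and> p \<in> polys R \<and> degree p \<le> m \<and> poly p x \<in> K"
        by (auto simp: lead_coeffs_def)
      then show ?thesis unfolding P_def by (rule someI_ex)
    qed
    define G where "G = (\<Union>m\<le>k. (\<lambda>a. poly (P m a) x) ` A m)"
    have G: "finite G" "G \<subseteq> K" "G \<subseteq> ring_ext R x"
      unfolding G_def using A P poly_mem_ring_ext by auto
    define J where "J = E.Idl_R G"
    have J: "ideal_in (ring_ext R x) J" "J \<subseteq> K" "G \<subseteq> J"
      unfolding J_def using E.ideal_Idl G E.Idl_minimal[OF K] E.Idl_superset by auto
    have low: "lead_coeffs x K m \<subseteq> lead_coeffs x J m" if "m \<le> k" for m
    proof -
      have "A m \<subseteq> lead_coeffs x J m"
      proof
        fix a assume a: "a \<in> A m"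
        then have "poly (P m a) x \<in> J" using J that by (auto simp: G_def)
        with P[OF a] show "a \<in> lead_coeffs x J m"
          unfolding lead_coeffs_def by (intro CollectI exI[of _ "P m a"]) simp
      qed
      then show ?thesis unfolding A(3) using ideal_lead_coeffs[OF J(1)] by (intro Idl_minimal)
    qed
    have "J = K"
    proof (rule eq_if_lead_coeffs_subset[OF J(1) K J(2)])
      fix m
      show "lead_coeffs x K m \<subseteq> lead_coeffs x J m"
      proof (cases "m \<le> k")
        case False
        have "lead_coeffs x K m \<subseteq> lead_coeffs x K k" using k by blast
        then show ?thesis using low[of k] lead_coeffs_mono[OF J(1), of k m] False by auto
      qed (rule low)
    qed
    then show "\<exists>A\<subseteq>carrier (ring_of (ring_ext R x)). finite A \<and> K = genideal (ring_of (ring_ext R x)) A"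
      using G J_def by auto
  qed
qed

section \<open>Going down a simple ring extension (Goldman domains)\<close>

text \<open>The quotient \<open>R/Q\<close> by the prime ideal \<open>Q\<close> is a Goldman domain. This holds trivially if \<open>Q\<close> is
  maximal.\<close>

definition goldman :: "'a set \<Rightarrow> bool" where
  "goldman Q \<longleftrightarrow> (\<exists>a\<in>R. a \<notin> Q \<and> (\<forall>P. prime_in R P \<longrightarrow> Q \<subset> P \<longrightarrow> a \<in> P))"

lemma prime_in_avoiding:
  assumes "ideal_in R I" "S \<subseteq> R" "1 \<in> S" "S \<inter> I = {}"
    and "\<And>s t. s \<in> S \<Longrightarrow> t \<in> S \<Longrightarrow> s * t \<in> S"
  shows "\<exists>P. prime_in R P \<and> I \<subseteq> P \<and> S \<inter> P = {}"
  using cring.exists_primeideal_avoiding[OF cring_ring_of, of I S] assms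
  by (simp add: ideal_iff primeideal_iff)

lemma prime_in_power:
  assumes "prime_in R P" "a \<in> R" "a \<notin> P"
  shows "a ^ k \<notin> P"
proof (induction k)
  case (Suc k)
  then show ?case using assms power_mem[OF assms(2)] by (auto simp: prime_in_def)
qed (use assms in \<open>auto simp: prime_in_def\<close>)

section \<open>Degrees modulo a prime ideal, and pseudo-division\<close>

lemma exists_top_coeff:
  assumes "0 \<in> Q" "p \<notin> polys Q"
  shows "\<exists>m. coeff p m \<notin> Q \<and> (\<forall>i>m. coeff p i \<in> Q)"
proof -
  let ?A = "{i. coeff p i \<notin> Q}"
  have "?A \<subseteq> {..degree p}" using assms le_degree by force
  then have fin: "finite ?A" by (rule finite_subset) simp
  moreover have "?A \<noteq> {}" using assms by (auto simp: polys_def)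
  ultimately have "Max ?A \<in> ?A" by (rule Max_in)
  moreover have "coeff p i \<in> Q" if "i > Max ?A" for i
    using Max_ge[OF fin, of i] that by fastforce
  ultimately show ?thesis by blast
qed

text \<open>Degrees modulo \<open>Q\<close> add because \<open>R/Q\<close> is a domain: every other
  term of the convolution has a factor beyond one of the two top positions, hence in
  \<open>Q\<close>.\<close>

lemma top_coeff_mult:
  assumes Q: "prime_in R Q" and p: "p \<in> polys R" and q: "q \<in> polys R"
    and m: "coeff p m \<notin> Q" "\<And>i. i > m \<Longrightarrow> coeff p i \<in> Q"
    and n: "coeff q n \<notin> Q" "\<And>i. i > n \<Longrightarrow> coeff q i \<in> Q"
  shows "coeff (p * q) (m + n) \<notin> Q"
proof
  assume a: "coeff (p * q) (m + n) \<in> Q"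
  have I: "ideal_in R Q" using Q by (simp add: prime_in_def)
  have "coeff (p * q) (m + n) = (\<Sum>i\<le>m + n. coeff p i * coeff q (m + n - i))"
    by (simp add: coeff_mult)
  also have "\<dots> = coeff p m * coeff q n + (\<Sum>i\<in>{..m + n} - {m}. coeff p i * coeff q (m + n - i))"
    by (subst sum.remove[of _ m]) auto
  finally have eq: "coeff p m * coeff q n = coeff (p * q) (m + n)
      - (\<Sum>i\<in>{..m + n} - {m}. coeff p i * coeff q (m + n - i))" by simp
  have "(\<Sum>i\<in>{..m + n} - {m}. coeff p i * coeff q (m + n - i)) \<in> Q"
  proof (rule ideal_in_sum[OF I])
    fix i assume "i \<in> {..m + n} - {m}"
    then consider "i > m" | "m + n - i > n" by force
    then show "coeff p i * coeff q (m + n - i) \<in> Q"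
      by cases (use m n polysD[OF p] polysD[OF q] ideal_inD(4,5)[OF I] in auto)
  qed
  then have "coeff p m * coeff q n \<in> Q"
    unfolding eq using a by (intro ideal_in_diff[OF I])
  then show False using Q m(1) n(1) polysD[OF p] polysD[OF q] by (auto simp: prime_in_def)
qed

text \<open>The leading coefficient of \<open>h\<close> need not be a unit, so \<open>f\<close> is
  first multiplied by a power of it. The bound on the degree of \<open>q\<close> lets
  \<open>ideal_contraction\<close> apply the minimality of its equation to the quotient.\<close>

lemma pseudo_division:
  assumes h: "h \<in> polys R" "degree h > 0" and f: "f \<in> polys R"
  shows "\<exists>N q r. q \<in> polys R \<and> r \<in> polys R \<and> smult (lead_coeff h ^ N) f = h * q + r
     \<and> degree r < degree h \<and> (q = 0 \<or> degree q + degree h \<le> degree f)"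
  using f
proof (induction "degree f" arbitrary: f rule: less_induct)
  case less
  show ?case
  proof (cases "degree f < degree h")
    case True
    then show ?thesis
      using less.prems polys.zero_mem by (intro exI[of _ 0] exI[of _ 0] exI[of _ f]) auto
  next
    case False
    define c where "c = lead_coeff h"
    define t where "t = monom (lead_coeff f) (degree f - degree h)"
    define g where "g = smult c f - h * t"
    have c: "c \<in> R" using h by (simp add: c_def polysD)
    have smult: "smult a p \<in> polys R" if "a \<in> R" "p \<in> polys R" for a p
      using that by (auto simp: polys_def mult_mem)
    have t: "t \<in> polys R" unfolding t_def using less.prems zero_mem by (intro monom_polys) (auto simp: polysD)
    have g: "g \<in> polys R" unfolding g_def using c t h less.prems by (intro polys.diff_mem polys.mult_mem smult)
    have "degree t \<le> degree f - degree h" by (simp add: t_def degree_monom_le)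
    then have dht: "degree (h * t) \<le> degree f" using degree_mult_le[of h t] False by linarith
    have "degree g \<le> degree f"
      unfolding g_def using dht degree_smult_le[of c f] by (intro degree_diff_le)
    moreover have "coeff (h * t) (degree f) = coeff h (degree h) * lead_coeff f"
      using coeff_monom_mult[of "lead_coeff f" "degree f - degree h" h "degree f"] False
      by (simp add: t_def mult.commute)
    then have "coeff g (degree f) = 0" by (simp add: g_def c_def)
    ultimately have dg: "degree g < degree f"
      using False h(2) by (metis degree_0 gr_implies_not0 le_neq_implies_less leading_coeff_0_iff linorder_neqE_nat)
    from less.hyps[OF dg g] obtain N q r where *: "q \<in> polys R" "r \<in> polys R"
       "smult (c ^ N) g = h * q + r" "degree r < degree h" "q = 0 \<or> degree q + degree h \<le> degree g"
      unfolding c_def by blast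
    have "smult (c ^ Suc N) f = smult (c ^ N) g + h * smult (c ^ N) t"
      by (simp add: g_def smult_diff_right mult.commute)
    then have "smult (c ^ Suc N) f = h * (q + smult (c ^ N) t) + r"
      using *(3) by (simp add: algebra_simps)
    moreover have "q + smult (c ^ N) t \<in> polys R" using * t c by (intro polys.add_mem smult power_mem)
    moreover have "degree (q + smult (c ^ N) t) \<le> degree f - degree h"
    proof (rule degree_add_le)
      show "degree q \<le> degree f - degree h" using *(5) dg by auto
      show "degree (smult (c ^ N) t) \<le> degree f - degree h"
        using degree_smult_le[of "c ^ N" t] \<open>degree t \<le> _\<close> by linarith
    qed
    ultimately show ?thesis
      using * False c_def by (intro exI[of _ "Suc N"] exI[of _ "q + smult (c ^ N) t"] exI[of _ r]) auto
  qed
qed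

end

locale simple_extension_prime = subring_set R for R :: "'a::comm_ring_1 set" +
  fixes x :: 'a and Q' :: "'a set"
  assumes Q': "prime_in (ring_ext R x) Q'"
begin

definition "Q = Q' \<inter> R"

sublocale E: subring_set "ring_ext R x" by (rule subring_ring_ext)

interpretation polys: subring_set "polys R" by (rule subring_polys)

lemma ideal_Q': "ideal_in (ring_ext R x) Q'" using Q' by (simp add: prime_in_def)

lemma prime_Q: "prime_in R Q"
  using Q' subset_ring_ext[of x] zero_mem unfolding prime_in_def ideal_in_def Q_def
  by (auto simp: add_mem mult_mem subset_iff)

lemma ideal_Q: "ideal_in R Q" using prime_Q by (simp add: prime_in_def)

lemma zero_Q: "0 \<in> Q" by (rule ideal_inD(2)[OF ideal_Q])

lemma poly_mem_ideal:
  assumes "ideal_in (ring_ext R x) J" "J \<inter> R = P" "p \<in> polys P"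
  shows "poly p x \<in> J"
proof -
  have "poly p x = (\<Sum>i\<le>degree p. coeff p i * x ^ i)" by (rule poly_altdef)
  also have "\<dots> \<in> J"
    using assms polysD[OF assms(3)] mem_ring_ext[of x]
    by (intro E.ideal_in_sum ideal_inD(4)[OF assms(1)] E.power_mem) auto
  finally show ?thesis .
qed

lemma poly_mem_Q': "p \<in> polys Q \<Longrightarrow> poly p x \<in> Q'"
  by (rule poly_mem_ideal[OF ideal_Q' Q_def[symmetric]])

text \<open>If \<open>x\<close> were transcendental modulo \<open>Q'\<close>, then \<open>1 + x a\<close> would not be a unit modulo \<open>Q'\<close>,
  and so would lie in a prime ideal that does not contain \<open>a\<close>.\<close>

lemma algebraic:
  assumes "E.goldman Q'"
  shows "\<exists>f. f \<in> polys R \<and> f \<notin> polys Q \<and> poly f x \<in> Q'"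
proof (rule ccontr)
  assume "\<not> ?thesis"
  then have trans: "f \<in> polys Q" if "f \<in> polys R" "poly f x \<in> Q'" for f using that by blast
  from assms obtain a where a: "a \<in> ring_ext R x" "a \<notin> Q'"
     "\<And>P. prime_in (ring_ext R x) P \<Longrightarrow> Q' \<subset> P \<Longrightarrow> a \<in> P"
    unfolding E.goldman_def by blast
  then obtain A where A: "A \<in> polys R" "a = poly A x" by (auto simp: ring_ext_def)
  define G where "G = 1 + pCons 0 A"
  have G: "G \<in> polys R" unfolding G_def using A by (intro polys.add_mem polys.one_mem pCons0_polys zero_mem)
  have "A \<notin> polys Q" using poly_mem_Q' A a by blast
  from exists_top_coeff[OF zero_Q this] obtain j where j: "coeff A j \<notin> Q" "\<And>i. i > j \<Longrightarrow> coeff A i \<in> Q"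
    by blast
  have jG: "coeff G (Suc j) \<notin> Q" "\<And>i. i > Suc j \<Longrightarrow> coeff G i \<in> Q"
    using j by (auto simp: G_def coeff_pCons split: nat.splits)
  define g where "g = poly G x"
  have g: "g \<in> ring_ext R x" unfolding g_def using G by (rule poly_mem_ring_ext)
  have gQ: "g \<notin> Q'" using trans[OF G] jG(1) polysD[of G Q "Suc j"] by (auto simp: g_def)
  \<comment> \<open>By transcendence a relation \<open>1 = i + g u\<close> lifts to
    \<open>G U\<close> being 1 modulo \<open>Q\<close>, whereas \<open>G\<close> has degree
    \<open>Suc j > 0\<close> modulo \<open>Q\<close> and \<open>U\<close> is nonzero there.\<close>
  have one: "1 \<notin> E.adj Q' g"
  proof
    assume "1 \<in> E.adj Q' g"
    then obtain i u where iu: "1 = i + g * u" "i \<in> Q'" "u \<in> ring_ext R x" by (auto elim!: E.adjE)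
    then obtain U where U: "U \<in> polys R" "u = poly U x" by (auto simp: ring_ext_def)
    have "1 - g * u = i" unfolding diff_eq_eq using iu(1) .
    then have "poly (1 - G * U) x = i" using U by (simp add: g_def)
    then have *: "1 - G * U \<in> polys Q"
      using iu U G by (intro trans polys.diff_mem polys.one_mem polys.mult_mem) auto
    have "U \<notin> polys Q"
    proof
      assume "U \<in> polys Q"
      then have "u \<in> Q'" using U poly_mem_Q' by blast
      then have "1 \<in> Q'" using iu g ideal_inD(3,5)[OF ideal_Q'] by metis
      then show False using Q' by (simp add: prime_in_def)
    qed
    from exists_top_coeff[OF zero_Q this] obtain k where
      k: "coeff U k \<notin> Q" "\<And>i. i > k \<Longrightarrow> coeff U i \<in> Q" by blast
    have "coeff (G * U) (Suc j + k) \<notin> Q" by (rule top_coeff_mult[OF prime_Q G U(1) jG k])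
    moreover have "- coeff (1 - G * U) (Suc j + k) \<in> Q"
      using polysD[OF *] by (intro ideal_in_uminus[OF ideal_Q])
    ultimately show False by (simp add: coeff_pCons)
  qed
  have "\<exists>P. prime_in (ring_ext R x) P \<and> E.adj Q' g \<subseteq> P \<and> {1} \<inter> P = {}"
    using one g E.one_mem by (intro E.prime_in_avoiding E.ideal_adj ideal_Q') auto
  then obtain P where P: "prime_in (ring_ext R x) P" "E.adj Q' g \<subseteq> P" "1 \<notin> P" by blast
  have "Q' \<subset> P" using P(2) E.adj_superset[of Q' g] E.mem_adj[OF ideal_Q', of g] gQ by blast
  then have "a \<in> P" using a P by blast
  have idP: "ideal_in (ring_ext R x) P" using P by (simp add: prime_in_def)
  have "a * x \<in> P" using ideal_inD(4)[OF idP \<open>a \<in> P\<close> mem_ring_ext] .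
  moreover have "g \<in> P" using P(2) E.mem_adj[OF ideal_Q', of g] by blast
  ultimately have "g - a * x \<in> P" by (intro E.ideal_in_diff[OF idP])
  then show False using P(3) A by (simp add: g_def G_def mult.commute)
qed

lemma drop_lead_coeff:
  assumes p: "p \<in> polys R" "lead_coeff p \<in> Q"
  obtains p' where "p' \<in> polys R" "p - p' \<in> polys Q" "p' = 0 \<or> degree p' < degree p"
proof -
  define t where "t = monom (lead_coeff p) (degree p)"
  have t: "t \<in> polys Q" unfolding t_def using p(2) zero_Q by (intro monom_polys)
  have tR: "t \<in> polys R" using t polys_mono[of Q R] Q_def by blast
  have "degree (p - t) \<le> degree p"
    by (intro degree_diff_le) (auto simp: t_def degree_monom_le)
  moreover have "coeff (p - t) (degree p) = 0" by (simp add: t_def)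
  ultimately have "p - t = 0 \<or> degree (p - t) < degree p"
    by (metis le_neq_implies_less leading_coeff_0_iff)
  then show ?thesis using that[of "p - t"] p(1) t tR by (simp add: polys.diff_mem)
qed

lemma const_value:
  assumes "p \<in> polys R" "degree p = 0"
  shows "poly p x = coeff p 0" "poly p x \<in> R"
proof -
  obtain a where "p = [:a:]" using degree_eq_zeroE[OF assms(2)] .
  then show "poly p x = coeff p 0" "poly p x \<in> R" using polysD[OF assms(1), of 0] by simp_all
qed

text \<open>A minimal polynomial of \<open>x\<close> over \<open>R/Q\<close>: a leading term with
  coefficient in \<open>Q\<close> could be dropped without changing the other properties, and degree
  0 would put the constant into \<open>Q\<close>.\<close>

lemma minimal_equation:
  assumes "\<exists>f. f \<in> polys R \<and> f \<notin> polys Q \<and> poly f x \<in> Q'"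
  obtains f where "f \<in> polys R" "lead_coeff f \<notin> Q" "poly f x \<in> Q'" "degree f > 0"
    "\<And>h. h \<in> polys R \<Longrightarrow> poly h x \<in> Q' \<Longrightarrow> degree h < degree f \<Longrightarrow> h \<in> polys Q"
proof -
  from ex_has_least_nat[of "\<lambda>f. f \<in> polys R \<and> f \<notin> polys Q \<and> poly f x \<in> Q'" _ degree] assms
  obtain f where f: "f \<in> polys R" "f \<notin> polys Q" "poly f x \<in> Q'"
    and min: "\<And>h. h \<in> polys R \<Longrightarrow> h \<notin> polys Q \<Longrightarrow> poly h x \<in> Q' \<Longrightarrow> degree f \<le> degree h"
    by blast
  have lead: "lead_coeff f \<notin> Q"
  proof
    assume "lead_coeff f \<in> Q"
    from drop_lead_coeff[OF f(1) this] obtain p where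
      p: "p \<in> polys R" "f - p \<in> polys Q" "p = 0 \<or> degree p < degree f" by blast
    have "p \<notin> polys Q"
      using p(2) f(2) ideal_inD(3)[OF ideal_polys[OF ideal_Q], of "f - p" p] by auto
    moreover have "poly p x \<in> Q'"
      using f(3) poly_mem_Q'[OF p(2)] E.ideal_in_diff[OF ideal_Q', of "poly f x" "poly (f - p) x"] by simp
    ultimately have "degree f \<le> degree p" "p \<noteq> 0"
      using min[OF p(1)] ideal_inD(2)[OF ideal_polys[OF ideal_Q]] by auto
    then show False using p(3) by simp
  qed
  have "degree f > 0"
  proof (rule ccontr)
    assume d: "\<not> ?thesis"
    then have "coeff f 0 \<in> Q" using f const_value[OF f(1)] by (simp add: Q_def)
    then show False using lead d by simp
  qed
  moreover have "h \<in> polys Q" if "h \<in> polys R" "poly h x \<in> Q'" "degree h < degree f" for h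
    using min[OF that(1) _ that(2)] that(3) by linarith
  ultimately show ?thesis using f lead that[of f] by blast
qed

text \<open>As \<open>x\<close> is algebraic over \<open>R/Q\<close>, a strictly larger ideal stays
  strictly larger after contraction. A polynomial \<open>h\<close> of least degree with value in
  \<open>J\<close> but not in \<open>Q'\<close> is constant: otherwise division of \<open>f\<close>
  by \<open>h\<close> has a quotient with value in \<open>Q'\<close>, which the minimality of
  \<open>f\<close> puts into \<open>polys Q\<close>, and then the leading coefficient of
  \<open>f\<close> lies in \<open>Q\<close>.\<close>

lemma ideal_contraction:
  assumes f: "f \<in> polys R" "lead_coeff f \<notin> Q" "poly f x \<in> Q'" "degree f > 0"
    and min: "\<And>h. h \<in> polys R \<Longrightarrow> poly h x \<in> Q' \<Longrightarrow> degree h < degree f \<Longrightarrow> h \<in> polys Q"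
    and J: "ideal_in (ring_ext R x) J" "Q' \<subset> J"
  shows "\<exists>c\<in>R. c \<in> J \<and> c \<notin> Q"
proof -
  obtain a where a: "a \<in> J" "a \<notin> Q'" using J by blast
  then obtain h0 where "h0 \<in> polys R \<and> poly h0 x \<in> J \<and> poly h0 x \<notin> Q'"
    using ideal_inD(1)[OF J(1)] by (fastforce simp: ring_ext_def)
  from ex_has_least_nat[of "\<lambda>h. h \<in> polys R \<and> poly h x \<in> J \<and> poly h x \<notin> Q'" _ degree, OF this]
  obtain h where h: "h \<in> polys R" "poly h x \<in> J" "poly h x \<notin> Q'"
    and hmin: "\<And>p. p \<in> polys R \<Longrightarrow> poly p x \<in> J \<Longrightarrow> degree p < degree h \<Longrightarrow> poly p x \<in> Q'"
    by (metis leD)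
  show ?thesis
  proof (cases "degree h = 0")
    case True
    then show ?thesis using h const_value[OF h(1)] by (auto simp: Q_def)
  next
    case False
    define c where "c = lead_coeff h"
    have cR: "c \<in> R" unfolding c_def using h by (simp add: polysD)
    have PQ': "\<And>a b. a \<in> ring_ext R x \<Longrightarrow> b \<in> ring_ext R x \<Longrightarrow> a * b \<in> Q' \<Longrightarrow> a \<in> Q' \<or> b \<in> Q'"
      using Q' by (auto simp: prime_in_def)
    have cQ: "c \<notin> Q"
    proof
      assume "c \<in> Q"
      then obtain p where p: "p \<in> polys R" "h - p \<in> polys Q" "p = 0 \<or> degree p < degree h"
        unfolding c_def using drop_lead_coeff[OF h(1)] by blast
      have hp: "poly (h - p) x \<in> Q'" by (rule poly_mem_Q'[OF p(2)])
      have "degree p < degree h" using p(3) False by auto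
      moreover have "poly p x \<in> J"
        using h(2) hp J(2) E.ideal_in_diff[OF J(1), of "poly h x" "poly (h - p) x"] by auto
      ultimately have "poly p x \<in> Q'" using p(1) by (intro hmin)
      then show False using hp h(3) ideal_inD(3)[OF ideal_Q', of "poly (h - p) x" "poly p x"] by simp
    qed
    \<comment> \<open>If \<open>f\<close> had smaller degree, the remainder of \<open>h\<close> by
      \<open>f\<close> would have its value in \<open>J\<close> and hence, by minimality of
      \<open>h\<close>, in \<open>Q'\<close>; cancelling a power of the leading coefficient of
      \<open>f\<close> puts the value of \<open>h\<close> into \<open>Q'\<close>.\<close>
    have le: "degree h \<le> degree f"
    proof (rule ccontr)
      assume gt: "\<not> ?thesis"
      obtain N q r where *: "q \<in> polys R" "r \<in> polys R" "smult (lead_coeff f ^ N) h = f * q + r"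
          "degree r < degree f"
        using pseudo_division[OF f(1,4) h(1)] by blast
      define b where "b = lead_coeff f ^ N"
      have b: "b \<in> R" "b \<notin> Q"
        unfolding b_def using f prime_in_power[OF prime_Q, of "lead_coeff f" N]
        by (auto simp: polysD intro: power_mem)
      then have bE: "b \<in> ring_ext R x" "b \<notin> Q'" using subset_ring_ext[of x] by (auto simp: Q_def)
      have eq: "b * poly h x = poly f x * poly q x + poly r x"
        using arg_cong[OF *(3), of "\<lambda>p. poly p x"] by (simp add: b_def)
      have fq: "poly f x * poly q x \<in> Q'"
        using f * by (intro ideal_inD(4)[OF ideal_Q'] poly_mem_ring_ext)
      have "poly r x = b * poly h x - poly f x * poly q x" using eq by simp
      also have "\<dots> \<in> J" using fq J h bE ideal_inD(5)[OF J(1)] by (intro E.ideal_in_diff[OF J(1)]) auto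
      finally have "poly r x \<in> Q'" using * gt by (intro hmin) auto
      then have "b * poly h x \<in> Q'" unfolding eq using fq by (intro ideal_inD(3)[OF ideal_Q'])
      then show False using PQ' bE h poly_mem_ring_ext by blast
    qed
    obtain N q r where *: "q \<in> polys R" "r \<in> polys R" "smult (c ^ N) f = h * q + r"
        "degree r < degree h" "q = 0 \<or> degree q + degree h \<le> degree f"
      using pseudo_division[OF h(1) _ f(1)] False c_def by blast
    have cN: "c ^ N \<in> R" "c ^ N \<notin> Q" using cR cQ prime_in_power[OF prime_Q] by (auto intro: power_mem)
    have eq: "c ^ N * poly f x = poly h x * poly q x + poly r x"
      using arg_cong[OF *(3), of "\<lambda>p. poly p x"] by simp
    have cf: "c ^ N * poly f x \<in> Q'"
      using f cN subset_ring_ext[of x] by (intro ideal_inD(5)[OF ideal_Q']) auto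
    have "poly r x = c ^ N * poly f x - poly h x * poly q x" using eq by simp
    also have "\<dots> \<in> J"
    proof (intro E.ideal_in_diff[OF J(1)])
      show "c ^ N * poly f x \<in> J" using cf J(2) by blast
      show "poly h x * poly q x \<in> J" using h(2) *(1) by (intro ideal_inD(4)[OF J(1)] poly_mem_ring_ext)
    qed
    finally have rQ: "poly r x \<in> Q'" using * by (intro hmin) auto
    have "poly h x * poly q x = c ^ N * poly f x - poly r x" using eq by simp
    also have "\<dots> \<in> Q'" using cf rQ by (intro E.ideal_in_diff[OF ideal_Q'])
    finally have "poly q x \<in> Q'" using PQ' h * poly_mem_ring_ext by blast
    have "q \<in> polys Q"
    proof (cases "q = 0")
      case False
      then show ?thesis using * \<open>degree h \<noteq> 0\<close> \<open>poly q x \<in> Q'\<close> by (intro min) auto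
    qed (simp add: polys_def zero_Q)
    then have "h * q \<in> polys Q" using h ideal_inD(5)[OF ideal_polys[OF ideal_Q]] by blast
    moreover have "coeff r (degree f) = 0" using * le by (intro coeff_eq_0) auto
    then have "c ^ N * lead_coeff f = coeff (h * q) (degree f)"
      using arg_cong[OF *(3), of "\<lambda>p. coeff p (degree f)"] by simp
    ultimately have "c ^ N * lead_coeff f \<in> Q" by (simp add: polysD)
    then have False using prime_Q cN f polysD[OF f(1)] by (auto simp: prime_in_def)
    then show ?thesis ..
  qed
qed

text \<open>It suffices that the ideal \<open>J\<close> generated by \<open>P\<close> and
  \<open>Q'\<close> meets \<open>R\<close> only inside \<open>P\<close>; a prime ideal above
  \<open>J\<close> avoiding \<open>R - P\<close> is then as desired. A leading coefficient outside
  \<open>P\<close> replaces integrality: division by \<open>f\<close> costs only a factor outside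
  \<open>P\<close>.\<close>

lemma lying_over:
  assumes f: "f \<in> polys R" "lead_coeff f \<notin> Q" "poly f x \<in> Q'" "degree f > 0"
    and min: "\<And>h. h \<in> polys R \<Longrightarrow> poly h x \<in> Q' \<Longrightarrow> degree h < degree f \<Longrightarrow> h \<in> polys Q"
    and P: "prime_in R P" "Q \<subseteq> P" "lead_coeff f \<notin> P"
  shows "\<exists>P'. prime_in (ring_ext R x) P' \<and> Q' \<subseteq> P' \<and> P' \<inter> R = P"
proof -
  have idP: "ideal_in R P" using P by (simp add: prime_in_def)
  have PR: "P \<subseteq> R" using ideal_inD(1)[OF idP] by blast
  have zP: "0 \<in> P" by (rule ideal_inD(2)[OF idP])
  note ipP = ideal_polys[OF idP]
  define J where "J = {poly p x + q | p q. p \<in> polys P \<and> q \<in> Q'}"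
  have polysPR: "polys P \<subseteq> polys R" by (rule polys_mono[OF PR])
  have J: "ideal_in (ring_ext R x) J"
    unfolding ideal_in_def
  proof (intro conjI ballI)
    show "J \<subseteq> ring_ext R x"
      using polysPR ideal_inD(1)[OF ideal_Q'] by (auto simp: J_def intro!: E.add_mem poly_mem_ring_ext)
    show "0 \<in> J" unfolding J_def using ideal_inD(2)[OF ipP] ideal_inD(2)[OF ideal_Q']
      by (intro CollectI exI[of _ 0]) auto
  next
    fix a b assume "a \<in> J" "b \<in> J"
    then obtain p q p' q' where "a = poly p x + q" "b = poly p' x + q'" and
      *: "p \<in> polys P" "p' \<in> polys P" "q \<in> Q'" "q' \<in> Q'" by (auto simp: J_def)
    then have "a + b = poly (p + p') x + (q + q')" by simp
    then show "a + b \<in> J" unfolding J_def using * ideal_inD(3)[OF ipP] ideal_inD(3)[OF ideal_Q'] by blast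
  next
    fix a b assume "a \<in> J" "b \<in> ring_ext R x"
    then obtain p q u where "a = poly p x + q" "b = poly u x" and
      *: "p \<in> polys P" "u \<in> polys R" "q \<in> Q'" "poly u x \<in> ring_ext R x" by (auto simp: J_def ring_ext_def)
    then have "a * b = poly (p * u) x + q * poly u x" by (simp add: algebra_simps)
    then show "a * b \<in> J" unfolding J_def using * ideal_inD(4)[OF ipP] ideal_inD(4)[OF ideal_Q'] by blast
  qed
  have disj: "(R - P) \<inter> J = {}"
  proof (rule ccontr)
    assume "\<not> ?thesis"
    then obtain s p q where s: "s \<in> R" "s \<notin> P" "s = poly p x + q" "p \<in> polys P" "q \<in> Q'"
      by (auto simp: J_def)
    define h where "h = [:s:] - p"
    have h: "h \<in> polys R" unfolding h_def
      using s polysPR zero_mem by (intro polys.diff_mem const_polys) auto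
    have hx: "poly h x \<in> Q'" using s by (simp add: h_def)
    obtain N k r where *: "k \<in> polys R" "r \<in> polys R" "smult (lead_coeff f ^ N) h = f * k + r"
        "degree r < degree f"
      using pseudo_division[OF f(1,4) h] by blast
    define b where "b = lead_coeff f ^ N"
    have b: "b \<in> R" "b \<notin> P"
      unfolding b_def using f P prime_in_power[OF P(1), of "lead_coeff f" N]
      by (auto simp: polysD intro: power_mem)
    have "poly r x = b * poly h x - poly f x * poly k x"
      using arg_cong[OF *(3), of "\<lambda>p. poly p x"] by (simp add: b_def)
    also have "\<dots> \<in> Q'"
      using hx f * b subset_ring_ext[of x] poly_mem_ring_ext
      by (intro E.ideal_in_diff[OF ideal_Q'] ideal_inD(4,5)[OF ideal_Q']) auto
    finally have "r \<in> polys Q" using * by (intro min) auto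
    then have r: "r \<in> polys P" using polys_mono[OF P(2)] by blast
    have "smult b p \<in> polys P" using s(4) b ideal_inD(5)[OF idP] by (auto simp: polys_def)
    then have e: "r + smult b p \<in> polys P" using r ideal_inD(3)[OF ipP] by blast
    \<comment> \<open>Modulo \<open>P\<close> this says that \<open>f k\<close> is the nonzero
      constant \<open>b s\<close>, while \<open>f\<close> has positive degree modulo
      \<open>P\<close> and \<open>k\<close> is nonzero.\<close>
    have eq: "f * k = [:b * s:] - (r + smult b p)"
      using *(3) by (simp add: h_def b_def algebra_simps smult_diff_right)
    have "k \<notin> polys P"
    proof
      assume "k \<in> polys P"
      then have "f * k + (r + smult b p) \<in> polys P"
        using e f ideal_inD(3,5)[OF ipP] by blast
      then have "[:b * s:] \<in> polys P" unfolding eq by simp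
      then have "b * s \<in> P" using const_polys_iff[OF zP] by blast
      then show False using P s b by (auto simp: prime_in_def)
    qed
    from exists_top_coeff[OF zP this] obtain j where
      j: "coeff k j \<notin> P" "\<And>i. i > j \<Longrightarrow> coeff k i \<in> P" by blast
    have "coeff (f * k) (degree f + j) \<notin> P"
      using f P j zP by (intro top_coeff_mult[OF P(1) f(1) *(1)]) (auto simp: coeff_eq_0)
    moreover have "coeff (f * k) (degree f + j) = - coeff (r + smult b p) (degree f + j)"
      unfolding eq using f(4) by (simp add: coeff_pCons split: nat.splits)
    ultimately show False using ideal_in_uminus[OF idP] polysD[OF e] by metis
  qed
  have "\<exists>P'. prime_in (ring_ext R x) P' \<and> J \<subseteq> P' \<and> (R - P) \<inter> P' = {}"
  proof (rule E.prime_in_avoiding[OF J _ _ disj])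
    show "R - P \<subseteq> ring_ext R x" using subset_ring_ext by blast
    show "1 \<in> R - P" using one_mem P by (simp add: prime_in_def)
    show "s * t \<in> R - P" if "s \<in> R - P" "t \<in> R - P" for s t
      using that P by (auto simp: prime_in_def mult_mem)
  qed
  then obtain P' where P': "prime_in (ring_ext R x) P'" "J \<subseteq> P'" "(R - P) \<inter> P' = {}" by blast
  have "Q' \<subseteq> J"
  proof
    fix q assume "q \<in> Q'"
    then have "q = poly 0 x + q" "0 \<in> polys P" using ideal_inD(2)[OF ipP] by auto
    then show "q \<in> J" unfolding J_def using \<open>q \<in> Q'\<close> by blast
  qed
  moreover have "P \<subseteq> J"
  proof
    fix p assume "p \<in> P"
    then have "p = poly [:p:] x + 0" "[:p:] \<in> polys P" using const_polys[OF zP] by auto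
    then show "p \<in> J" unfolding J_def using ideal_inD(2)[OF ideal_Q'] by blast
  qed
  ultimately show ?thesis using P' PR by blast
qed

text \<open>The witness for \<open>Q\<close> is \<open>lead_coeff f * g\<close>, where
  \<open>g\<close> outside \<open>Q\<close> is contracted from \<open>Q' + (a)\<close>. A prime
  ideal strictly above \<open>Q\<close> omitting this product would lift to one strictly above
  \<open>Q'\<close>, which contains \<open>a\<close> and therefore \<open>g\<close>.\<close>

theorem goldman_contraction:
  assumes gold: "E.goldman Q'"
  shows "goldman Q"
proof -
  obtain f where f: "f \<in> polys R" "lead_coeff f \<notin> Q" "poly f x \<in> Q'" "degree f > 0"
    and min: "\<And>h. h \<in> polys R \<Longrightarrow> poly h x \<in> Q' \<Longrightarrow> degree h < degree f \<Longrightarrow> h \<in> polys Q"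
    using minimal_equation[OF algebraic[OF gold]] by blast
  from gold obtain a where a: "a \<in> ring_ext R x" "a \<notin> Q'"
     "\<And>P. prime_in (ring_ext R x) P \<Longrightarrow> Q' \<subset> P \<Longrightarrow> a \<in> P"
    unfolding E.goldman_def by blast
  define J where "J = E.adj Q' a"
  have J: "ideal_in (ring_ext R x) J" "Q' \<subset> J"
    unfolding J_def using E.ideal_adj[OF ideal_Q' a(1)] E.adj_superset[of Q' a] E.mem_adj[OF ideal_Q', of a] a(2)
    by blast+
  obtain g where g: "g \<in> R" "g \<in> J" "g \<notin> Q" using ideal_contraction[OF f min J] by blast
  show ?thesis
    unfolding goldman_def
  proof (intro bexI conjI allI impI)
    have lR: "lead_coeff f \<in> R" using polysD[OF f(1)] by simp
    show "lead_coeff f * g \<in> R" using lR g by (intro mult_mem)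
    show "lead_coeff f * g \<notin> Q" using prime_Q lR f g by (auto simp: prime_in_def)
    fix P assume P: "prime_in R P" "Q \<subset> P"
    have idP: "ideal_in R P" using P by (simp add: prime_in_def)
    show "lead_coeff f * g \<in> P"
    proof (rule ccontr)
      assume *: "lead_coeff f * g \<notin> P"
      then have n: "lead_coeff f \<notin> P" "g \<notin> P" using ideal_inD(4,5)[OF idP] lR g by blast+
      obtain P' where P': "prime_in (ring_ext R x) P'" "Q' \<subseteq> P'" "P' \<inter> R = P"
        using lying_over[OF f min P(1) _ n(1)] P by blast
      have "Q' \<subset> P'" using P P' Q_def by blast
      then have "a \<in> P'" using a P' by blast
      then have "J \<subseteq> P'" unfolding J_def using P' by (intro E.adj_minimal) (auto simp: prime_in_def)
      then show False using g n P' by blast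
    qed
  qed
qed

end

section \<open>Vertex decompositions of families with few missing sets\<close>

definition missing :: "'v set \<Rightarrow> nat \<Rightarrow> 'v set set \<Rightarrow> 'v set set" where
  "missing V d FF = {F. F \<subseteq> V \<and> card F = d} - FF"

text \<open>A vertex \<open>v\<close> of a pure complex is shedding iff no \<open>G\<close> is blocked at \<open>v\<close>: otherwise \<open>G\<close> would be a
  facet of the deletion of \<open>v\<close>, of too small a dimension.\<close>

definition blocked :: "'v set \<Rightarrow> nat \<Rightarrow> 'v set set \<Rightarrow> 'v set \<Rightarrow> 'v \<Rightarrow> bool" where
  "blocked V d FF G v \<longleftrightarrow> G \<subseteq> V \<and> v \<in> V \<and> v \<notin> G \<and> card G + 1 = d \<and> insert v G \<in> FF \<and>
     (\<forall>w\<in>V - insert v G. insert w G \<notin> FF)"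

lemma finite_missing: "finite V \<Longrightarrow> finite (missing V d FF)"
  by (simp add: missing_def)

lemma card_insert_image:
  assumes "A \<inter> G = {}"
  shows "card ((\<lambda>w. insert w G) ` A) = card A"
  using assms by (intro card_image inj_onI) blast

text \<open>The price of a blocked pair. All these sets contain \<open>G\<close> and omit
  \<open>v\<close>, which keeps the families of suitable blocked pairs disjoint.\<close>

lemma blocked_missing:
  assumes V: "finite V" "card V = d + c" and b: "blocked V d FF G v"
  shows "card {insert w G | w. w \<in> V - insert v G} = c"
    and "{insert w G | w. w \<in> V - insert v G} \<subseteq> missing V d FF"
proof -
  have G: "finite G" using finite_subset[OF _ V(1), of G] b by (auto simp: blocked_def)
  have "{insert w G | w. w \<in> V - insert v G} = (\<lambda>w. insert w G) ` (V - insert v G)" by auto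
  moreover have "card ((\<lambda>w. insert w G) ` (V - insert v G)) = card (V - insert v G)"
    by (rule card_insert_image) auto
  moreover have "card (V - insert v G) = c"
    using b V G by (subst card_Diff_subset) (auto simp: blocked_def)
  ultimately show "card {insert w G | w. w \<in> V - insert v G} = c" by simp
  show "{insert w G | w. w \<in> V - insert v G} \<subseteq> missing V d FF"
    using b G by (auto simp: missing_def blocked_def)
qed

lemma card_missing_avoiding:
  assumes "finite V"
  shows "card {F \<in> missing V d FF. v \<notin> F} + card {F \<in> missing V d FF. v \<in> F} = card (missing V d FF)"
proof -
  have "card ({F \<in> missing V d FF. v \<notin> F} \<union> {F \<in> missing V d FF. v \<in> F})
      = card {F \<in> missing V d FF. v \<notin> F} + card {F \<in> missing V d FF. v \<in> F}"
    using finite_missing[OF assms, of d FF] by (intro card_Un_disjoint) auto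
  moreover have "{F \<in> missing V d FF. v \<notin> F} \<union> {F \<in> missing V d FF. v \<in> F} = missing V d FF" by auto
  ultimately show ?thesis by simp
qed

lemma missing_singletons_empty:
  assumes FF: "\<And>F. F \<in> FF \<Longrightarrow> card F = 1" and cover: "V \<subseteq> \<Union>FF"
  shows "missing V 1 FF = {}"
proof -
  have "{w} \<in> FF" if w: "w \<in> V" for w
  proof -
    obtain F where F: "F \<in> FF" "w \<in> F" using w cover by blast
    then have "F = {w}" using FF[OF F(1)] by (auto simp: card_1_singleton_iff)
    then show ?thesis using F by simp
  qed
  then show ?thesis by (auto simp: missing_def card_1_singleton_iff)
qed

text \<open>Deleting \<open>v\<close> lowers \<open>c\<close> by one, so two missing sets should
  contain \<open>v\<close>. If \<open>v0\<close> is blocked by \<open>G0\<close>, any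
  \<open>v\<close> in \<open>G0\<close> lies in \<open>c\<close> missing sets, and a pair blocked at
  \<open>v\<close> would contribute \<open>c\<close> others that omit \<open>v\<close>, in total
  \<open>2 c\<close>. If nothing is blocked, a vertex in two missing sets serves. Without such a
  vertex the missing sets are disjoint, and for \<open>c >= 2\<close> there is no room for
  \<open>2 c - 1\<close> of them.\<close>

lemma exists_shedding_vertex:
  assumes V: "finite V" "card V = d + c" and c: "c \<ge> 1"
    and FF: "\<And>F. F \<in> FF \<Longrightarrow> F \<subseteq> V \<and> card F = d" and cover: "\<Union>FF = V"
    and few: "card (missing V d FF) \<le> 2 * c - 1"
  shows "\<exists>v\<in>V. (\<forall>G. \<not> blocked V d FF G v) \<and> card {F \<in> missing V d FF. v \<notin> F} \<le> 2 * (c - 1) - 1"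
proof -
  define M where "M = missing V d FF"
  have finM: "finite M" unfolding M_def using V by (intro finite_missing)
  have split: "card {F \<in> M. v \<notin> F} + card {F \<in> M. v \<in> F} = card M" for v
    unfolding M_def by (rule card_missing_avoiding[OF V(1)])
  have Mfin: "finite F" if "F \<in> M" for F
    using finite_subset[OF _ V(1), of F] that by (auto simp: M_def missing_def)
  have d1: "d \<ge> 1"
  proof (rule ccontr)
    assume "\<not> ?thesis"
    then have "F = {}" if "F \<in> FF" for F
      using FF[OF that] finite_subset[OF _ V(1), of F] card_0_eq[of F] by simp
    then have "V = {}" using cover by blast
    then show False using V c by simp
  qed
  consider (empty) "M = {}" | (blocked) G v where "M \<noteq> {}" "blocked V d FF G v"
    | (free) "M \<noteq> {}" "\<And>G v. \<not> blocked V d FF G v" by blast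
  then show ?thesis
  proof cases
    case empty
    obtain v where v: "v \<in> V" using V c by fastforce
    have "\<not> blocked V d FF G v" for G
    proof
      assume b: "blocked V d FF G v"
      have "card {insert w G | w. w \<in> V - insert v G} \<le> card M"
        using blocked_missing(2)[OF V b] by (intro card_mono finM) (simp add: M_def)
      then show False using blocked_missing(1)[OF V b] empty c by simp
    qed
    then show ?thesis using v empty M_def by (intro bexI[of _ v]) auto
  next
    case (blocked G0 v0)
    define S0 where "S0 = {insert w G0 | w. w \<in> V - insert v0 G0}"
    note S0 = blocked_missing[OF V blocked(2), folded S0_def M_def]
    have "G0 \<noteq> {}"
    proof
      assume G0: "G0 = {}"
      then have "d = 1" using blocked(2) by (simp add: blocked_def)
      then have "M = {}" unfolding M_def using FF cover missing_singletons_empty[of FF V] by simp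
      then show False using blocked by simp
    qed
    then obtain v where v: "v \<in> G0" by blast
    have vV: "v \<in> V" using v blocked by (auto simp: blocked_def)
    have nb: "\<not> blocked V d FF G v" for G
    proof
      assume b: "blocked V d FF G v"
      define S where "S = {insert w G | w. w \<in> V - insert v G}"
      note S = blocked_missing[OF V b, folded S_def M_def]
      have "v \<notin> X" if "X \<in> S" for X
        using that b by (auto simp: S_def blocked_def)
      moreover have "v \<in> X" if "X \<in> S0" for X using that v by (auto simp: S0_def)
      ultimately have disj: "S0 \<inter> S = {}" by blast
      have "card (S0 \<union> S) = 2 * c"
        using S S0 disj finM by (subst card_Un_disjoint) (auto intro: finite_subset)
      moreover have "card (S0 \<union> S) \<le> card M" using S S0 by (intro card_mono finM) auto
      ultimately show False using few c unfolding M_def by linarith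
    qed
    have "c \<le> card {F \<in> M. v \<in> F}"
    proof -
      have "S0 \<subseteq> {F \<in> M. v \<in> F}" using S0 v by (auto simp: S0_def)
      then have "card S0 \<le> card {F \<in> M. v \<in> F}" using finM by (intro card_mono) auto
      then show ?thesis using S0 by simp
    qed
    \<comment> \<open>At most \<open>c - 1\<close> missing sets omit \<open>v\<close>; for
      \<open>c = 1\<close> the right-hand side is 0 by truncated subtraction.\<close>
    then have "card {F \<in> M. v \<notin> F} \<le> 2 * (c - 1) - 1"
      using split[of v] few c unfolding M_def[symmetric] by linarith
    then show ?thesis using nb vV M_def by blast
  next
    case free
    show ?thesis
    proof (cases "\<exists>v\<in>V. card {F \<in> M. v \<in> F} \<ge> 2")
      case True
      then obtain v where v: "v \<in> V" "card {F \<in> M. v \<in> F} \<ge> 2" by blast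
      then have "card {F \<in> M. v \<notin> F} \<le> 2 * (c - 1) - 1"
        using split[of v] few c unfolding M_def[symmetric] by linarith
      then show ?thesis using free v M_def by blast
    next
      case False
      obtain F0 where F0: "F0 \<in> M" using free by blast
      then have "F0 \<noteq> {}" using d1 by (auto simp: M_def missing_def)
      then obtain v where v: "v \<in> F0" "v \<in> V" using F0 by (auto simp: M_def missing_def)
      have "card {F \<in> M. v \<in> F} \<noteq> 0" using F0 v finM by auto
      then have one: "card {F \<in> M. v \<notin> F} + 1 \<le> card M" using split[of v] by linarith
      \<comment> \<open>In either case it is enough to lose the single missing set
        \<open>F0\<close>. Otherwise \<open>2 c - 1\<close> disjoint sets of size \<open>d\<close>
        fit into \<open>d + c\<close> vertices, which is impossible for \<open>c\<close> and
        \<open>d\<close> at least 2.\<close>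
      have "c = 1 \<or> card M \<le> 2 * c - 2"
      proof (rule ccontr)
        assume neg: "\<not> ?thesis"
        then have cM: "card M = 2 * c - 1" "c \<ge> 2" using few c unfolding M_def by auto
        have disj: "A \<inter> B = {}" if "A \<in> M" "B \<in> M" "A \<noteq> B" for A B
        proof (rule ccontr)
          assume "A \<inter> B \<noteq> {}"
          then obtain u where u: "u \<in> A" "u \<in> B" by blast
          then have "card {A, B} \<le> card {F \<in> M. u \<in> F}" using that finM by (intro card_mono) auto
          then have "card {F \<in> M. u \<in> F} \<ge> 2" using that by simp
          moreover have "u \<in> V" using u that by (auto simp: M_def missing_def)
          ultimately show False using False by blast
        qed
        have "card (\<Union>M) = (\<Sum>F\<in>M. card F)"
          using disj Mfin by (intro card_Union_disjoint) (auto simp: pairwise_def disjnt_def)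
        also have "\<dots> = card M * d" by (simp add: M_def missing_def)
        finally have "card M * d \<le> d + c"
          using card_mono[of V "\<Union>M"] V by (auto simp: M_def missing_def)
        moreover have "d \<noteq> 1"
        proof
          assume d: "d = 1"
          then have "M = {}" unfolding M_def using FF cover missing_singletons_empty[of FF V] by simp
          then show False using F0 by simp
        qed
        ultimately have "(2 * c - 1) * d \<le> d + c" "d \<ge> 2" using cM d1 by auto
        moreover obtain k where k: "c = k + 2" using cM(2) by (metis add.commute le_Suc_ex)
        ultimately have "(2 * k + 3) * d \<le> d + k + 2" by (simp add: algebra_simps)
        then have "2 * (k * d) + 2 * d \<le> k + 2" by (simp add: algebra_simps)
        moreover have "k * 1 \<le> k * d" using \<open>d \<ge> 2\<close> by (intro mult_le_mono) auto
        ultimately show False using \<open>d \<ge> 2\<close> by linarith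
      qed
      then have "card {F \<in> M. v \<notin> F} \<le> 2 * (c - 1) - 1"
        using one few unfolding M_def[symmetric] by auto
      then show ?thesis using free v M_def by blast
    qed
  qed
qed

section \<open>Deletions and links of families of facets\<close>

definition del :: "'v \<Rightarrow> 'v set set \<Rightarrow> 'v set set" where
  "del v FF = {F \<in> FF. v \<notin> F}"

definition lnk :: "'v \<Rightarrow> 'v set set \<Rightarrow> 'v set set" where
  "lnk v FF = (\<lambda>F. F - {v}) ` {F \<in> FF. v \<in> F}"

lemma mem_lnk_iff: "G \<in> lnk v FF \<longleftrightarrow> v \<notin> G \<and> insert v G \<in> FF"
  unfolding lnk_def by (force simp: image_iff insert_absorb)

lemma Union_lnk_subset: "(\<And>F. F \<in> FF \<Longrightarrow> F \<subseteq> V) \<Longrightarrow> \<Union>(lnk v FF) \<subseteq> V - {v}"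
  by (fastforce simp: lnk_def)

lemma two_le_card_subsets:
  assumes "finite X" "1 \<le> k" "k < card X"
  shows "2 \<le> card {H. H \<subseteq> X \<and> card H = k}"
proof -
  have "2 \<le> card X choose k"
  proof -
    obtain m j where "card X = Suc m" "k = Suc j" using assms by (metis Suc_le_D less_imp_Suc_add One_nat_def)
    moreover have "m choose j \<ge> 1" "m choose Suc j \<ge> 1"
      using assms calculation by (auto simp: Suc_le_eq)
    ultimately show ?thesis by simp
  qed
  then show ?thesis using n_subsets[OF assms(1), of k] by simp
qed

text \<open>A vertex \<open>w\<close> that is not joined to \<open>v\<close> costs at least two missing sets, so that the link of
  \<open>v\<close> satisfies the same bound on its own vertex set.\<close>

lemma missing_link:
  assumes V: "finite V" "card V = d + c" and c: "c \<ge> 1"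
    and FF: "\<And>F. F \<in> FF \<Longrightarrow> F \<subseteq> V \<and> card F = d" and cover: "\<Union>FF = V"
    and few: "card (missing V d FF) \<le> 2 * c - 1" and v: "v \<in> V"
    and V': "V' = \<Union>(lnk v FF)" "card V' = d - 1 + c'"
  shows "card (missing V' (d - 1) (lnk v FF)) \<le> 2 * c' - 1"
proof -
  define M where "M = missing V d FF"
  obtain F0 where F0: "F0 \<in> FF" "v \<in> F0" using v cover by blast
  have V'V: "V' \<subseteq> V - {v}" unfolding V' by (rule Union_lnk_subset) (use FF in blast)
  then have finV': "finite V'" using V finite_subset by blast
  have finM: "finite M" unfolding M_def using V by (intro finite_missing)
  define LM where "LM = missing V' (d - 1) (lnk v FF)"
  consider "d \<le> 1" | "d = 2" | "d \<ge> 3" by linarith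
  then show ?thesis
  proof cases
    case 1
    have "finite F0" using FF[OF F0(1)] V finite_subset by blast
    then have "card F0 \<noteq> 0" using F0 by auto
    then have "d = 1" using 1 FF[OF F0(1)] by simp
    then have "F0 = {v}" using FF[OF F0(1)] F0(2) by (auto simp: card_1_singleton_iff)
    then have "{} \<in> lnk v FF" using F0 by (simp add: mem_lnk_iff)
    then have "missing V' (d - 1) (lnk v FF) = {}"
      using \<open>d = 1\<close> finV' finite_subset by (fastforce simp: missing_def)
    then show ?thesis by simp
  next
    case 2
    have "card H = 1" if "H \<in> lnk v FF" for H
    proof -
      have "finite H" using that V'(1) finV' finite_subset by (metis Union_upper)
      moreover have "card (insert v H) = 2" "v \<notin> H" using that FF 2 by (auto simp: mem_lnk_iff)
      ultimately show ?thesis by simp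
    qed
    then have "missing V' (d - 1) (lnk v FF) = {}"
      using 2 V'(1) missing_singletons_empty[of "lnk v FF" V'] by simp
    then show ?thesis by simp
  next
    case 3
    define B where "B = V - {v} - V'"
    have finB: "finite B" using V by (simp add: B_def)
    have cardB: "card B + c' = c"
    proof -
      have "card B = card (V - {v}) - card V'"
        unfolding B_def using V'V finV' by (intro card_Diff_subset)
      moreover have "card V' \<le> card (V - {v})" using V'V V by (intro card_mono) auto
      moreover have "card (V - {v}) = d + c - 1" using V v by simp
      ultimately show ?thesis using V' 3 by linarith
    qed
    have F0': "F0 - {v} \<subseteq> V'" unfolding V' using F0 by (auto simp: lnk_def)
    have "card (F0 - {v}) = d - 1" using F0 FF[OF F0(1)] by simp
    then have V'ge: "d - 1 \<le> card V'" using card_mono[OF finV' F0'] by simp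
    \<comment> \<open>From \<open>d >= 3\<close> and \<open>d - 1 <= card V'\<close> follows
      \<open>1 <= d - 2 < card V'\<close>, so there are at least two such sets.\<close>
    define HH where "HH = {H. H \<subseteq> V' \<and> card H = d - 2}"
    have HH: "2 \<le> card HH" "finite HH"
      unfolding HH_def using finV' V'ge 3 by (auto intro!: two_le_card_subsets)
    have vB: "v \<notin> B" "v \<notin> V'" "B \<inter> V' = {}" using V'V by (auto simp: B_def)
    define X where "X = (\<lambda>G. insert v G) ` LM"
    \<comment> \<open>As \<open>H\<close> avoids \<open>B\<close>, such a set determines
      \<open>w\<close> and \<open>H\<close>. It is missing because \<open>w\<close> is no vertex of
      the link, and it is not in \<open>X\<close> because the sets of \<open>X\<close> avoid
      \<open>B\<close>.\<close>
    define Y where "Y = (\<lambda>(w, H). insert v (insert w H)) ` (B \<times> HH)"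
    have "card X = card LM"
      unfolding X_def
    proof (intro card_image inj_onI)
      fix G H assume "G \<in> LM" "H \<in> LM" "insert v G = insert v H"
      moreover from this have "v \<notin> G" "v \<notin> H" using vB by (auto simp: LM_def missing_def)
      ultimately show "G = H" by (simp add: insert_ident)
    qed
    have "card Y = card (B \<times> HH)"
      unfolding Y_def
    proof (intro card_image inj_onI)
      fix p q assume "p \<in> B \<times> HH" "q \<in> B \<times> HH"
        and eq: "(\<lambda>(w, H). insert v (insert w H)) p = (\<lambda>(w, H). insert v (insert w H)) q"
      then obtain w H w' H' where p: "p = (w, H)" "w \<in> B" "H \<subseteq> V'" and q: "q = (w', H')" "w' \<in> B" "H' \<subseteq> V'"
        by (auto simp: HH_def)
      have eq': "insert v (insert w H) = insert v (insert w' H')" using eq p q by simp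
      have "w \<in> insert v (insert w' H')" using eq' by blast
      then have "w = w'" using p q vB by blast
      moreover have "H = H'"
      proof -
        have "H = insert v (insert w H) \<inter> V'" using p vB by blast
        also have "\<dots> = insert v (insert w' H') \<inter> V'" using eq' by simp
        also have "\<dots> = H'" using q vB by blast
        finally show ?thesis .
      qed
      ultimately show "p = q" using p q by simp
    qed
    then have cY: "card Y \<ge> 2 * card B" using HH by (simp add: card_cartesian_product)
    have "X \<subseteq> M"
    proof
      fix F assume "F \<in> X"
      then obtain G where G: "F = insert v G" "G \<subseteq> V'" "card G = d - 1" "G \<notin> lnk v FF"
        by (auto simp: X_def LM_def missing_def)
      have "v \<notin> G" "finite G" using G vB finV' finite_subset by auto
      then show "F \<in> M" using G V'V v 3 by (auto simp: M_def missing_def mem_lnk_iff)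
    qed
    moreover have "Y \<subseteq> M"
    proof
      fix F assume "F \<in> Y"
      then obtain w H where G: "F = insert v (insert w H)" "w \<in> B" "H \<subseteq> V'" "card H = d - 2"
        by (auto simp: Y_def HH_def)
      have *: "v \<notin> insert w H" "w \<notin> H" "finite H" using G vB finV' finite_subset by auto
      then have "card F = d" using G 3 by simp
      moreover have "F \<notin> FF"
      proof
        assume "F \<in> FF"
        then have "insert w H \<in> lnk v FF" using G * by (simp add: mem_lnk_iff)
        then have "w \<in> V'" using V' by blast
        then show False using G vB by blast
      qed
      moreover have "F \<subseteq> V" using G V'V v B_def by blast
      ultimately show "F \<in> M" by (simp add: M_def missing_def)
    qed
    moreover have "X \<inter> Y = {}"
    proof (rule ccontr)
      assume "X \<inter> Y \<noteq> {}"
      then obtain G w H where "insert v G = insert v (insert w H)" "G \<subseteq> V'" "w \<in> B"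
        by (auto simp: X_def Y_def LM_def missing_def)
      then have "w \<in> insert v G" by blast
      then show False using \<open>w \<in> B\<close> \<open>G \<subseteq> V'\<close> vB by blast
    qed
    ultimately have "card X + card Y \<le> card M"
      using card_Un_disjoint[of X Y] card_mono[OF finM, of "X \<union> Y"] finM finite_subset by (metis Un_least)
    then have "card LM + 2 * card B \<le> 2 * c - 1"
      using \<open>card X = card LM\<close> cY few unfolding M_def by linarith
    then show ?thesis using cardB c unfolding LM_def by linarith
  qed
qed

section \<open>Polynomial rings\<close>

definition mpolys :: "nat set \<Rightarrow> 'k::comm_ring_1 mpoly set" where
  "mpolys V = {p. \<forall>t\<in>keys p. keys t \<subseteq> V}"

lemma mpoly_ring_eq: "mpoly_ring n = ring_of (mpolys {1..n})"
  by (simp add: mpoly_ring_def ring_of_def mpolys_def)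

lemma mpolysI: "(\<And>t. t \<in> keys p \<Longrightarrow> keys t \<subseteq> V) \<Longrightarrow> p \<in> mpolys V"
  by (auto simp: mpolys_def)

lemma mpolysD: "p \<in> mpolys V \<Longrightarrow> t \<in> keys p \<Longrightarrow> keys t \<subseteq> V"
  by (auto simp: mpolys_def)

lemma mpolys_mono: "V \<subseteq> W \<Longrightarrow> mpolys V \<subseteq> mpolys W"
  by (auto simp: mpolys_def)

lemma keys_diff_subset:
  "keys (p - q :: 'a \<Rightarrow>\<^sub>0 'b::ab_group_add) \<subseteq> keys p \<union> keys q"
  by (auto simp: in_keys_iff lookup_minus)

lemma keys_add_nat:
  "keys (s + t :: 'a \<Rightarrow>\<^sub>0 nat) = keys s \<union> keys t"
  by (auto simp: in_keys_iff lookup_add)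

lemma subring_mpolys: "subring_set (mpolys V :: 'k::comm_ring_1 mpoly set)"
proof
  show "1 \<in> mpolys V" by (auto simp: mpolys_def)
  show "p - q \<in> mpolys V" if "p \<in> mpolys V" "q \<in> mpolys V" for p q :: "'k mpoly"
    using that keys_diff_subset[of p q] by (auto simp: mpolys_def)
  show "p * q \<in> mpolys V" if "p \<in> mpolys V" "q \<in> mpolys V" for p q :: "'k mpoly"
  proof (rule mpolysI)
    fix t assume "t \<in> keys (p * q)"
    then obtain u v where uv: "t = u + v" "u \<in> keys p" "v \<in> keys q"
      using keys_mult[of p q] by blast
    then show "keys t \<subseteq> V"
      using that by (auto simp: keys_add_nat mpolys_def)
  qed
qed

interpretation mpolys: subring_set "mpolys V :: 'k::comm_ring_1 mpoly set" for V
  by (rule subring_mpolys)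

lemma single_mem_mpolys: "keys t \<subseteq> V \<Longrightarrow> single t c \<in> mpolys V"
  by (auto simp: mpolys_def split: if_splits)

lemma indet_mem_mpolys: "i \<in> V \<Longrightarrow> indet i \<in> mpolys V"
  unfolding indet_def by (rule single_mem_mpolys) auto

lemma indet_power: "indet i ^ k = single (single i k) 1"
proof (induction k)
  case (Suc k)
  then show ?case by (simp add: indet_def mult_single single_add[symmetric])
qed simp

lemma sum_monomials: "p = (\<Sum>t\<in>keys p. single t (lookup p t))"
proof (rule poly_mapping_eqI)
  fix t
  have "lookup (\<Sum>t\<in>keys p. single t (lookup p t)) t
      = (\<Sum>u\<in>keys p. if u = t then lookup p t else 0)"
    unfolding lookup_sum by (intro sum.cong) (auto simp: lookup_single when_def)
  also have "\<dots> = lookup p t"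
    by (auto simp: in_keys_iff)
  finally show "lookup p t
    = lookup (\<Sum>t\<in>keys p. single t (lookup p t)) t" ..
qed

lemma lookup_monomial_mult:
  fixes p :: "'k::comm_ring_1 mpoly"
  shows "lookup (single s 1 * p) (s + t) = lookup p t"
proof -
  have "single s 1 * p
     = (\<Sum>u\<in>keys p. single (s + u) (lookup p u))"
    by (subst sum_monomials[of p]) (simp add: sum_distrib_left mult_single)
  then have "lookup (single s 1 * p) (s + t)
     = (\<Sum>u\<in>keys p. lookup (single (s + u) (lookup p u)) (s + t))"
    by (simp only: lookup_sum)
  also have "\<dots> = (\<Sum>u\<in>keys p. if u = t then lookup p t else 0)"
    by (intro sum.cong) (auto simp: lookup_single when_def)
  also have "\<dots> = lookup p t"
    by (auto simp: in_keys_iff)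
  finally show ?thesis .
qed

lemma keys_monomial_mult:
  fixes p :: "'k::comm_ring_1 mpoly"
  shows "keys (single s 1 * p) = (+) s ` keys p"
proof
  show "keys (single s 1 * p) \<subseteq> (+) s ` keys p"
    using keys_mult[of "single s (1::'k)" p] by (auto split: if_splits)
  show "(+) s ` keys p \<subseteq> keys (single s 1 * p)"
    by (auto simp: in_keys_iff lookup_monomial_mult)
qed

lemma exponent_decomp:
  fixes t :: "nat \<Rightarrow>\<^sub>0 nat"
  obtains u where "t = u + single i (lookup t i)" "i \<notin> keys u"
    "keys u = keys t - {i}"
proof -
  define u where "u = t - single i (lookup t i)"
  have l: "lookup u j = (if j = i then 0 else lookup t j)" for j
    by (simp add: u_def lookup_minus lookup_single when_def)
  have "t = u + single i (lookup t i)"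
    by (rule poly_mapping_eqI) (simp add: lookup_add l lookup_single when_def)
  moreover have "i \<notin> keys u" "keys u = keys t - {i}"
    by (auto simp: in_keys_iff l split: if_splits)
  ultimately show ?thesis by (rule that)
qed

text \<open>This makes statements about \<open>R[x]\<close>, namely the basis theorem and the
  contraction of Goldman primes, applicable to polynomial rings by adjoining one variable at a
  time.\<close>

lemma ring_ext_mpolys:
  "ring_ext (mpolys V) (indet i) = (mpolys (insert i V) :: 'k::comm_ring_1 mpoly set)"
proof
  interpret E: subring_set "ring_ext (mpolys V) (indet i) :: 'k mpoly set"
    by (rule mpolys.subring_ring_ext)
  show "ring_ext (mpolys V) (indet i) \<subseteq> (mpolys (insert i V) :: 'k mpoly set)"
  proof
    fix a :: "'k mpoly" assume "a \<in> ring_ext (mpolys V) (indet i)"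
    then obtain p where p: "p \<in> polys (mpolys V)" "a = poly p (indet i)" by (auto simp: ring_ext_def)
    have "coeff p j \<in> mpolys (insert i V)" for j using polysD[OF p(1)] mpolys_mono by blast
    then show "a \<in> mpolys (insert i V)"
      unfolding p(2) poly_altdef
      by (intro mpolys.sum_mem mpolys.mult_mem mpolys.power_mem indet_mem_mpolys) auto
  qed
  show "mpolys (insert i V) \<subseteq> (ring_ext (mpolys V) (indet i) :: 'k mpoly set)"
  proof
    fix p :: "'k mpoly" assume p: "p \<in> mpolys (insert i V)"
    have "(\<Sum>t\<in>keys p. single t (lookup p t)) \<in> ring_ext (mpolys V) (indet i)"
    proof (rule E.sum_mem)
      fix t assume t: "t \<in> keys p"
      obtain u where u: "t = u + single i (lookup t i)"
        "keys u = keys t - {i}"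
        using exponent_decomp[of t i] by blast
      have "single u (lookup p t) \<in> mpolys V"
        using mpolysD[OF p t] u by (intro single_mem_mpolys) auto
      then have 1: "single u (lookup p t) \<in> ring_ext (mpolys V) (indet i)"
        using mpolys.subset_ring_ext by blast
      have "single t (lookup p t)
          = single u (lookup p t) * indet i ^ lookup t i"
        by (subst u(1)) (simp add: indet_power mult_single)
      also have "\<dots> \<in> ring_ext (mpolys V) (indet i)"
        by (intro E.mult_mem 1 E.power_mem mpolys.mem_ring_ext)
      finally show "single t (lookup p t) \<in> ring_ext (mpolys V) (indet i)" .
    qed
    then show "p \<in> ring_ext (mpolys V) (indet i)" by (simp only: sum_monomials[of p, symmetric])
  qed
qed

lemma mpolys_empty: "mpolys {} = range (single 0 :: 'k::comm_ring_1 \<Rightarrow> _)"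
proof
  show "mpolys {} \<subseteq> range (single 0 :: 'k \<Rightarrow> _)"
  proof
    fix p :: "'k mpoly" assume "p \<in> mpolys {}"
    then have "keys p \<subseteq> {0}" by (auto simp: mpolys_def)
    then have "p = single 0 (lookup p 0)"
      by (intro poly_mapping_eqI) (auto simp: lookup_single when_def in_keys_iff)
    then show "p \<in> range (single 0)" by (rule range_eqI)
  qed
qed (auto simp: mpolys_def split: if_splits)

lemma noetherian_mpolys:
  assumes "finite V"
  shows "noetherian_ring (ring_of (mpolys V :: 'k::field mpoly set))"
  using assms
proof (induction V rule: finite_induct)
  case empty
  interpret C: cring "ring_of (mpolys {} :: 'k mpoly set)" by (rule mpolys.cring_ring_of)
  show ?case
  proof (rule C.noetherian_ringI)
    fix I assume "ideal I (ring_of (mpolys {} :: 'k mpoly set))"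
    then have I: "ideal_in (mpolys {}) I" by (simp add: mpolys.ideal_iff)
    show "\<exists>A\<subseteq>carrier (ring_of (mpolys {})). finite A \<and> I = genideal (ring_of (mpolys {})) A"
    proof (cases "I = {0}")
      case True
      have "genideal (ring_of (mpolys {} :: 'k mpoly set)) {0} = {0}" using C.genideal_zero by simp
      then show ?thesis using True by (intro exI[of _ "{0}"]) (auto simp: mpolys.zero_mem)
    next
      case False
      then obtain a where a: "a \<in> I" "a \<noteq> 0" using ideal_inD(2)[OF I] by blast
      obtain c where c: "a = single 0 c"
        using ideal_inD(1)[OF I a(1)] by (auto simp: mpolys_empty)
      have c0: "c \<noteq> 0" using a c by auto
      have "a * single 0 (inverse c) \<in> I"
        using a by (intro ideal_inD(4)[OF I]) (auto simp: mpolys_empty)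
      then have "1 \<in> I" using c c0 by (simp add: mult_single)
      then have "I = mpolys {}" using ideal_inD(1,4)[OF I] by (metis mult_1 subsetI subset_antisym)
      then show ?thesis
        using C.genideal_one mpolys.one_mem by (intro exI[of _ "{1}"]) auto
    qed
  qed
next
  case (insert i V)
  then show ?case using mpolys.hilbert_basis[of V "indet i"] by (simp add: ring_ext_mpolys)
qed

section \<open>Face ideals\<close>

text \<open>For down-closed \<open>\<Delta>\<close> this is the Stanley--Reisner ideal, given by its
  monomials so that the effect of adding or dividing out a variable is visible. For
  \<open>Pow F\<close> the residue ring is the polynomial ring in the variables of
  \<open>F\<close>.\<close>

definition face_ideal :: "nat set \<Rightarrow> nat set set \<Rightarrow> 'k::comm_ring_1 mpoly set" where
  "face_ideal V \<Delta> = {p \<in> mpolys V. \<forall>t\<in>keys p. keys t \<notin> \<Delta>}"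

definition down_closed :: "nat set set \<Rightarrow> bool" where
  "down_closed \<Delta> \<longleftrightarrow> (\<forall>F\<in>\<Delta>. \<forall>G. G \<subseteq> F \<longrightarrow> G \<in> \<Delta>)"

lemma face_ideal_subset: "face_ideal V \<Delta> \<subseteq> mpolys V"
  by (auto simp: face_ideal_def)

lemma ideal_face_ideal:
  assumes "down_closed \<Delta>"
  shows "ideal_in (mpolys V) (face_ideal V \<Delta> :: 'k::comm_ring_1 mpoly set)"
  unfolding ideal_in_def
proof (intro conjI ballI face_ideal_subset)
  show "0 \<in> face_ideal V \<Delta>" by (simp add: face_ideal_def mpolys.zero_mem)
  fix p q :: "'k mpoly"
  show "p + q \<in> face_ideal V \<Delta>" if "p \<in> face_ideal V \<Delta>" "q \<in> face_ideal V \<Delta>"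
    using that keys_add[of p q] by (auto simp: face_ideal_def mpolys.add_mem)
  show "p * q \<in> face_ideal V \<Delta>" if "p \<in> face_ideal V \<Delta>" "q \<in> mpolys V"
  proof -
    have "keys t \<notin> \<Delta>" if "t \<in> keys (p * q)" for t
    proof -
      obtain u v where uv: "t = u + v" "u \<in> keys p"
        using keys_mult[of p q] \<open>t \<in> _\<close> by blast
      then have "keys u \<notin> \<Delta>" using \<open>p \<in> face_ideal V \<Delta>\<close> by (auto simp: face_ideal_def)
      then show ?thesis using assms uv by (auto simp: down_closed_def keys_add_nat)
    qed
    then show ?thesis using that by (auto simp: face_ideal_def mpolys.mult_mem)
  qed
qed

lemma monomial_mem_face_ideal:
  assumes "keys t \<subseteq> V" "keys t \<notin> \<Delta>"
  shows "single t c \<in> face_ideal V \<Delta>"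
  using assms single_mem_mpolys[of t V c] by (auto simp: face_ideal_def)

lemma mem_ideal_if_monomials:
  assumes I: "ideal_in (mpolys V) (I :: 'k::comm_ring_1 mpoly set)"
    and "\<And>t. t \<in> keys p \<Longrightarrow> single t 1 \<in> I"
  shows "p \<in> I"
proof -
  have "single t (lookup p t) \<in> I" if "t \<in> keys p" for t
  proof -
    have "single t 1 * single 0 (lookup p t) \<in> I"
      using assms(2)[OF that] by (intro ideal_inD(4)[OF I] single_mem_mpolys) auto
    then show ?thesis by (simp add: mult_single)
  qed
  then have "(\<Sum>t\<in>keys p. single t (lookup p t)) \<in> I"
    by (intro mpolys.ideal_in_sum[OF I])
  then show ?thesis by (simp only: sum_monomials[of p, symmetric])
qed

lemma prod_indet:
  "finite F \<Longrightarrow> (\<Prod>i\<in>F. indet i) = single (\<Sum>i\<in>F. single i 1) (1 :: 'k::comm_ring_1)"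
  by (induction F rule: finite_induct) (auto simp: indet_def mult_single)

lemma lookup_sum_single:
  "finite F \<Longrightarrow> lookup (\<Sum>i\<in>F. single i (1::nat)) j = (if j \<in> F then 1 else 0)"
  by (simp add: lookup_sum lookup_single when_def)

text \<open>A monomial whose support is a nonface is divisible by the squarefree monomial with that
  support, which is one of the generators.\<close>

lemma stanley_reisner_ideal_eq:
  assumes "down_closed \<Delta>"
  shows "stanley_reisner_ideal n \<Delta> = (face_ideal {1..n} \<Delta> :: 'k::field mpoly set)"
proof -
  let ?G = "{\<Prod>i\<in>F. indet i | F. F \<subseteq> {1..n} \<and> F \<notin> \<Delta>} :: 'k mpoly set"
  have G: "?G \<subseteq> mpolys {1..n}"
    by (auto intro!: mpolys.prod_mem indet_mem_mpolys)
  have "mpolys.Idl_R {1..n} ?G = face_ideal {1..n} \<Delta>"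
  proof
    have "?G \<subseteq> face_ideal {1..n} \<Delta>"
    proof clarify
      fix F :: "nat set" assume F: "F \<subseteq> {1..n}" "F \<notin> \<Delta>"
      then have fin: "finite F" using finite_subset by blast
      have "keys (\<Sum>i\<in>F. single i (1::nat)) = F"
        using lookup_sum_single[OF fin] by (auto simp: in_keys_iff split: if_splits)
      then show "(\<Prod>i\<in>F. indet i) \<in> (face_ideal {1..n} \<Delta> :: 'k mpoly set)"
        using F fin by (simp add: prod_indet monomial_mem_face_ideal)
    qed
    then show "mpolys.Idl_R {1..n} ?G \<subseteq> face_ideal {1..n} \<Delta>"
      by (intro mpolys.Idl_minimal ideal_face_ideal assms)
    show "face_ideal {1..n} \<Delta> \<subseteq> mpolys.Idl_R {1..n} ?G"
    proof
      fix p :: "'k mpoly" assume p: "p \<in> face_ideal {1..n} \<Delta>"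
      have id: "ideal_in (mpolys {1..n}) (mpolys.Idl_R {1..n} ?G)" by (rule mpolys.ideal_Idl[OF G])
      show "p \<in> mpolys.Idl_R {1..n} ?G"
      proof (rule mem_ideal_if_monomials[OF id])
        fix t assume t: "t \<in> keys p"
        define F where "F = keys t"
        have F: "F \<subseteq> {1..n}" "F \<notin> \<Delta>" "finite F" using p t by (auto simp: face_ideal_def mpolys_def F_def)
        define s where "s = (\<Sum>i\<in>F. single i (1::nat))"
        have s: "lookup s j = (if j \<in> F then 1 else 0)" for j
          unfolding s_def by (rule lookup_sum_single[OF F(3)])
        have "t = s + (t - s)"
          by (rule poly_mapping_eqI) (auto simp: lookup_add lookup_minus s F_def in_keys_iff)
        then have "single t 1 = (\<Prod>i\<in>F. indet i) * single (t - s) (1::'k)"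
          unfolding prod_indet[OF F(3)] s_def[symmetric] by (simp add: mult_single)
        also have "\<dots> \<in> mpolys.Idl_R {1..n} ?G"
        proof (rule ideal_inD(4)[OF id])
          show "(\<Prod>i\<in>F. indet i) \<in> mpolys.Idl_R {1..n} ?G"
            using mpolys.Idl_superset[OF G] F by blast
          have "keys (t - s) \<subseteq> F" by (auto simp: in_keys_iff lookup_minus F_def)
          then show "single (t - s) 1 \<in> mpolys {1..n}" using F by (intro single_mem_mpolys) auto
        qed
        finally show "single t 1 \<in> mpolys.Idl_R {1..n} ?G" .
      qed
    qed
  qed
  then show ?thesis by (simp add: stanley_reisner_ideal_def mpoly_ring_eq)
qed

text \<open>The quotient end of the exact sequence for \<open>indet v\<close>: setting the variable
  to zero leaves the ring of the deletion.\<close>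

lemma face_ideal_adj_indet:
  assumes D: "down_closed \<Delta>" and v: "v \<in> V"
  shows "mpolys.adj V (face_ideal V \<Delta>) (indet v) = (face_ideal V {F \<in> \<Delta>. v \<notin> F} :: 'k::comm_ring_1 mpoly set)"
proof
  have D': "down_closed {F \<in> \<Delta>. v \<notin> F}" using D by (auto simp: down_closed_def)
  show "mpolys.adj V (face_ideal V \<Delta>) (indet v) \<subseteq> (face_ideal V {F \<in> \<Delta>. v \<notin> F} :: 'k mpoly set)"
  proof (rule mpolys.adj_minimal[OF ideal_face_ideal[OF D']])
    show "indet v \<in> face_ideal V {F \<in> \<Delta>. v \<notin> F}"
      unfolding indet_def using v by (intro monomial_mem_face_ideal) auto
  qed (auto simp: face_ideal_def)
  have id: "ideal_in (mpolys V) (mpolys.adj V (face_ideal V \<Delta>) (indet v) :: 'k mpoly set)"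
    using v by (intro mpolys.ideal_adj ideal_face_ideal D indet_mem_mpolys)
  show "face_ideal V {F \<in> \<Delta>. v \<notin> F} \<subseteq> (mpolys.adj V (face_ideal V \<Delta>) (indet v) :: 'k mpoly set)"
  proof
    fix p :: "'k mpoly" assume p: "p \<in> face_ideal V {F \<in> \<Delta>. v \<notin> F}"
    show "p \<in> mpolys.adj V (face_ideal V \<Delta>) (indet v)"
    proof (rule mem_ideal_if_monomials[OF id])
      fix t assume t: "t \<in> keys p"
      then have tV: "keys t \<subseteq> V" using p by (auto simp: face_ideal_def mpolys_def)
      show "single t (1::'k) \<in> mpolys.adj V (face_ideal V \<Delta>) (indet v)"
      proof (cases "v \<in> keys t")
        case False
        then have "keys t \<notin> \<Delta>" using p t by (auto simp: face_ideal_def)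
        then show ?thesis using tV mpolys.adj_superset monomial_mem_face_ideal by blast
      next
        case True
        define s where "s = t - single v 1"
        have "t = single v 1 + s"
          using True by (intro poly_mapping_eqI) (auto simp: s_def lookup_add lookup_minus lookup_single when_def in_keys_iff)
        then have "single t (1::'k) = indet v * single s 1"
          by (simp add: indet_def mult_single)
        also have "\<dots> \<in> mpolys.adj V (face_ideal V \<Delta>) (indet v)"
        proof (rule ideal_inD(4)[OF id])
          show "indet v \<in> mpolys.adj V (face_ideal V \<Delta>) (indet v :: 'k mpoly)"
            by (rule mpolys.mem_adj[OF ideal_face_ideal[OF D]])
          have "keys s \<subseteq> keys t" by (auto simp: s_def in_keys_iff lookup_minus)
          then show "single s 1 \<in> mpolys V" using tV by (intro single_mem_mpolys) auto
        qed
        finally show ?thesis .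
      qed
    qed
  qed
qed

text \<open>Multiplication by a variable shifts exponents injectively and adds \<open>v\<close> to
  each support. The complex on the right is the closed star of \<open>v\<close>, that is, the cone
  over its link with apex \<open>v\<close>.\<close>

lemma face_ideal_colon_indet:
  assumes v: "v \<in> V"
  shows "mpolys.colon V (face_ideal V \<Delta>) (indet v) = (face_ideal V {F. insert v F \<in> \<Delta>} :: 'k::comm_ring_1 mpoly set)"
proof -
  have keys: "keys (indet v * p) = (+) (single v 1) ` keys p" for p :: "'k mpoly"
    unfolding indet_def by (rule keys_monomial_mult)
  show ?thesis
    using v by (auto simp: mpolys.colon_def face_ideal_def keys keys_add_nat mpolys.mult_mem indet_mem_mpolys)
qed

section \<open>Elements that are monic in one variable\<close>

definition var_poly :: "nat \<Rightarrow> 'k::comm_ring_1 poly \<Rightarrow> 'k mpoly" where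
  "var_poly i q = poly (map_poly (single 0) q) (indet i)"

text \<open>Expresses that \<open>indet i\<close> is a free variable modulo \<open>I\<close>: the
  residue ring is a polynomial ring in it, and membership in \<open>I\<close> is decided coefficient
  by coefficient.\<close>

definition coeff_closed :: "nat set \<Rightarrow> nat \<Rightarrow> 'k::comm_ring_1 mpoly set \<Rightarrow> bool" where
  "coeff_closed V i I \<longleftrightarrow> (\<forall>P\<in>polys (mpolys (V - {i})). poly P (indet i) \<in> I \<longrightarrow> P \<in> polys I)"

lemma map_poly_single_polys: "map_poly (single 0) q \<in> polys (mpolys V)"
  by (auto simp: polys_def coeff_map_poly intro: single_mem_mpolys)

lemma var_poly_mem: "i \<in> V \<Longrightarrow> var_poly i q \<in> mpolys V"
  using mpolys.poly_mem_ring_ext[OF map_poly_single_polys[of q V], of "indet i"]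
  by (simp add: var_poly_def ring_ext_mpolys insert_absorb)

text \<open>Modulo \<open>I\<close> this is a polynomial in a free variable whose leading
  coefficient is a nonzero scalar, hence a unit; it cannot annihilate the top coefficient of
  \<open>A\<close> outside \<open>I\<close>.\<close>

lemma nzd_var_poly:
  fixes q :: "'k::field poly"
  assumes I: "ideal_in (mpolys V) I" and i: "i \<in> V" and cc: "coeff_closed V i I" and q: "q \<noteq> 0"
  shows "mpolys.nzd V I (var_poly i q)"
  unfolding mpolys.nzd_def
proof (intro ballI impI)
  fix a assume a: "a \<in> mpolys V" "var_poly i q * a \<in> I"
  have a': "a \<in> ring_ext (mpolys (V - {i})) (indet i)" using a(1) i by (simp add: ring_ext_mpolys insert_absorb)
  then obtain A where A: "A \<in> polys (mpolys (V - {i}))" "a = poly A (indet i)" by (auto simp: ring_ext_def)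
  define Z :: "'k mpoly poly" where "Z = map_poly (single 0) q"
  interpret P: subring_set "polys (mpolys (V - {i})) :: 'k mpoly poly set" by (rule mpolys.subring_polys)
  have "Z * A \<in> polys (mpolys (V - {i}))"
    using A unfolding Z_def by (intro P.mult_mem map_poly_single_polys)
  moreover have "poly (Z * A) (indet i) \<in> I" using a A by (simp add: Z_def var_poly_def)
  ultimately have ZA: "Z * A \<in> polys I" using cc by (auto simp: coeff_closed_def)
  have "A \<in> polys I"
  proof (rule ccontr)
    assume "A \<notin> polys I"
    from mpolys.exists_top_coeff[OF ideal_inD(2)[OF I] this] obtain k where
      k: "coeff A k \<notin> I" "\<And>j. j > k \<Longrightarrow> coeff A j \<in> I" by blast
    define m where "m = degree q"
    have Zc: "coeff Z j = single 0 (coeff q j)" for j by (simp add: Z_def coeff_map_poly)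
    have "coeff (Z * A) (m + k) = (\<Sum>j\<le>m + k. coeff Z j * coeff A (m + k - j))"
      by (simp add: coeff_mult)
    also have "\<dots> = coeff Z m * coeff A k + (\<Sum>j\<in>{..m + k} - {m}. coeff Z j * coeff A (m + k - j))"
      by (subst sum.remove[of _ m]) auto
    finally have eq: "coeff Z m * coeff A k = coeff (Z * A) (m + k)
      - (\<Sum>j\<in>{..m + k} - {m}. coeff Z j * coeff A (m + k - j))" by simp
    have "(\<Sum>j\<in>{..m + k} - {m}. coeff Z j * coeff A (m + k - j)) \<in> I"
    proof (rule mpolys.ideal_in_sum[OF I])
      fix j assume j: "j \<in> {..m + k} - {m}"
      show "coeff Z j * coeff A (m + k - j) \<in> I"
      proof (cases "j > m")
        case True
        then have "coeff Z j = 0" by (simp add: Zc m_def coeff_eq_0)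
        then show ?thesis using ideal_inD(2)[OF I] by simp
      next
        case False
        then have "coeff A (m + k - j) \<in> I" using j by (intro k(2)) auto
        then show ?thesis by (intro ideal_inD(5)[OF I]) (auto simp: Zc intro: single_mem_mpolys)
      qed
    qed
    then have "coeff Z m * coeff A k \<in> I"
      unfolding eq using polysD[OF ZA] by (intro mpolys.ideal_in_diff[OF I])
    then have "coeff Z m * coeff A k * single 0 (inverse (coeff q m)) \<in> I"
      by (rule ideal_inD(4)[OF I]) (auto intro: single_mem_mpolys)
    also have "coeff Z m * coeff A k * single 0 (inverse (coeff q m))
        = coeff A k * (single 0 (coeff q m) * single 0 (inverse (coeff q m)))"
      by (simp add: Zc mult_ac)
    also have "\<dots> = coeff A k" using q by (simp add: mult_single m_def)
    finally show False using k by simp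
  qed
  moreover have "poly A (indet i) = (\<Sum>j\<le>degree A. coeff A j * indet i ^ j)" by (rule poly_altdef)
  ultimately show "a \<in> I"
    unfolding A(2) using polysD[of A I] i
    by (auto intro!: mpolys.ideal_in_sum[OF I] ideal_inD(4)[OF I] mpolys.power_mem indet_mem_mpolys)
qed

text \<open>An element without the variable \<open>i\<close> acts on the coefficients one by one.
  Killing one of the \<open>z j\<close> therefore leaves the other variables free.\<close>

lemma coeff_closed_adj:
  fixes y :: "'k::field mpoly"
  assumes i: "i \<in> V" and cc: "coeff_closed V i I" and y: "y \<in> mpolys (V - {i})"
  shows "coeff_closed V i (mpolys.adj V I y)"
  unfolding coeff_closed_def
proof (intro ballI impI)
  fix P assume P: "P \<in> polys (mpolys (V - {i}))" "poly P (indet i) \<in> mpolys.adj V I y"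
  interpret P: subring_set "polys (mpolys (V - {i})) :: 'k mpoly poly set" by (rule mpolys.subring_polys)
  from P(2) obtain a b where ab: "poly P (indet i) = a + y * b" "a \<in> I" "b \<in> mpolys V"
    by (auto elim!: mpolys.adjE)
  have "b \<in> ring_ext (mpolys (V - {i})) (indet i)" using ab(3) i by (simp add: ring_ext_mpolys insert_absorb)
  then obtain B where B: "B \<in> polys (mpolys (V - {i}))" "b = poly B (indet i)" by (auto simp: ring_ext_def)
  have "poly (P - [:y:] * B) (indet i) = a" using ab B by simp
  moreover have "P - [:y:] * B \<in> polys (mpolys (V - {i}))"
    using P B y by (intro P.diff_mem P.mult_mem mpolys.const_polys mpolys.zero_mem)
  ultimately have *: "P - [:y:] * B \<in> polys I" using cc ab by (auto simp: coeff_closed_def)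
  have "coeff P e \<in> mpolys.adj V I y" for e
  proof -
    have "coeff P e = coeff (P - [:y:] * B) e + y * coeff B e" by simp
    moreover have "coeff B e \<in> mpolys V" using polysD[OF B(1)] mpolys_mono[of "V - {i}" V] by blast
    ultimately show ?thesis using polysD[OF *] mpolys.adjI by metis
  qed
  then show "P \<in> polys (mpolys.adj V I y)" by (simp add: polys_def)
qed

text \<open>Different powers of \<open>indet i\<close>, with coefficients that do not involve it,
  have no monomial in common.\<close>

lemma lookup_poly_indet:
  fixes P :: "'k::comm_ring_1 mpoly poly"
  assumes P: "P \<in> polys (mpolys (V - {i}))" and t: "i \<notin> keys t"
  shows "lookup (poly P (indet i)) (single i e + t) = lookup (coeff P e) t"
proof -
  have *: "lookup (coeff P j * indet i ^ j) (single i e + t)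
      = (if j = e then lookup (coeff P e) t else 0)" for j
  proof (cases "j = e")
    case True
    then show ?thesis using lookup_monomial_mult[of "single i e" "coeff P e" t]
      by (simp add: indet_power mult.commute)
  next
    case False
    have "single i e + t \<notin> keys (coeff P j * indet i ^ j)"
    proof
      assume "single i e + t \<in> keys (coeff P j * indet i ^ j)"
      then obtain u where u: "u \<in> keys (coeff P j)" "single i e + t = single i j + u"
        using keys_monomial_mult[of "single i j" "coeff P j"]
        by (auto simp: indet_power mult.commute)
      have "i \<notin> keys u" using mpolysD[OF polysD[OF P] u(1)] by blast
      then have "lookup (single i j + u) i = j" by (simp add: lookup_add in_keys_iff)
      moreover have "lookup (single i e + t) i = e" using t by (simp add: lookup_add in_keys_iff)
      ultimately show False using u False by simp
    qed
    then show ?thesis using False by (simp add: in_keys_iff)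
  qed
  show ?thesis
    unfolding poly_altdef lookup_sum * by (auto simp: coeff_eq_0)
qed

text \<open>As \<open>i\<close> belongs to \<open>F\<close>, a factor \<open>indet i\<close> does
  not affect whether a support is contained in \<open>F\<close>.\<close>

lemma coeff_closed_face_ideal:
  assumes "i \<in> F" "i \<in> V"
  shows "coeff_closed V i (face_ideal V (Pow F) :: 'k::comm_ring_1 mpoly set)"
  unfolding coeff_closed_def polys_def[of "face_ideal _ _"]
proof (intro ballI impI CollectI allI)
  fix P :: "'k mpoly poly" and e
  assume P: "P \<in> polys (mpolys (V - {i}))" "poly P (indet i) \<in> face_ideal V (Pow F)"
  have c: "coeff P e \<in> mpolys (V - {i})" using polysD[OF P(1)] .
  have "\<not> keys t \<subseteq> F" if t: "t \<in> keys (coeff P e)" for t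
  proof -
    have "i \<notin> keys t" using mpolysD[OF c t] by blast
    then have "single i e + t \<in> keys (poly P (indet i))"
      using t lookup_poly_indet[OF P(1), of t e] by (simp add: in_keys_iff)
    then have "\<not> keys (single i e + t) \<subseteq> F"
      using P(2) by (auto simp: face_ideal_def)
    then show ?thesis using assms by (auto simp: keys_add_nat split: if_splits)
  qed
  moreover have "coeff P e \<in> mpolys V" using c mpolys_mono[of "V - {i}" V] by blast
  ultimately show "coeff P e \<in> face_ideal V (Pow F)" by (auto simp: face_ideal_def)
qed

lemma indep_on_var_poly:
  fixes q :: "nat \<Rightarrow> 'k::field poly"
  assumes "ideal_in (mpolys V) I" "U \<subseteq> V" "\<And>i. i \<in> U \<Longrightarrow> coeff_closed V i I" "\<And>i. i \<in> U \<Longrightarrow> q i \<noteq> 0"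
  shows "mpolys.indep_on V r (\<lambda>i. var_poly i (q i)) U I"
  using assms
proof (induction r arbitrary: U I)
  case (Suc r)
  show ?case
    unfolding mpolys.indep_on.simps
  proof (intro ballI conjI)
    fix i assume i: "i \<in> U"
    show "mpolys.nzd V I (var_poly i (q i))" using Suc.prems i by (intro nzd_var_poly) auto
    show "mpolys.indep_on V r (\<lambda>i. var_poly i (q i)) (U - {i}) (mpolys.adj V I (var_poly i (q i)))"
    proof (rule Suc.IH)
      show "ideal_in (mpolys V) (mpolys.adj V I (var_poly i (q i)))"
        using Suc.prems i by (intro mpolys.ideal_adj var_poly_mem) auto
      show "coeff_closed V j (mpolys.adj V I (var_poly i (q i)))" if "j \<in> U - {i}" for j
        using Suc.prems i that by (intro coeff_closed_adj var_poly_mem) auto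
    qed (use Suc.prems in auto)
  qed
qed simp

section \<open>A weakly regular sequence on the Stanley--Reisner ring\<close>

text \<open>For \<open>i\<close> outside \<open>F\<close> every monomial of \<open>z i\<close>
  involves the variable \<open>i\<close>, because the constant term of \<open>q i\<close> is zero.
  So \<open>z i\<close> vanishes modulo the ideal, and the symmetric polynomials over
  \<open>V\<close> agree with those over \<open>F\<close>.\<close>

lemma wreg_simplex:
  fixes q :: "nat \<Rightarrow> 'k::field poly"
  assumes V: "finite V" "F \<subseteq> V" and q: "\<And>i. i \<in> V \<Longrightarrow> q i \<noteq> 0 \<and> coeff (q i) 0 = 0"
  defines "z \<equiv> \<lambda>i. var_poly i (q i)"
  shows "mpolys.wreg V (face_ideal V (Pow F)) (map (mpolys.esym z V) (rev [1..<Suc (card F)]))"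
proof -
  have D: "down_closed (Pow F)" by (auto simp: down_closed_def)
  note I = ideal_face_ideal[OF D, of V]
  have zV: "z i \<in> mpolys V" if "i \<in> V" for i unfolding z_def using that by (rule var_poly_mem)
  have zI: "z i \<in> face_ideal V (Pow F)" if i: "i \<in> V - F" for i
  proof -
    have eq: "z i = (\<Sum>j\<le>degree (map_poly (single 0 :: 'k \<Rightarrow> 'k mpoly) (q i)).
        single (single i j) (coeff (q i) j))"
      by (simp add: z_def var_poly_def poly_altdef coeff_map_poly indet_power mult_single)
    show ?thesis
      unfolding eq
    proof (rule mpolys.ideal_in_sum[OF I])
      fix j
      show "single (single i j) (coeff (q i) j) \<in> face_ideal V (Pow F)"
      proof (cases "j = 0")
        case True
        then show ?thesis using q[of i] i ideal_inD(2)[OF I] by simp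
      next
        case False
        then show ?thesis using i by (intro monomial_mem_face_ideal) auto
      qed
    qed
  qed
  show ?thesis
  proof (rule mpolys.wreg_esym[OF I])
    show "finite F" using V finite_subset by blast
    show "mpolys.indep_on V (card F) z F (face_ideal V (Pow F))"
      unfolding z_def using V q by (intro indep_on_var_poly I coeff_closed_face_ideal) auto
    show "mpolys.esym z V j \<in> mpolys V" for j using zV by (intro mpolys.esym_mem)
    show "mpolys.esym z V j - mpolys.esym z F j \<in> face_ideal V (Pow F)" for j
      using V zV zI by (intro mpolys.esym_diff_mem[OF _ _ I])
  qed (use V zV in auto)
qed

text \<open>Encodes iterated stars: the cone points \<open>W\<close> are the vertices at which a
  link was taken, and their variables remain free in the residue ring.\<close>

definition join :: "'v set set \<Rightarrow> 'v set \<Rightarrow> 'v set set" where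
  "join FF W = {G. \<exists>F\<in>FF. G \<subseteq> F \<union> W}"

lemma down_closed_join: "down_closed (join FF W)"
  by (auto simp: down_closed_def join_def)

text \<open>A face that omits \<open>v\<close> but lies in a facet \<open>F\<close> through
  \<open>v\<close> also lies in a facet without \<open>v\<close>: the set \<open>F - {v}\<close> is
  not blocked at \<open>v\<close>, so \<open>v\<close> can be exchanged for some
  \<open>w\<close>.\<close>

lemma join_del:
  assumes FF: "\<And>F. F \<in> FF \<Longrightarrow> F \<subseteq> X \<and> card F = d" and X: "finite X" and v: "v \<notin> W" "v \<in> X"
    and nb: "\<And>G. \<not> blocked X d FF G v"
  shows "{G \<in> join FF W. v \<notin> G} = join (del v FF) W"
proof
  show "join (del v FF) W \<subseteq> {G \<in> join FF W. v \<notin> G}" using v by (auto simp: join_def del_def)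
  show "{G \<in> join FF W. v \<notin> G} \<subseteq> join (del v FF) W"
  proof clarify
    fix G assume "G \<in> join FF W" "v \<notin> G"
    then obtain F where F: "F \<in> FF" "G \<subseteq> F \<union> W" by (auto simp: join_def)
    show "G \<in> join (del v FF) W"
    proof (cases "v \<in> F")
      case False
      then show ?thesis using F by (auto simp: join_def del_def)
    next
      case True
      have fin: "finite F" using FF[OF F(1)] X finite_subset by blast
      have F': "insert v (F - {v}) = F" using True by auto
      have "card (F - {v}) + 1 = d" using FF[OF F(1)] True fin
        by (metis Suc_eq_plus1 card_Suc_Diff1)
      then obtain w where w: "w \<in> X - F" "insert w (F - {v}) \<in> FF"
        using nb[of "F - {v}"] FF[OF F(1)] F(1) v F' by (auto simp: blocked_def)
      then have "insert w (F - {v}) \<in> del v FF" using v True by (auto simp: del_def)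
      moreover have "G \<subseteq> insert w (F - {v}) \<union> W" using F \<open>v \<notin> G\<close> by auto
      ultimately show ?thesis unfolding join_def by blast
    qed
  qed
qed

text \<open>The star of \<open>v\<close> is again a join: \<open>v\<close> moves into the cone part,
  so the facets lose one vertex while \<open>W\<close> gains one.\<close>

lemma join_lnk:
  assumes "v \<notin> W"
  shows "{G. insert v G \<in> join FF W} = join (lnk v FF) (insert v W)"
proof
  show "{G. insert v G \<in> join FF W} \<subseteq> join (lnk v FF) (insert v W)"
  proof clarify
    fix G assume "insert v G \<in> join FF W"
    then obtain F where F: "F \<in> FF" "insert v G \<subseteq> F \<union> W" by (auto simp: join_def)
    then have "v \<in> F" using assms by auto
    then have "F - {v} \<in> lnk v FF" using F by (auto simp: lnk_def)
    moreover have "G \<subseteq> (F - {v}) \<union> insert v W" using F by auto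
    ultimately show "G \<in> join (lnk v FF) (insert v W)" by (auto simp: join_def)
  qed
  show "join (lnk v FF) (insert v W) \<subseteq> {G. insert v G \<in> join FF W}"
  proof clarify
    fix G assume "G \<in> join (lnk v FF) (insert v W)"
    then obtain H where H: "v \<notin> H" "insert v H \<in> FF" "G \<subseteq> H \<union> insert v W"
      by (auto simp: join_def mem_lnk_iff)
    then have "insert v G \<subseteq> insert v H \<union> W" by auto
    then show "insert v G \<in> join FF W" using H by (auto simp: join_def)
  qed
qed

text \<open>The description of the deletion applied to singletons: the face \<open>{w}\<close> omits
  \<open>v\<close>, so it lies in a facet that omits \<open>v\<close>.\<close>

lemma cover_del:
  assumes FF: "\<And>F. F \<in> FF \<Longrightarrow> F \<subseteq> X \<and> card F = d" and X: "finite X" and cover: "\<Union>FF = X"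
    and v: "v \<in> X" and nb: "\<And>G. \<not> blocked X d FF G v"
  shows "\<Union>(del v FF) = X - {v}"
proof
  show "\<Union>(del v FF) \<subseteq> X - {v}" using FF by (auto simp: del_def)
  show "X - {v} \<subseteq> \<Union>(del v FF)"
  proof
    fix w assume w: "w \<in> X - {v}"
    then obtain F where "F \<in> FF" "w \<in> F" using cover by blast
    then have "{w} \<in> {G \<in> join FF {}. v \<notin> G}" using w by (auto simp: join_def)
    then have "{w} \<in> join (del v FF) {}" using join_del[OF FF X _ v nb, of "{}"] by simp
    then show "w \<in> \<Union>(del v FF)" by (auto simp: join_def)
  qed
qed

lemma missing_del: "missing (X - {v}) d (del v FF) = {F \<in> missing X d FF. v \<notin> F}"
  by (auto simp: missing_def del_def)

text \<open>Induction on the number of vertices along the exact sequence for a shedding vertex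
  \<open>v\<close>. The deletion has parameters \<open>d\<close>, \<open>c - 1\<close> and
  \<open>W\<close>, the star has \<open>d - 1\<close>, \<open>c'\<close> and
  \<open>insert v W\<close>. Thus \<open>d + card W\<close>, and with it the sequence, is the same
  at both ends.\<close>

theorem wreg_few_missing:
  fixes q :: "nat \<Rightarrow> 'k::field poly"
  assumes V: "finite V" and q: "\<And>i. i \<in> V \<Longrightarrow> q i \<noteq> 0 \<and> coeff (q i) 0 = 0"
    and X: "X \<subseteq> V" "card X = d + c" and FF: "\<And>F. F \<in> FF \<Longrightarrow> F \<subseteq> X \<and> card F = d"
    and ne: "FF \<noteq> {}" and cover: "\<Union>FF = X"
    and few: "card (missing X d FF) \<le> 2 * c - 1" and W: "W \<subseteq> V" "W \<inter> X = {}"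
  defines "z \<equiv> \<lambda>i. var_poly i (q i)"
  shows "mpolys.wreg V (face_ideal V (join FF W)) (map (mpolys.esym z V) (rev [1..<Suc (d + card W)]))"
  using X FF ne cover few W
proof (induction "card X" arbitrary: X FF W d c rule: less_induct)
  case less
  note X = less.prems(1,2) and FF = less.prems(3) and cover = less.prems(5)
  have finX: "finite X" using X V finite_subset by blast
  have finW: "finite W" using less.prems V finite_subset by blast
  show ?case
  proof (cases "c = 0")
    \<comment> \<open>Only \<open>X\<close> itself can now be a member of \<open>FF\<close>, so the
      complex is a simplex.\<close>
    case True
    have eqX: "F = X" if "F \<in> FF" for F
      using FF[OF that] X True card_subset_eq[OF finX, of F] by simp
    then have "FF = {X}" using less.prems(4) by blast
    then have "join FF W = Pow (X \<union> W)" by (auto simp: join_def)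
    moreover have "card (X \<union> W) = d + card W"
      using card_Un_disjoint[OF finX finW] less.prems(8) X(2) True by (simp add: Int_commute)
    ultimately show ?thesis
      using wreg_simplex[OF V, of "X \<union> W" q] less.prems q unfolding z_def by simp
  next
    case False
    then have c: "c \<ge> 1" by simp
    from exists_shedding_vertex[OF finX X(2) c FF cover less.prems(6)] obtain v where
      v: "v \<in> X" "\<And>G. \<not> blocked X d FF G v" "card {F \<in> missing X d FF. v \<notin> F} \<le> 2 * (c - 1) - 1" by blast
    have vW: "v \<notin> W" "v \<in> V" using v X less.prems by auto
    have zV: "z i \<in> mpolys V" if "i \<in> V" for i unfolding z_def using that by (rule var_poly_mem)
    let ?fs = "map (mpolys.esym z V) (rev [1..<Suc (d + card W)])"
    obtain F0 where F0: "F0 \<in> FF" "v \<in> F0" using v cover by blast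
    have finF0: "finite F0" using FF[OF F0(1)] finX finite_subset by blast
    have "card F0 \<noteq> 0" using F0 finF0 by auto
    then have d: "d \<ge> 1" using FF[OF F0(1)] by simp
    have lt: "card (X - {v}) < card X" using v finX by (intro card_Diff1_less)
    show ?thesis
    proof (rule mpolys.wreg_extension[where y = "indet v"])
      show "ideal_in (mpolys V) (face_ideal V (join FF W) :: 'k mpoly set)" by (rule ideal_face_ideal[OF down_closed_join])
      show "indet v \<in> (mpolys V :: 'k mpoly set)" using vW by (intro indet_mem_mpolys)
      show "set ?fs \<subseteq> mpolys V" using zV by (auto intro!: mpolys.esym_mem)
      have "mpolys.wreg V (face_ideal V (join (del v FF) W)) ?fs"
      proof (rule less.hyps[OF lt, of d "c - 1"])
        show "card (X - {v}) = d + (c - 1)" using v X c finX by simp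
        show cov: "\<Union>(del v FF) = X - {v}" using cover_del[OF FF finX cover v(1,2)] .
        show "del v FF \<noteq> {}"
        proof -
          have "card (X - {v}) \<noteq> 0" using v X c d finX by simp
          then have "X - {v} \<noteq> {}" by (metis card.empty)
          then show ?thesis using cov by auto
        qed
        show "card (missing (X - {v}) d (del v FF)) \<le> 2 * (c - 1) - 1" using v(3) by (simp add: missing_del)
      qed (use FF X less.prems in \<open>auto simp: del_def\<close>)
      then show "mpolys.wreg V (mpolys.adj V (face_ideal V (join FF W)) (indet v)) ?fs"
        by (simp add: face_ideal_adj_indet[OF down_closed_join vW(2)] join_del[OF FF finX vW(1) v(1,2)])
      define X' where "X' = \<Union>(lnk v FF)"
      have X'X: "X' \<subseteq> X - {v}" unfolding X'_def by (rule Union_lnk_subset) (use FF in blast)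
      have L: "G \<subseteq> X' \<and> card G = d - 1" if "G \<in> lnk v FF" for G
      proof -
        have G: "v \<notin> G" "insert v G \<in> FF" using that by (auto simp: mem_lnk_iff)
        have "finite (insert v G)" using FF[OF G(2)] finite_subset[OF _ finX] by simp
        then have "Suc (card G) = d" using FF[OF G(2)] G(1) by simp
        moreover have "G \<subseteq> X'" using that by (auto simp: X'_def)
        ultimately show ?thesis by simp
      qed
      have F0L: "F0 - {v} \<in> lnk v FF" using F0 by (auto simp: lnk_def)
      have finX': "finite X'" using X'X finX finite_subset by blast
      have "d - 1 \<le> card X'" using L[OF F0L] card_mono[OF finX', of "F0 - {v}"] by simp
      \<comment> \<open>The link has its own vertex set \<open>X'\<close>, possibly smaller than
        \<open>X - {v}\<close>, and \<open>c'\<close> is its codimension there.\<close>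
      then obtain c' where c': "card X' = d - 1 + c'" using le_Suc_ex by blast
      have "card X' < card X" using card_mono[of "X - {v}" X'] X'X finX lt by simp
      moreover have "card (missing X' (d - 1) (lnk v FF)) \<le> 2 * c' - 1"
        by (rule missing_link[OF finX X(2) c FF cover less.prems(6) v(1) X'_def c'])
      ultimately have "mpolys.wreg V (face_ideal V (join (lnk v FF) (insert v W)))
          (map (mpolys.esym z V) (rev [1..<Suc (d - 1 + card (insert v W))]))"
      proof (intro less.hyps[of X' "d - 1" c'])
        show "X' \<subseteq> V" using X'X X(1) by blast
        show "G \<subseteq> X' \<and> card G = d - 1" if "G \<in> lnk v FF" for G using L[OF that] .
        show "lnk v FF \<noteq> {}" using F0L by blast
        show "insert v W \<subseteq> V" using less.prems(7) vW by blast
        show "insert v W \<inter> X' = {}" using less.prems(8) X'X by blast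
      qed (simp_all add: X'_def[symmetric] c')
      moreover have "d - 1 + card (insert v W) = d + card W" using d finW vW by simp
      ultimately show "mpolys.wreg V (mpolys.colon V (face_ideal V (join FF W)) (indet v)) ?fs"
        by (simp only: face_ideal_colon_indet[OF vW(2)] join_lnk[OF vW(1)])
    qed
  qed
qed

section \<open>Regular sequences in quotient rings\<close>

context subring_set
begin

lemma ideal_foldl_adj:
  "ideal_in R I \<Longrightarrow> set fs \<subseteq> R \<Longrightarrow> ideal_in R (foldl adj I fs)"
  by (induction fs arbitrary: I) (auto simp: ideal_adj)

lemma foldl_adj_superset:
  "ideal_in R I \<Longrightarrow> set fs \<subseteq> R \<Longrightarrow> I \<union> set fs \<subseteq> foldl adj I fs"
proof (induction fs arbitrary: I)
  case (Cons f fs)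
  then have "adj I f \<union> set fs \<subseteq> foldl adj (adj I f) fs" by (intro Cons.IH ideal_adj) auto
  then show ?case using adj_superset[of I f] mem_adj[OF Cons.prems(1), of f] by auto
qed auto

lemma foldl_adj_minimal:
  "ideal_in R J \<Longrightarrow> I \<union> set fs \<subseteq> J \<Longrightarrow> foldl adj I fs \<subseteq> J"
proof (induction fs arbitrary: I)
  case (Cons f fs)
  then have "adj I f \<subseteq> J" by (intro adj_minimal) auto
  with Cons show ?case by simp
qed auto

lemma Idl_eq_foldl_adj:
  assumes I: "ideal_in R I" and fs: "set fs \<subseteq> R"
  shows "Idl_R (I \<union> set fs) = foldl adj I fs"
proof
  have sub: "I \<union> set fs \<subseteq> R" using ideal_inD(1)[OF I] fs by auto
  show "Idl_R (I \<union> set fs) \<subseteq> foldl adj I fs"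
    using I fs by (intro Idl_minimal ideal_foldl_adj foldl_adj_superset)
  show "foldl adj I fs \<subseteq> Idl_R (I \<union> set fs)"
    using sub by (intro foldl_adj_minimal ideal_Idl Idl_superset)
qed

lemma wreg_nth:
  "wreg I fs \<Longrightarrow> j < length fs \<Longrightarrow> nzd (foldl adj I (take j fs)) (fs ! j)"
proof (induction fs arbitrary: I j)
  case (Cons f fs)
  then show ?case by (cases j) auto
qed simp

lemma cring_ideal_ring_of: "ideal_in R I \<Longrightarrow> cring_ideal (ring_of R) I"
  unfolding cring_ideal_def using cring_ring_of by (simp add: ideal_iff)

text \<open>The ideal of cosets generated by an initial segment corresponds to
  \<open>foldl adj I\<close> of that segment, so weak regularity carries over; only properness has
  to be added.\<close>

lemma regular_sequence_Quot:
  assumes I: "ideal_in R I" and fs: "set fs \<subseteq> R" and w: "wreg I fs" and one: "1 \<notin> foldl adj I fs"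
  shows "regular_sequence (ring_of R Quot I) (map (a_r_coset (ring_of R) I) fs)"
proof -
  interpret C: cring_ideal "ring_of R" I using I by (rule cring_ideal_ring_of)
  let ?h = "a_r_coset (ring_of R) I"
  have mem: "?h a \<in> genideal (ring_of R Quot I) (?h ` set gs) \<longleftrightarrow> a \<in> foldl adj I gs"
    if "set gs \<subseteq> R" "a \<in> R" for gs a
    using C.coset_in_Idl_iff[of "set gs" a] that by (simp add: Idl_eq_foldl_adj[OF I])
  show ?thesis
    unfolding regular_sequence_def
  proof (intro conjI allI ballI impI)
    show "set (map ?h fs) \<subseteq> carrier (ring_of R Quot I)"
      using fs by (auto simp: C.carrier_Quot)
    show "genideal (ring_of R Quot I) (set (map ?h fs)) \<noteq> carrier (ring_of R Quot I)"
    proof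
      assume "genideal (ring_of R Quot I) (set (map ?h fs)) = carrier (ring_of R Quot I)"
      then have "?h 1 \<in> genideal (ring_of R Quot I) (?h ` set fs)"
        using one_mem by (auto simp: C.carrier_Quot)
      then show False using one mem[OF fs one_mem] by simp
    qed
  next
    fix j x assume j: "j < length (map ?h fs)" and x: "x \<in> carrier (ring_of R Quot I)"
      and *: "map ?h fs ! j \<otimes>\<^bsub>ring_of R Quot I\<^esub> x \<in> genideal (ring_of R Quot I) (set (take j (map ?h fs)))"
    obtain a where a: "a \<in> R" "x = ?h a" using x by (auto simp: C.carrier_Quot)
    have fj: "fs ! j \<in> R" using fs j by auto
    have st: "set (take j fs) \<subseteq> R" using fs set_take_subset by fast
    have "?h (fs ! j * a) \<in> genideal (ring_of R Quot I) (?h ` set (take j fs))"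
      using * j a fj C.coset_mult[of "fs ! j" a] by (simp add: take_map)
    then have "fs ! j * a \<in> foldl adj I (take j fs)" using mem[OF st] a fj by (simp add: mult_mem)
    then have "a \<in> foldl adj I (take j fs)" using wreg_nth[OF w, of j] j a nzdD by simp
    then show "x \<in> genideal (ring_of R Quot I) (set (take j (map ?h fs)))"
      using mem[OF st a(1)] a by (simp add: take_map)
  qed
qed

end

section \<open>The Nullstellensatz for maximal ideals of polynomial rings\<close>

lemma prime_in_contraction:
  assumes R: "subring_set R" and P: "prime_in S P" and sub: "R \<subseteq> S"
  shows "prime_in R (P \<inter> R)"
proof -
  interpret subring_set R by fact
  show ?thesis
    using P sub unfolding prime_in_def ideal_in_def
    by (auto simp: zero_mem add_mem mult_mem subset_iff)
qed

text \<open>The variables in \<open>W\<close> are removed in turn. The intermediate contractions are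
  not known to be maximal, but each inherits the Goldman property.\<close>

lemma goldman_mpolys_single:
  fixes M :: "'k::field mpoly set"
  assumes "finite W" "i \<notin> W" "prime_in (mpolys (insert i W)) M" "mpolys.goldman (insert i W) M"
  shows "mpolys.goldman {i} (M \<inter> mpolys {i})"
  using assms
proof (induction W arbitrary: M rule: finite_induct)
  case empty
  then have "M \<inter> mpolys {i} = M" using ideal_inD(1) by (auto simp: prime_in_def)
  then show ?case using empty by simp
next
  case (insert j W)
  have eq: "ring_ext (mpolys (insert i W)) (indet j) = (mpolys (insert i (insert j W)) :: 'k mpoly set)"
    by (simp add: ring_ext_mpolys insert_commute)
  interpret X: simple_extension_prime "mpolys (insert i W) :: 'k mpoly set" "indet j" M
    by unfold_locales (simp add: eq insert.prems)
  have Q: "X.Q = M \<inter> mpolys (insert i W)" by (rule X.Q_def)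
  have "mpolys.goldman (insert i W) X.Q"
    using insert.prems by (intro X.goldman_contraction) (simp add: eq)
  then have "mpolys.goldman {i} (X.Q \<inter> mpolys {i})"
    using insert X.prime_Q by (intro insert.IH) auto
  moreover have "X.Q \<inter> mpolys {i} = M \<inter> mpolys {i}"
    using mpolys_mono[of "{i}" "insert i W"] unfolding Q by auto
  ultimately show ?case by simp
qed

text \<open>Contracted to the ring in the single variable \<open>i\<close>, the ideal is still a
  Goldman prime, so that variable is algebraic modulo it over \<open>mpolys {}\<close>, a copy of
  the field.\<close>

lemma exists_var_poly_mem:
  fixes M :: "'k::field mpoly set"
  assumes V: "finite V" "i \<in> V" and M: "prime_in (mpolys V) M" and gold: "mpolys.goldman V M"
  shows "\<exists>q. q \<noteq> 0 \<and> coeff q 0 = 0 \<and> var_poly i q \<in> M"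
proof -
  have iV: "mpolys {i} \<subseteq> (mpolys V :: 'k mpoly set)" using V by (intro mpolys_mono) auto
  have idM: "ideal_in (mpolys V) M" using M by (simp add: prime_in_def)
  have g: "mpolys.goldman {i} (M \<inter> mpolys {i})"
    using V M gold by (intro goldman_mpolys_single[of "V - {i}"]) (simp_all add: insert_absorb)
  have eq: "ring_ext (mpolys {}) (indet i) = (mpolys {i} :: 'k mpoly set)"
    by (simp add: ring_ext_mpolys)
  interpret X: simple_extension_prime "mpolys {} :: 'k mpoly set" "indet i" "M \<inter> mpolys {i}"
    by unfold_locales (simp add: eq prime_in_contraction[OF subring_mpolys M iV])
  have "\<exists>f. f \<in> polys (mpolys {}) \<and> f \<notin> polys X.Q \<and> poly f (indet i) \<in> M \<inter> mpolys {i}"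
    using g by (intro X.algebraic) (simp add: eq)
  then obtain f where f: "f \<in> polys (mpolys {})" "f \<notin> polys X.Q" "poly f (indet i) \<in> M" by blast
  define q where "q = map_poly (\<lambda>p. lookup p 0) f"
  have "single 0 (coeff q j) = coeff f j" for j
    using polysD[OF f(1), of j] by (auto simp: q_def coeff_map_poly mpolys_empty)
  then have qf: "map_poly (single 0) q = f"
    by (intro poly_eqI) (simp add: coeff_map_poly)
  have "f \<noteq> 0" using f(2) X.zero_Q by (auto simp: polys_def)
  then have "q \<noteq> 0" using qf by auto
  \<comment> \<open>A further factor \<open>indet i\<close> makes the constant term zero.\<close>
  have "map_poly (single 0) (pCons 0 q) = pCons 0 f"
    using qf \<open>q \<noteq> 0\<close> by (simp add: map_poly_pCons)
  then have "var_poly i (pCons 0 q) = indet i * poly f (indet i)" by (simp add: var_poly_def)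
  also have "\<dots> \<in> M" using f V by (intro ideal_inD(5)[OF idM] indet_mem_mpolys)
  finally show ?thesis using \<open>q \<noteq> 0\<close> by (intro exI[of _ "pCons 0 q"]) simp
qed

section \<open>Prime ideals of faces\<close>

text \<open>The residue ring is the polynomial ring in the variables of \<open>F\<close>, a domain.
  Concretely, \<open>part p\<close> represents \<open>p\<close> modulo the ideal and involves only
  these variables, and only 0 among such polynomials lies in the ideal.\<close>

lemma prime_face_ideal:
  assumes FV: "F \<subseteq> V"
  shows "prime_in (mpolys V) (face_ideal V (Pow F) :: 'k::field mpoly set)"
proof -
  have D: "down_closed (Pow F)" by (auto simp: down_closed_def)
  note I = ideal_face_ideal[OF D, of V, where ?'k = 'k]
  define part :: "'k mpoly \<Rightarrow> 'k mpoly" where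
    "part p = (\<Sum>t | t \<in> keys p \<and> keys t \<subseteq> F. single t (lookup p t))" for p
  have part_mem: "part p \<in> mpolys F" for p
    unfolding part_def by (intro mpolys.sum_mem single_mem_mpolys) auto
  have diff: "p - part p \<in> face_ideal V (Pow F)" if p: "p \<in> mpolys V" for p
  proof -
    have "p = (\<Sum>t\<in>keys p. single t (lookup p t))" by (rule sum_monomials)
    also have "\<dots> = part p + (\<Sum>t | t \<in> keys p \<and> \<not> keys t \<subseteq> F. single t (lookup p t))"
      unfolding part_def by (subst sum.union_disjoint[symmetric]) (auto intro!: sum.cong)
    finally have "p - part p = (\<Sum>t | t \<in> keys p \<and> \<not> keys t \<subseteq> F. single t (lookup p t))"
      by (simp add: algebra_simps)
    also have "\<dots> \<in> face_ideal V (Pow F)"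
      using mpolysD[OF p] by (intro mpolys.ideal_in_sum[OF I] monomial_mem_face_ideal) auto
    finally show ?thesis .
  qed
  show ?thesis
    unfolding prime_in_def
  proof (intro conjI ballI impI)
    show "1 \<notin> (face_ideal V (Pow F) :: 'k mpoly set)" by (simp add: face_ideal_def)
    fix p q :: "'k mpoly" assume pq: "p \<in> mpolys V" "q \<in> mpolys V" "p * q \<in> face_ideal V (Pow F)"
    have pV: "part p \<in> mpolys V" "part q \<in> mpolys V" using part_mem mpolys_mono[OF FV] by blast+
    have "part p * part q = p * q - (p - part p) * q - (q - part q) * part p" by (simp add: algebra_simps)
    also have "\<dots> \<in> face_ideal V (Pow F)"
    proof (rule mpolys.ideal_in_diff[OF I mpolys.ideal_in_diff[OF I]])
      show "(p - part p) * q \<in> face_ideal V (Pow F)" using diff[OF pq(1)] pq(2) by (rule ideal_inD(4)[OF I])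
      show "(q - part q) * part p \<in> face_ideal V (Pow F)" using diff[OF pq(2)] pV(1) by (rule ideal_inD(4)[OF I])
    qed (rule pq(3))
    finally have "part p * part q \<in> face_ideal V (Pow F)" .
    moreover have "part p * part q \<in> mpolys F" by (intro mpolys.mult_mem part_mem)
    ultimately have "keys (part p * part q) = {}"
      using mpolysD[of "part p * part q" F] by (fastforce simp: face_ideal_def)
    then have "part p * part q = 0" by simp
    then have "part p = 0 \<or> part q = 0" by simp
    then show "p \<in> face_ideal V (Pow F) \<or> q \<in> face_ideal V (Pow F)"
      using diff pq by (metis diff_zero)
  qed (rule I)
qed

section \<open>Stanley--Reisner rings: dimension and depth\<close>

lemma stanley_reisner_ring_eq:
  "down_closed \<Delta> \<Longrightarrow> stanley_reisner_ring n \<Delta>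
     = ring_of (mpolys {1..n}) Quot (face_ideal {1..n} \<Delta> :: 'k::field mpoly set)"
  by (simp add: stanley_reisner_ring_def mpoly_ring_eq stanley_reisner_ideal_eq)

text \<open>The prime ideals belong to shrinking faces: at each step one vertex of \<open>F\<close>
  is dropped, and its variable enters the ideal and makes the inclusion strict. It takes
  \<open>card F\<close> steps to reach the empty face.\<close>

lemma card_face_le_krull_dim:
  assumes D: "down_closed \<Delta>" and F: "F \<in> \<Delta>" "F \<subseteq> V" and V: "finite V"
  shows "enat (card F) \<le> krull_dim (ring_of (mpolys V) Quot (face_ideal V \<Delta> :: 'k::field mpoly set))"
proof -
  let ?S = "ring_of (mpolys V :: 'k mpoly set)"
  let ?I = "face_ideal V \<Delta> :: 'k mpoly set"
  interpret C: cring_ideal ?S ?I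
    by (rule mpolys.cring_ideal_ring_of[OF ideal_face_ideal[OF D]])
  have finF: "finite F" using F V finite_subset by blast
  obtain xs where xs: "set xs = F" "distinct xs" using finite_distinct_list[OF finF] by blast
  have len: "length xs = card F" using xs distinct_card by fastforce
  define P where "P j = (face_ideal V (Pow (set (drop j xs))) :: 'k mpoly set)" for j
  have sub: "set (drop j xs) \<subseteq> F" for j using xs set_drop_subset by fast
  have prime: "prime_in (mpolys V) (P j)" for j
    unfolding P_def using sub F by (intro prime_face_ideal) blast
  have IP: "?I \<subseteq> P j" for j
    using D F sub[of j] unfolding P_def face_ideal_def down_closed_def by blast
  have "prime_chain (?S Quot ?I) (card F) (\<lambda>j. a_r_coset ?S ?I ` P j)"
    unfolding prime_chain_def
  proof (intro conjI allI impI)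
    show "primeideal (a_r_coset ?S ?I ` P j) (?S Quot ?I)" for j
      using prime IP by (intro C.primeideal_coset_image) (simp_all add: mpolys.primeideal_iff)
    fix j assume j: "j < card F"
    have "set (drop (Suc j) xs) \<subseteq> set (drop j xs)" by (rule set_drop_subset_set_drop) simp
    then have PP: "P j \<subseteq> P (Suc j)" by (auto simp: P_def face_ideal_def)
    have drop: "drop j xs = xs ! j # drop (Suc j) xs" using j len by (simp add: Cons_nth_drop_Suc)
    have x: "xs ! j \<in> F" "xs ! j \<notin> set (drop (Suc j) xs)"
      using xs j len drop distinct_drop[OF xs(2), of j] by auto
    define y where "y = (indet (xs ! j) :: 'k mpoly)"
    have y: "y \<in> mpolys V" using x F by (auto simp: y_def intro!: indet_mem_mpolys)
    have "y \<in> P (Suc j)"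
      unfolding P_def y_def indet_def using x F by (intro monomial_mem_face_ideal) auto
    moreover have "y \<notin> P j" unfolding P_def y_def indet_def face_ideal_def using drop by simp
    moreover have "ideal (P j) ?S" using prime[of j] by (simp add: mpolys.ideal_iff prime_in_def)
    ultimately have "a_r_coset ?S ?I y \<in> a_r_coset ?S ?I ` P (Suc j)" "a_r_coset ?S ?I y \<notin> a_r_coset ?S ?I ` P j"
      using C.coset_in_image_iff[of "P j" y] IP y by auto
    then show "a_r_coset ?S ?I ` P j \<subset> a_r_coset ?S ?I ` P (Suc j)" using PP by blast
  qed
  then show ?thesis
    unfolding krull_dim_def by (intro Sup_upper) blast
qed

text \<open>Positive degree excludes the empty product, which is 1.\<close>

lemma (in subring_set) esym_mem_ideal:
  assumes J: "ideal_in R J" and z: "\<And>i. i \<in> U \<Longrightarrow> z i \<in> J" and j: "j > 0"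
  shows "esym z U j \<in> J"
  unfolding esym_def
proof (rule ideal_in_sum[OF J])
  fix T assume T: "T \<in> {T. T \<subseteq> U \<and> card T = j}"
  then obtain i where i: "i \<in> T" using j by fastforce
  have fin: "finite T" using T j card_gt_0_iff by blast
  have "prod z T = z i * prod z (T - {i})" using fin i by (simp add: prod.remove)
  also have "\<dots> \<in> J"
    using T i z ideal_inD(1)[OF J] by (intro ideal_inD(4)[OF J] prod_mem) auto
  finally show "prod z T \<in> J" .
qed

text \<open>The \<open>q i\<close> depend on the maximal ideal, so weak regularity is assumed for
  all choices. The resulting sequence lies in the preimage \<open>N\<close> of \<open>M\<close>, and
  hence generates a proper ideal.\<close>

lemma le_depth_face_ring:
  fixes M :: "'k::field mpoly set set"
  assumes D: "down_closed \<Delta>" and V: "finite V"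
    and M': "maximalideal M (ring_of (mpolys V) Quot face_ideal V \<Delta>)"
    and wreg: "\<And>q :: nat \<Rightarrow> 'k poly. (\<And>i. i \<in> V \<Longrightarrow> q i \<noteq> 0 \<and> coeff (q i) 0 = 0) \<Longrightarrow>
       mpolys.wreg V (face_ideal V \<Delta>)
         (map (mpolys.esym (\<lambda>i. var_poly i (q i)) V) (rev [1..<Suc d]))"
  shows "enat d \<le> depth (ring_of (mpolys V) Quot face_ideal V \<Delta>) M"
proof -
  let ?S = "ring_of (mpolys V :: 'k mpoly set)"
  let ?I = "face_ideal V \<Delta> :: 'k mpoly set"
  let ?h = "a_r_coset ?S ?I"
  note I = ideal_face_ideal[OF D, of V, where ?'k = 'k]
  interpret C: cring_ideal ?S ?I by (rule mpolys.cring_ideal_ring_of[OF I])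
  have idM: "ideal M (?S Quot ?I)" by (rule maximalideal.axioms(1)[OF M'])
  have primeM: "primeideal M (?S Quot ?I)"
    by (rule cring.maximalideal_prime[OF C.cring_Quot M'])
  define N where "N = {a \<in> mpolys V. ?h a \<in> M}"
  have primeN: "prime_in (mpolys V) N"
    using C.primeideal_coset_vimage[OF primeM] by (simp add: N_def mpolys.primeideal_iff)
  have idN: "ideal_in (mpolys V) N" using primeN by (simp add: prime_in_def)
  have IN: "?I \<subseteq> N" using C.subset_coset_vimage[OF idM] by (simp add: N_def)
  \<comment> \<open>The witness is 1: the image of an ideal strictly above \<open>N\<close> is
    strictly above \<open>M\<close>, hence the whole quotient ring.\<close>
  have goldN: "mpolys.goldman V N"
    unfolding mpolys.goldman_def
  proof (intro bexI conjI allI impI)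
    show "1 \<in> (mpolys V :: 'k mpoly set)" by (rule mpolys.one_mem)
    show "1 \<notin> N" using primeN by (simp add: prime_in_def)
    fix P assume P: "prime_in (mpolys V) P" "N \<subset> P"
    have idP: "ideal P ?S" using P by (simp add: prime_in_def mpolys.ideal_iff)
    have idP': "ideal (?h ` P) (?S Quot ?I)" by (rule C.ring_ideal_imp_quot_ideal[OF C.I idP])
    have IP: "?I \<subseteq> P" using IN P by blast
    have PS: "P \<subseteq> mpolys V" using ideal.Icarr[OF idP] by auto
    have "M \<subseteq> ?h ` P"
    proof
      fix x assume x: "x \<in> M"
      then obtain a where "a \<in> mpolys V" "x = ?h a"
        using ideal.Icarr[OF idM x] by (auto simp: C.carrier_Quot)
      then show "x \<in> ?h ` P" using x P by (auto simp: N_def)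
    qed
    then have "?h ` P = M \<or> ?h ` P = carrier (?S Quot ?I)"
      using maximalideal.I_maximal[OF M' idP'] PS by (auto simp: C.carrier_Quot)
    moreover obtain b where "b \<in> P" "b \<notin> N" using P by blast
    then have "?h ` P \<noteq> M" using PS by (auto simp: N_def)
    moreover have one: "1 \<in> (mpolys V :: 'k mpoly set)" by (rule mpolys.one_mem)
    ultimately have "?h 1 \<in> ?h ` P" by (auto simp: C.carrier_Quot)
    then show "1 \<in> P" using C.coset_in_image_iff[OF idP IP, of 1] one by simp
  qed
  have "\<exists>q. q \<noteq> 0 \<and> coeff q 0 = 0 \<and> var_poly i q \<in> N" if "i \<in> V" for i
    using exists_var_poly_mem[OF V that primeN goldN] .
  then obtain q where q: "\<And>i. i \<in> V \<Longrightarrow> q i \<noteq> 0 \<and> coeff (q i) 0 = 0 \<and> var_poly i (q i) \<in> N"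
    by metis
  define fs where "fs = map (mpolys.esym (\<lambda>i. var_poly i (q i)) V) (rev [1..<Suc d])"
  have fsN: "set fs \<subseteq> N"
    unfolding fs_def using q by (auto intro!: mpolys.esym_mem_ideal[OF idN])
  then have fsS: "set fs \<subseteq> mpolys V" using ideal_inD(1)[OF idN] by blast
  have "foldl (mpolys.adj V) ?I fs \<subseteq> N" using IN fsN by (intro mpolys.foldl_adj_minimal idN) auto
  then have "1 \<notin> foldl (mpolys.adj V) ?I fs" using primeN by (auto simp: prime_in_def)
  then have "regular_sequence (?S Quot ?I) (map ?h fs)"
    using wreg[of q] q by (intro mpolys.regular_sequence_Quot[OF I fsS]) (auto simp: fs_def)
  moreover have "set (map ?h fs) \<subseteq> M" using fsN by (auto simp: N_def)
  moreover have "length (map ?h fs) = d" by (simp add: fs_def)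
  ultimately show ?thesis
    unfolding depth_def by (intro Sup_upper) blast
qed

theorem cohen_macaulay_stanley_reisner_ring:
  assumes D: "down_closed \<Delta>"
    and dim: "krull_dim (stanley_reisner_ring n \<Delta> :: 'k::field mpoly set ring) = enat d"
    and wreg: "\<And>q :: nat \<Rightarrow> 'k poly. (\<And>i. i \<in> {1..n} \<Longrightarrow> q i \<noteq> 0 \<and> coeff (q i) 0 = 0) \<Longrightarrow>
       mpolys.wreg {1..n} (face_ideal {1..n} \<Delta>)
         (map (mpolys.esym (\<lambda>i. var_poly i (q i)) {1..n}) (rev [1..<Suc d]))"
  shows "cohen_macaulay_ring (stanley_reisner_ring n \<Delta> :: 'k mpoly set ring)"
proof -
  let ?S = "ring_of (mpolys {1..n} :: 'k mpoly set)"
  let ?I = "face_ideal {1..n} \<Delta> :: 'k mpoly set"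
  have A: "stanley_reisner_ring n \<Delta> = ?S Quot ?I" by (rule stanley_reisner_ring_eq[OF D])
  interpret C: cring_ideal ?S ?I
    by (rule mpolys.cring_ideal_ring_of[OF ideal_face_ideal[OF D]])
  show ?thesis
    unfolding cohen_macaulay_ring_def
  proof (intro conjI allI impI)
    show "cring (stanley_reisner_ring n \<Delta> :: 'k mpoly set ring)" by (rule cring_stanley_reisner_ring)
    show "noetherian_ring (stanley_reisner_ring n \<Delta> :: 'k mpoly set ring)"
      unfolding A by (intro C.noetherian_Quot noetherian_mpolys) simp
    fix M :: "'k mpoly set set" assume M: "maximalideal M (stanley_reisner_ring n \<Delta>)"
    have "primeideal M (stanley_reisner_ring n \<Delta>)"
      by (rule cring.maximalideal_prime[OF cring_stanley_reisner_ring M])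
    then have "depth (stanley_reisner_ring n \<Delta>) M \<le> height (stanley_reisner_ring n \<Delta>) M"
      by (rule cring.depth_le_height[OF cring_stanley_reisner_ring])
    moreover have "height (stanley_reisner_ring n \<Delta>) M \<le> enat d"
      unfolding dim[symmetric] by (rule height_le_krull_dim)
    moreover have "enat d \<le> depth (stanley_reisner_ring n \<Delta>) M"
      unfolding A using D _ M[unfolded A] wreg by (rule le_depth_face_ring) simp
    ultimately show "depth (stanley_reisner_ring n \<Delta>) M = height (stanley_reisner_ring n \<Delta>) M" by simp
  qed
qed

section \<open>The Hilbert function of a Stanley--Reisner ring\<close>

definition exp_deg :: "(nat \<Rightarrow>\<^sub>0 nat) \<Rightarrow> nat" where
  "exp_deg t = (\<Sum>i\<in>keys t. lookup t i)"

definition exps :: "nat set \<Rightarrow> nat \<Rightarrow> (nat \<Rightarrow>\<^sub>0 nat) set" where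
  "exps F m = {t. keys t = F \<and> exp_deg t = m}"

lemma exp_deg_superset:
  "finite F \<Longrightarrow> keys t \<subseteq> F \<Longrightarrow> exp_deg t = (\<Sum>i\<in>F. lookup t i)"
  unfolding exp_deg_def by (intro sum.mono_neutral_left) (auto simp: in_keys_iff)

lemma exp_deg_add_single:
  assumes "i \<notin> keys u"
  shows "exp_deg (u + single i j) = exp_deg u + j"
proof -
  let ?F = "insert i (keys u)"
  have "exp_deg (u + single i j) = (\<Sum>k\<in>?F. lookup (u + single i j) k)"
    by (intro exp_deg_superset) (auto simp: keys_add_nat split: if_splits)
  also have "\<dots> = (\<Sum>k\<in>?F. lookup u k) + j"
    using assms by (simp add: lookup_add sum.distrib lookup_single when_def)
  also have "(\<Sum>k\<in>?F. lookup u k) = exp_deg u"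
    by (intro exp_deg_superset[symmetric]) auto
  finally show ?thesis .
qed

lemma exps_insert:
  assumes "i \<notin> F"
  shows "exps (insert i F) m = (\<Union>j\<in>{1..m}. (\<lambda>u. u + single i j) ` exps F (m - j))"
proof
  show "exps (insert i F) m \<subseteq> (\<Union>j\<in>{1..m}. (\<lambda>u. u + single i j) ` exps F (m - j))"
  proof
    fix t assume t: "t \<in> exps (insert i F) m"
    define j where "j = lookup t i"
    obtain u where u: "t = u + single i j" "i \<notin> keys u"
      "keys u = keys t - {i}"
      unfolding j_def by (rule exponent_decomp)
    have "m = exp_deg u + j" using t u exp_deg_add_single[OF u(2), of j] by (simp add: exps_def)
    moreover have "j \<ge> 1" using t by (auto simp: exps_def j_def in_keys_iff Suc_le_eq)
    moreover have "keys u = F" using u t assms by (auto simp: exps_def)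
    ultimately have "u \<in> exps F (m - j)" "j \<in> {1..m}" by (auto simp: exps_def)
    then show "t \<in> (\<Union>j\<in>{1..m}. (\<lambda>u. u + single i j) ` exps F (m - j))"
      using u(1) by blast
  qed
  show "(\<Union>j\<in>{1..m}. (\<lambda>u. u + single i j) ` exps F (m - j)) \<subseteq> exps (insert i F) m"
    using assms by (auto simp: exps_def keys_add_nat exp_deg_add_single)
qed

lemma exps_empty: "exps {} m = (if m = 0 then {0} else {})"
  by (auto simp: exps_def exp_deg_def)

text \<open>These are the compositions of \<open>m\<close> into \<open>card F\<close> positive
  parts. Splitting off the exponent of one variable leaves a sum over the remaining degree,
  evaluated by summing a column of Pascal's triangle. The cases with 0 are separate because
  subtraction truncates.\<close>

lemma card_exps:
  assumes "finite F"
  shows "finite (exps F m) \<and> card (exps F m) =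
    (if F = {} then (if m = 0 then 1 else 0) else if m = 0 then 0 else (m - 1) choose (card F - 1))"
  using assms
proof (induction F arbitrary: m rule: finite_induct)
  case empty
  show ?case by (simp add: exps_empty)
next
  case (insert i F)
  let ?g = "\<lambda>j u. u + single i j :: nat \<Rightarrow>\<^sub>0 nat"
  have fin: "finite (exps F k)" for k using insert.IH by blast
  have lk: "lookup u i = 0" if "u \<in> exps F k" for u k
    using that insert.hyps by (auto simp: exps_def in_keys_iff)
  have "card (exps (insert i F) m) = (\<Sum>j\<in>{1..m}. card (?g j ` exps F (m - j)))"
    unfolding exps_insert[OF insert.hyps(2)]
  proof (intro card_UN_disjoint ballI impI)
    fix j j' :: nat assume "j \<noteq> j'"
    show "?g j ` exps F (m - j) \<inter> ?g j' ` exps F (m - j') = {}"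
    proof (rule ccontr)
      assume "\<not> ?thesis"
      then obtain u u' where *: "?g j u = ?g j' u'" "u \<in> exps F (m - j)" "u' \<in> exps F (m - j')" by auto
      then have "lookup (?g j u) i = lookup (?g j' u') i" by simp
      then show False using lk[OF *(2)] lk[OF *(3)] \<open>j \<noteq> j'\<close> by (simp add: lookup_add)
    qed
  qed (use fin in auto)
  also have "\<dots> = (\<Sum>j\<in>{1..m}. card (exps F (m - j)))"
    by (intro sum.cong card_image inj_onI) auto
  also have "\<dots> = (\<Sum>k<m. card (exps F k))"
    by (rule sum.reindex_bij_witness[of _ "\<lambda>k. m - k" "\<lambda>j. m - j"]) auto
  finally have eq: "card (exps (insert i F) m) = (\<Sum>k<m. card (exps F k))" .
  have "(\<Sum>k<m. card (exps F k)) = (if m = 0 then 0 else (m - 1) choose card F)"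
  proof (cases m)
    case (Suc l)
    show ?thesis
    proof (cases "F = {}")
      case True
      have "(\<Sum>k<m. card (exps F k)) = (\<Sum>k<m. if k = 0 then 1 else 0)"
        using insert.IH True by (intro sum.cong) auto
      then show ?thesis using Suc True by simp
    next
      case False
      then obtain r where r: "card F = Suc r" using insert.hyps by (metis card_0_eq not0_implies_Suc)
      have "(\<Sum>k<m. card (exps F k)) = card (exps F 0) + (\<Sum>k<l. card (exps F (Suc k)))"
        unfolding Suc by (rule sum.lessThan_Suc_shift)
      also have "\<dots> = (\<Sum>k<l. k choose r)"
        using insert.IH False r by simp
      also have "\<dots> = l choose Suc r"
      proof (cases l)
        case (Suc p)
        then show ?thesis using sum_choose_upper[of r p] by (simp add: lessThan_Suc_atMost)
      qed simp
      finally show ?thesis using Suc r by simp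
    qed
  qed simp
  then show ?case
    using eq fin insert.hyps exps_insert[OF insert.hyps(2), of m] by simp
qed

text \<open>The binomial coefficient of \<open>X - 1\<close> over \<open>k\<close> as a polynomial
  in \<open>X\<close>; for \<open>k = card F - 1\<close> its values at \<open>m >= 1\<close> count
  the exponent vectors of degree \<open>m\<close> with support \<open>F\<close>.\<close>

definition choose_poly :: "nat \<Rightarrow> real poly" where
  "choose_poly k = smult (1 / fact k) (\<Prod>i<k. [:- 1 - real i, 1:])"

lemma poly_choose_poly:
  assumes "m \<ge> 1"
  shows "poly (choose_poly k) (real m) = real ((m - 1) choose k)"
proof -
  have "real ((m - 1) choose k) = real (m - 1) gchoose k" by (rule binomial_gbinomial)
  also have "\<dots> = (\<Prod>i = 0..<k. real (m - 1) - real i) / fact k" by (rule gbinomial_prod_rev)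
  also have "\<dots> = poly (choose_poly k) (real m)"
    using assms by (simp add: choose_poly_def poly_prod atLeast0LessThan of_nat_diff algebra_simps)
  finally show ?thesis ..
qed

lemma degree_choose_poly: "degree (choose_poly k) = k"
  by (simp add: choose_poly_def degree_prod_eq_sum_degree)

lemma lead_coeff_choose_poly: "coeff (choose_poly k) k = 1 / fact k"
proof -
  have "degree (\<Prod>i<k. [:- 1 - real i, 1:]) = k" by (simp add: degree_prod_eq_sum_degree)
  moreover have "lead_coeff (\<Prod>i<k. [:- 1 - real i, 1:]) = 1"
    by (simp add: lead_coeff_prod)
  ultimately show ?thesis by (simp add: choose_poly_def)
qed

text \<open>The difference would have infinitely many roots. This justifies the definite description
  in \<open>hilbert_polynomial\<close>.\<close>

lemma eventually_poly_unique:
  fixes p q :: "real poly"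
  assumes "\<forall>\<^sub>F m in sequentially. poly p (real m) = f m" "\<forall>\<^sub>F m in sequentially. poly q (real m) = f m"
  shows "p = q"
proof (rule ccontr)
  assume "p \<noteq> q"
  then have "finite {x. poly (p - q) x = 0}" by (intro poly_roots_finite) simp
  moreover have "\<forall>\<^sub>F m in sequentially. poly (p - q) (real m) = 0"
    using eventually_conj[OF assms] by eventually_elim simp
  then obtain N where N: "\<And>m. m \<ge> N \<Longrightarrow> poly (p - q) (real m) = 0"
    by (auto simp: eventually_sequentially)
  have "real ` {N..} \<subseteq> {x. poly (p - q) x = 0}" using N by auto
  ultimately have "finite (real ` {N..})" by (rule finite_subset[rotated])
  then have "finite {N..}" by (rule finite_imageD) simp
  then show False using infinite_Ici by blast
qed

section \<open>Dimensions of the graded components\<close>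

context
  fixes V :: "nat set" and \<Delta> :: "nat set set" and S :: "'k::field mpoly ring" and I :: "'k mpoly set"
  assumes D: "down_closed \<Delta>" and ne: "{} \<in> \<Delta>" and sub: "\<Delta> \<subseteq> Pow V"
  defines "S \<equiv> ring_of (mpolys V)" and "I \<equiv> face_ideal V \<Delta>"
begin

lemma id_I: "ideal_in (mpolys V) I"
  unfolding I_def by (rule ideal_face_ideal[OF D])

lemma cring_ideal_SI: "cring_ideal S I"
  unfolding S_def using mpolys.cring_ring_of id_I by (simp add: cring_ideal_def mpolys.ideal_iff)

lemmas ring_SI = cring_ideal.ring_Quot[OF cring_ideal_SI]

definition "cst p = I +>\<^bsub>S\<^esub> p"

lemma cst_mem: "p \<in> mpolys V \<Longrightarrow> cst p \<in> carrier (S Quot I)"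
  using cring_ideal.carrier_Quot[OF cring_ideal_SI] by (auto simp: cst_def S_def)

lemma cst_hom: "ring_hom_ring S (S Quot I) cst"
proof -
  have "cst = (+>\<^bsub>S\<^esub>) I" by (rule ext) (simp add: cst_def)
  then show ?thesis using ideal.rcos_ring_hom_ring[OF cring_ideal.I[OF cring_ideal_SI]] by simp
qed

lemma cst_add: "p \<in> mpolys V \<Longrightarrow> q \<in> mpolys V \<Longrightarrow> cst (p + q) = cst p \<oplus>\<^bsub>S Quot I\<^esub> cst q"
  using ring_hom_add[OF ring_hom_ring.homh[OF cst_hom], of p q] by (simp add: S_def)

lemma cst_mult: "p \<in> mpolys V \<Longrightarrow> q \<in> mpolys V \<Longrightarrow> cst (p * q) = cst p \<otimes>\<^bsub>S Quot I\<^esub> cst q"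
  using ring_hom_mult[OF ring_hom_ring.homh[OF cst_hom], of p q] by (simp add: S_def)

lemma cst_one: "cst 1 = \<one>\<^bsub>S Quot I\<^esub>"
  using ring_hom_one[OF ring_hom_ring.homh[OF cst_hom]] by (simp add: S_def)

lemma cst_zero: "cst 0 = \<zero>\<^bsub>S Quot I\<^esub>"
  using ring_hom_zero[OF ring_hom_ring.homh[OF cst_hom] cring.axioms(1)[OF cring_ideal.R[OF cring_ideal_SI]] ring_SI]
  by (simp add: S_def)

lemma cst_eq_iff:
  assumes "p \<in> mpolys V" "q \<in> mpolys V"
  shows "cst p = cst q \<longleftrightarrow> p - q \<in> I"
proof -
  have SR: "ring S" using cring_ideal.R[OF cring_ideal_SI] by (rule cring.axioms(1))
  have m: "p \<ominus>\<^bsub>S\<^esub> q = p - q"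
  proof -
    interpret ring S by fact
    have "\<ominus>\<^bsub>S\<^esub> q = - q"
      using assms by (intro minus_equality) (auto simp: S_def mpolys.uminus_mem)
    then show ?thesis by (simp add: a_minus_def S_def)
  qed
  have "(p \<ominus>\<^bsub>S\<^esub> q \<in> I) = (I +>\<^bsub>S\<^esub> p = I +>\<^bsub>S\<^esub> q)"
    using assms by (intro ring.quotient_eq_iff_same_a_r_cos[OF SR cring_ideal.I[OF cring_ideal_SI]]) (simp_all add: S_def)
  then show ?thesis unfolding cst_def m by simp
qed

definition "scal = range (\<lambda>a. cst (single 0 a))"

text \<open>The empty face keeps 1 out of \<open>I\<close>, so the residue ring is nonzero and the
  field embeds into it.\<close>

lemma subfield_scal: "subfield scal (S Quot I)"
proof -
  let ?K = "ring_of (UNIV :: 'k set)"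
  interpret U: subring_set "UNIV :: 'k set" by unfold_locales auto
  have cK: "cring ?K" by (rule U.cring_ring_of)
  have "Units ?K = carrier ?K - {\<zero>\<^bsub>?K\<^esub>}"
  proof -
    have "\<exists>b. b * a = 1 \<and> a * b = 1" if "a \<noteq> 0" for a :: 'k
      using that by (intro exI[of _ "inverse a"]) simp
    then show ?thesis by (auto simp: Units_def)
  qed
  then have fK: "field ?K" by (intro cring.cring_fieldI[OF cK])
  have h: "ring_hom_ring ?K (S Quot I) (\<lambda>a. cst (single 0 a))"
  proof (rule ring_hom_ringI)
    show "ring ?K" using cK by (rule cring.axioms(1))
    show "ring (S Quot I)" by (rule ring_SI)
    show "cst (single 0 a) \<in> carrier (S Quot I)" if "a \<in> carrier ?K" for a
      by (intro cst_mem single_mem_mpolys) simp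
    show "cst (single 0 (x \<otimes>\<^bsub>?K\<^esub> y))
        = cst (single 0 x) \<otimes>\<^bsub>S Quot I\<^esub> cst (single 0 y)" for x y
      using cst_mult[of "single 0 x" "single 0 y"]
      by (simp add: single_mem_mpolys mult_single)
    show "cst (single 0 (x \<oplus>\<^bsub>?K\<^esub> y))
        = cst (single 0 x) \<oplus>\<^bsub>S Quot I\<^esub> cst (single 0 y)" for x y
      using cst_add[of "single 0 x" "single 0 y"]
      by (simp add: single_mem_mpolys single_add)
    show "cst (single 0 \<one>\<^bsub>?K\<^esub>) = \<one>\<^bsub>S Quot I\<^esub>" by (simp add: cst_one)
  qed
  have "cst 1 \<noteq> cst 0"
    using ne by (subst cst_eq_iff) (auto simp: mpolys.one_mem mpolys.zero_mem I_def face_ideal_def)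
  then have "\<one>\<^bsub>S Quot I\<^esub> \<noteq> \<zero>\<^bsub>S Quot I\<^esub>" by (simp add: cst_one cst_zero)
  then have "subfield ((\<lambda>a. cst (single 0 a)) ` carrier ?K) (S Quot I)"
    using field.carrier_is_subfield[OF fK] by (intro ring_hom_ring.img_is_subfield(2)[OF h])
  then show ?thesis by (simp add: scal_def)
qed

definition "span_exps B = {cst p | p. keys p \<subseteq> B}"

lemma keys_subset_mpolys:
  "B \<subseteq> {t. keys t \<in> \<Delta>} \<Longrightarrow> keys p \<subseteq> B \<Longrightarrow> p \<in> mpolys V"
  using sub by (auto simp: mpolys_def)

text \<open>Monomials supported on faces stay independent modulo \<open>I\<close>, because no
  element of \<open>I\<close> contains such a monomial; they are adjoined one at a time as line
  extensions.\<close>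

lemma dimension_span_exps:
  assumes "finite B" "B \<subseteq> {t. keys t \<in> \<Delta>}"
  shows "ring.dimension (S Quot I) (card B) scal (span_exps B)"
  using assms
proof (induction B rule: finite_induct)
  case empty
  have "span_exps {} = {\<zero>\<^bsub>S Quot I\<^esub>}" by (auto simp: span_exps_def cst_zero)
  then show ?case using ring.zero_dim[OF ring_SI] by simp
next
  case (insert t B)
  have t: "keys t \<in> \<Delta>" and B: "B \<subseteq> {t. keys t \<in> \<Delta>}" using insert.prems by auto
  have tV: "keys t \<subseteq> V" using t sub by auto
  define x where "x = single t (1::'k)"
  have x: "x \<in> mpolys V" unfolding x_def using tV by (rule single_mem_mpolys)
  have cx: "single 0 a * x = single t a" for a by (simp add: x_def mult_single)
  let ?L = "ring.line_extension (S Quot I) scal (cst x) (span_exps B)"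
  have "ring.dimension (S Quot I) (Suc (card B)) scal ?L"
  proof (rule ring.Suc_dim[OF ring_SI])
    show "cst x \<in> carrier (S Quot I)" using x by (rule cst_mem)
    show "ring.dimension (S Quot I) (card B) scal (span_exps B)" using insert.IH B .
    show "cst x \<notin> span_exps B"
    proof
      assume "cst x \<in> span_exps B"
      then obtain p where p: "cst x = cst p" "keys p \<subseteq> B" by (auto simp: span_exps_def)
      then have "x - p \<in> I" using cst_eq_iff x keys_subset_mpolys[OF B p(2)] by blast
      moreover have "t \<notin> keys p" using p(2) insert.hyps by blast
      then have "t \<in> keys (x - p)" by (simp add: in_keys_iff lookup_minus x_def)
      ultimately show False using t by (auto simp: I_def face_ideal_def)
    qed
  qed
  moreover have "?L = span_exps (insert t B)"
  proof -
    have eq: "cst (single 0 a) \<otimes>\<^bsub>S Quot I\<^esub> cst x \<oplus>\<^bsub>S Quot I\<^esub> cst p = cst (single t a + p)"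
      if "keys p \<subseteq> B" for a p
      using cst_mult[of "single 0 a" x] cst_add[of "single t a" p]
        keys_subset_mpolys[OF B that] x tV by (simp add: single_mem_mpolys cx)
    have "y \<in> ?L
        \<longleftrightarrow> y \<in> {cst (single t a + p) | a p. keys p \<subseteq> B}" for y
    proof
      assume "y \<in> ?L"
      then obtain k e where "k \<in> scal" "e \<in> span_exps B" "y = k \<otimes>\<^bsub>S Quot I\<^esub> cst x \<oplus>\<^bsub>S Quot I\<^esub> e"
        unfolding ring.line_extension_mem_iff[OF ring_SI] by blast
      moreover from this obtain a p where "k = cst (single 0 a)" "e = cst p" "keys p \<subseteq> B"
        unfolding scal_def span_exps_def by blast
      ultimately show "y \<in> {cst (single t a + p) | a p. keys p \<subseteq> B}"
        using eq by blast
    next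
      assume "y \<in> {cst (single t a + p) | a p. keys p \<subseteq> B}"
      then obtain a p where p: "y = cst (single t a + p)" "keys p \<subseteq> B" by blast
      have "cst (single 0 a) \<in> scal" "cst p \<in> span_exps B"
        using p by (auto simp: scal_def span_exps_def)
      then show "y \<in> ?L"
        unfolding ring.line_extension_mem_iff[OF ring_SI] p(1) eq[OF p(2), symmetric] by blast
    qed
    then have "?L
        = {cst (single t a + p) | a p. keys p \<subseteq> B}" by blast
    also have "\<dots> = span_exps (insert t B)"
    proof
      show "{cst (single t a + p) | a p. keys p \<subseteq> B} \<subseteq> span_exps (insert t B)"
      proof clarify
        fix a and p :: "'k mpoly" assume "keys p \<subseteq> B"
        then have "keys (single t a + p) \<subseteq> insert t B"
          using keys_add[of "single t a" p] by (auto split: if_splits)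
        then show "cst (single t a + p) \<in> span_exps (insert t B)" by (auto simp: span_exps_def)
      qed
      show "span_exps (insert t B) \<subseteq> {cst (single t a + p) | a p. keys p \<subseteq> B}"
      proof
        fix y assume "y \<in> span_exps (insert t B)"
        then obtain p where p: "y = cst p" "keys p \<subseteq> insert t B" by (auto simp: span_exps_def)
        define r where "r = p - single t (lookup p t)"
        have "keys r \<subseteq> B"
          using p(2) by (auto simp: r_def in_keys_iff lookup_minus lookup_single when_def split: if_splits)
        moreover have "y = cst (single t (lookup p t) + r)" using p by (simp add: r_def)
        ultimately show "y \<in> {cst (single t a + p) | a p. keys p \<subseteq> B}" by blast
      qed
    qed
    finally show ?thesis .
  qed
  ultimately show ?case using insert.hyps by simp
qed

lemma homogeneous_iff: "homogeneous m p \<longleftrightarrow> (\<forall>t\<in>keys p. exp_deg t = m)"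
  by (simp add: homogeneous_def exp_deg_def)

text \<open>The terms of a homogeneous polynomial whose support is a nonface lie in \<open>I\<close>
  and can be removed.\<close>

lemma component_eq_span:
  "{cst f | f. f \<in> mpolys V \<and> homogeneous m f} = span_exps {t. keys t \<in> \<Delta> \<and> exp_deg t = m}"
proof
  let ?B = "{t. keys t \<in> \<Delta> \<and> exp_deg t = m}"
  show "span_exps ?B \<subseteq> {cst f | f. f \<in> mpolys V \<and> homogeneous m f}"
  proof
    fix y assume "y \<in> span_exps ?B"
    then obtain p where p: "y = cst p" "keys p \<subseteq> ?B" by (auto simp: span_exps_def)
    then have "p \<in> mpolys V" by (intro keys_subset_mpolys[of ?B]) auto
    moreover have "homogeneous m p" using p by (auto simp: homogeneous_iff)
    ultimately show "y \<in> {cst f | f. f \<in> mpolys V \<and> homogeneous m f}" using p by blast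
  qed
  show "{cst f | f. f \<in> mpolys V \<and> homogeneous m f} \<subseteq> span_exps ?B"
  proof clarify
    fix f :: "'k mpoly" assume f: "f \<in> mpolys V" "homogeneous m f"
    define g where "g = (\<Sum>t | t \<in> keys f \<and> keys t \<in> \<Delta>. single t (lookup f t))"
    have lg: "lookup g t = (if keys t \<in> \<Delta> then lookup f t else 0)" for t
    proof -
      have "lookup g t = (\<Sum>u | u \<in> keys f \<and> keys u \<in> \<Delta>. if u = t then lookup f t else 0)"
        unfolding g_def lookup_sum by (intro sum.cong) (auto simp: lookup_single when_def)
      also have "\<dots> = (if keys t \<in> \<Delta> then lookup f t else 0)"
        by (auto simp: in_keys_iff)
      finally show ?thesis .
    qed
    have kg: "keys g \<subseteq> ?B"
      using f by (auto simp: in_keys_iff lg homogeneous_iff split: if_splits)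
    have gV: "g \<in> mpolys V" using kg by (intro keys_subset_mpolys[of ?B]) auto
    have "keys t \<notin> \<Delta>" if "t \<in> keys (f - g)" for t
      using that by (auto simp: in_keys_iff lookup_minus lg split: if_splits)
    then have "f - g \<in> I" using f gV by (auto simp: I_def face_ideal_def mpolys.diff_mem)
    then have "cst f = cst g" using cst_eq_iff f gV by blast
    then show "cst f \<in> span_exps ?B" using kg by (auto simp: span_exps_def)
  qed
qed

lemma hilbert_function_face_ring:
  assumes V: "finite V"
  shows "hilbert_function (S Quot I) scal (\<lambda>m. {cst f | f. f \<in> mpolys V \<and> homogeneous m f}) m
    = (\<Sum>F\<in>\<Delta>. card (exps F m))"
proof -
  let ?B = "{t. keys t \<in> \<Delta> \<and> exp_deg t = m}"
  have fD: "finite \<Delta>" using sub V finite_subset by blast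
  have fF: "finite F" if "F \<in> \<Delta>" for F using that sub V finite_subset by blast
  have B: "?B = (\<Union>F\<in>\<Delta>. exps F m)" by (auto simp: exps_def)
  have fin: "finite ?B" unfolding B using fD fF card_exps by blast
  have "card ?B = (\<Sum>F\<in>\<Delta>. card (exps F m))"
    unfolding B using fD fF card_exps by (intro card_UN_disjoint) (auto simp: exps_def)
  moreover have "ring.dim (S Quot I) scal (span_exps ?B) = card ?B"
    using ring.dimI[OF ring_SI subfield_scal dimension_span_exps[OF fin]] by (auto simp: over_def)
  ultimately show ?thesis by (simp add: hilbert_function_def component_eq_span)
qed

end

text \<open>For \<open>m >= 1\<close> each nonempty face \<open>F\<close> contributes
  \<open>(m - 1) choose (card F - 1)\<close> to the Hilbert function. Only faces with
  \<open>d\<close> elements reach degree \<open>d - 1\<close>, each with coefficient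
  \<open>1 / fact (d - 1)\<close>. Whether such faces exist is left open; if not, both sides are
  0.\<close>

lemma sr_multiplicity_eq:
  assumes \<Delta>: "simplicial_complex n \<Delta>" and ne: "{} \<in> \<Delta>"
    and dim: "krull_dim (stanley_reisner_ring n \<Delta> :: 'k::field mpoly set ring) = enat d" and d: "d \<ge> 1"
    and le: "\<And>F. F \<in> \<Delta> \<Longrightarrow> card F \<le> d"
  shows "sr_multiplicity TYPE('k) n \<Delta> = real (card {F \<in> \<Delta>. card F = d})"
proof -
  have D: "down_closed \<Delta>" and sub: "\<Delta> \<subseteq> Pow {1..n}"
    using \<Delta> by (auto simp: simplicial_complex_def down_closed_def)
  have fD: "finite \<Delta>" using sub finite_subset by blast
  have fF: "finite F" if "F \<in> \<Delta>" for F using that sub finite_subset by blast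
  let ?A = "stanley_reisner_ring n \<Delta> :: 'k mpoly set ring"
  let ?H = "hilbert_function ?A (sr_scalars n \<Delta>) (sr_component n \<Delta>)"
  have H: "?H m = (\<Sum>F\<in>\<Delta>. card (exps F m))" for m
  proof -
    have "sr_scalars n \<Delta> = (scal {1..n} \<Delta> :: 'k mpoly set set)"
      unfolding sr_scalars_def scal_def[OF D ne sub] cst_def[OF D ne sub]
      by (simp add: mpoly_ring_eq stanley_reisner_ideal_eq[OF D])
    moreover have "(sr_component n \<Delta> :: nat \<Rightarrow> 'k mpoly set set) = (\<lambda>m. {cst {1..n} \<Delta> f | f. f \<in> (mpolys {1..n} :: 'k mpoly set) \<and> homogeneous m f})"
      unfolding sr_component_def[abs_def] cst_def[OF D ne sub]
      by (simp add: mpoly_ring_eq stanley_reisner_ideal_eq[OF D])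
    moreover have "?A = ring_of (mpolys {1..n}) Quot face_ideal {1..n} \<Delta>"
      by (simp add: stanley_reisner_ring_def mpoly_ring_eq stanley_reisner_ideal_eq[OF D])
    ultimately show ?thesis
      using hilbert_function_face_ring[OF D ne sub, of m, where ?'k = 'k] by simp
  qed
  define h where "h = (\<Sum>F\<in>\<Delta> - {{}}. choose_poly (card F - 1))"
  have "poly h (real m) = real (?H m)" if m: "m \<ge> 1" for m
  proof -
    have "real (?H m) = (\<Sum>F\<in>\<Delta>. real (card (exps F m)))" by (simp add: H)
    also have "\<dots> = (\<Sum>F\<in>\<Delta> - {{}}. real (card (exps F m)))"
      using fD ne m card_exps[of "{}" m] by (subst sum.remove[of _ "{}"]) auto
    also have "\<dots> = (\<Sum>F\<in>\<Delta> - {{}}. poly (choose_poly (card F - 1)) (real m))"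
      using m fF card_exps by (intro sum.cong) (auto simp: poly_choose_poly)
    finally show ?thesis by (simp add: h_def poly_sum)
  qed
  then have ev: "\<forall>\<^sub>F m in sequentially. poly h (real m) = real (?H m)"
    by (auto simp: eventually_sequentially)
  have "hilbert_polynomial ?A (sr_scalars n \<Delta>) (sr_component n \<Delta>) = h"
    unfolding hilbert_polynomial_def
  proof (rule the_equality)
    show "\<forall>\<^sub>F m in sequentially. poly h (real m) = real (?H m)" by (rule ev)
    show "p = h" if "\<forall>\<^sub>F m in sequentially. poly p (real m) = real (?H m)" for p
      using that ev by (rule eventually_poly_unique)
  qed
  then have "sr_multiplicity TYPE('k) n \<Delta> = fact (d - 1) * coeff h (d - 1)"
    by (simp add: sr_multiplicity_def hilbert_multiplicity_def dim Let_def)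
  also have "coeff h (d - 1) = (\<Sum>F\<in>\<Delta> - {{}}. if card F = d then 1 / fact (d - 1) else 0)"
    unfolding h_def coeff_sum
  proof (intro sum.cong refl)
    fix F assume F: "F \<in> \<Delta> - {{}}"
    then have "card F \<noteq> 0" "card F \<le> d" using fF le by auto
    then show "coeff (choose_poly (card F - 1)) (d - 1) = (if card F = d then 1 / fact (d - 1) else 0)"
      using lead_coeff_choose_poly[of "d - 1"] degree_choose_poly[of "card F - 1"]
      by (auto intro!: coeff_eq_0)
  qed
  also have "\<dots> = real (card {F \<in> \<Delta> - {{}}. card F = d}) / fact (d - 1)"
    using fD by (simp add: sum.If_cases Int_def)
  also have "{F \<in> \<Delta> - {{}}. card F = d} = {F \<in> \<Delta>. card F = d}" using d by auto
  finally show ?thesis by simp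
qed

section \<open>Pure complexes of large multiplicity\<close>

lemma two_mult_le_choose: "2 * c \<le> (c + 2) choose 2"
proof (induction c)
  case (Suc c)
  have "(Suc c + 2) choose 2 = (c + 2) + ((c + 2) choose 2)" by (simp add: numeral_2_eq_2)
  then show ?case using Suc by simp
qed simp

text \<open>Makes the bound \<open>(n choose c) - 2 c + 1\<close> positive, so that the multiplicity
  cannot be 0.\<close>

lemma two_mult_le_choose':
  assumes "d \<ge> 2"
  shows "2 * c \<le> (c + d) choose c"
proof -
  have "2 * c \<le> (c + 2) choose c"
    using two_mult_le_choose[of c] binomial_symmetric[of c "c + 2"] by simp
  also have "\<dots> \<le> (c + d) choose c"
    using assms by (intro binomial_right_mono) simp
  finally show ?thesis .
qed

lemma exists_facet_superset:
  assumes "finite \<Delta>" "F \<in> \<Delta>"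
  shows "\<exists>G\<in>facets \<Delta>. F \<subseteq> G"
proof -
  from finite_has_maximal2[OF assms] obtain G where "G \<in> \<Delta>" "F \<subseteq> G" "\<forall>H\<in>\<Delta>. G \<subseteq> H \<longrightarrow> G = H"
    by (elim bexE conjE)
  then show ?thesis by (auto simp: facets_def)
qed

text \<open>The family without any face is a simplicial complex for \<open>n = 0\<close>. Its ring
  is zero, so it has no prime ideals and its dimension is 0 by convention.\<close>

lemma empty_mem_if_krull_dim_pos:
  assumes D: "down_closed \<Delta>" and V: "\<Delta> \<subseteq> Pow {1..n}"
    and dim: "krull_dim (stanley_reisner_ring n \<Delta> :: 'k::field mpoly set ring) = enat d" and d: "d \<ge> 1"
  shows "{} \<in> \<Delta>"
proof (rule ccontr)
  assume "{} \<notin> \<Delta>"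
  then have \<Delta>: "\<Delta> = {}" using D by (auto simp: down_closed_def)
  let ?S = "ring_of (mpolys {1..n} :: 'k mpoly set)" and ?I = "face_ideal {1..n} \<Delta>"
  have A: "stanley_reisner_ring n \<Delta> = ?S Quot ?I" by (rule stanley_reisner_ring_eq[OF D])
  interpret C: cring_ideal ?S ?I
    by (rule mpolys.cring_ideal_ring_of[OF ideal_face_ideal[OF D]])
  have "\<not> prime_chain (?S Quot ?I) r P" for r P
  proof
    assume "prime_chain (?S Quot ?I) r P"
    then have P: "primeideal (P 0) (?S Quot ?I)" by (simp add: prime_chain_def)
    have "1 \<in> ?I" using \<Delta> by (simp add: face_ideal_def mpolys.one_mem)
    then have "1 \<in> {a \<in> carrier ?S. a_r_coset ?S ?I a \<in> P 0}"
      using C.subset_coset_vimage[OF primeideal.axioms(1)[OF P]] by blast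
    moreover have "prime_in (mpolys {1..n}) {a \<in> carrier ?S. a_r_coset ?S ?I a \<in> P 0}"
      using C.primeideal_coset_vimage[OF P] by (simp only: mpolys.primeideal_iff)
    ultimately show False unfolding prime_in_def by blast
  qed
  then have "{enat r | r. \<exists>P. prime_chain (?S Quot ?I) r P} = {}" by blast
  then have "krull_dim (?S Quot ?I) = Sup {}" unfolding krull_dim_def by (simp only:)
  then have "krull_dim (?S Quot ?I) = 0" by (simp add: bot_enat_def)
  then show False using dim d unfolding A by (simp add: zero_enat_def)
qed

theorem theorem3p1:
  fixes n d c :: nat
    and \<Delta> :: "nat set set"
    and A :: "((nat \<Rightarrow>\<^sub>0 nat) \<Rightarrow>\<^sub>0 'k::field) set ring"
  assumes "simplicial_complex n \<Delta>"
    and "A = stanley_reisner_ring n \<Delta>"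
    and "krull_dim A = enat d"
    and "d \<ge> 2"
    and "c = n - d"
    and "pure_complex \<Delta>"
    and "sr_multiplicity TYPE('k) n \<Delta> \<ge> real (n choose c) - 2 * real c + 1"
  shows "cohen_macaulay_ring A"
proof -
  define V where "V = {1..n}"
  have V: "finite V" "card V = n" by (simp_all add: V_def)
  have D: "down_closed \<Delta>" and sub: "\<Delta> \<subseteq> Pow V" and sing: "\<And>i. i \<in> V \<Longrightarrow> {i} \<in> \<Delta>"
    using assms(1) unfolding simplicial_complex_def down_closed_def V_def by blast+
  have fin\<Delta>: "finite \<Delta>" using sub V finite_subset by blast
  have A: "A = ring_of (mpolys V) Quot face_ideal V \<Delta>"
    unfolding assms(2) V_def by (rule stanley_reisner_ring_eq[OF D])
  have dim: "krull_dim (stanley_reisner_ring n \<Delta> :: 'k mpoly set ring) = enat d"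
    using assms(2,3) by simp
  have ne: "{} \<in> \<Delta>" using empty_mem_if_krull_dim_pos[OF D sub[unfolded V_def] dim] assms(4) by simp
  have le: "card F \<le> d" if F: "F \<in> \<Delta>" for F
  proof -
    have "enat (card F) \<le> krull_dim A"
      unfolding A using F sub V by (intro card_face_le_krull_dim[OF D]) auto
    then show ?thesis using assms(3) by simp
  qed
  define FF where "FF = {F \<in> \<Delta>. card F = d}"
  have mult: "real (card FF) \<ge> real (n choose c) - 2 * real c + 1"
    using assms(4,7) sr_multiplicity_eq[OF assms(1) ne dim _ le] by (simp add: FF_def)
  \<comment> \<open>So far the Krull dimension only bounds the size of faces from above. That some
    face attains it follows from the positive multiplicity.\<close>
  have "FF \<noteq> {}"
  proof
    assume "FF = {}"
    then have neg: "real (n choose c) - 2 * real c + 1 \<le> 0" using mult by simp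
    show False
    proof (cases "n \<le> d")
      \<comment> \<open>Here \<open>c = 0\<close> by truncated subtraction, and the lower bound for
        the multiplicity is 2.\<close>
      case True
      then show False using neg assms(5) by simp
    next
      case False
      then have "n = c + d" using assms(5) by simp
      then have "2 * c \<le> n choose c" using two_mult_le_choose'[OF assms(4), of c] by simp
      then have "2 * real c \<le> real (n choose c)" by (metis of_nat_le_iff of_nat_mult of_nat_numeral)
      then show False using neg by simp
    qed
  qed
  then obtain G where G: "G \<in> \<Delta>" "card G = d" by (auto simp: FF_def)
  have "G \<in> facets \<Delta>"
    unfolding facets_def
  proof (intro CollectI conjI ballI impI G(1))
    fix H assume H: "H \<in> \<Delta>" "G \<subseteq> H"
    have "finite H" using H(1) sub V finite_subset by blast
    then show "H = G" using H G(2) le[OF H(1)] card_seteq[of H G] by simp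
  qed
  then have "face_dim H = face_dim G" if "H \<in> facets \<Delta>" for H
    using assms(6) that unfolding pure_complex_def by blast
  then have card_facet: "card H = d" if "H \<in> facets \<Delta>" for H
    using that G(2) by (simp add: face_dim_def)
  have \<Delta>: "\<Delta> = join FF {}"
  proof
    show "\<Delta> \<subseteq> join FF {}"
    proof
      fix F assume "F \<in> \<Delta>"
      then obtain H where H: "H \<in> facets \<Delta>" "F \<subseteq> H" using exists_facet_superset[OF fin\<Delta>] by blast
      then have "H \<in> FF" using card_facet by (simp add: FF_def facets_def)
      then show "F \<in> join FF {}" using H by (auto simp: join_def)
    qed
    show "join FF {} \<subseteq> \<Delta>" using D by (auto simp: join_def FF_def down_closed_def)
  qed
  have "d \<le> n" using G sub V card_mono[OF V(1), of G] by auto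
  then have n: "n = d + c" using assms(5) by simp
  have FFV: "F \<subseteq> V \<and> card F = d" if "F \<in> FF" for F using that sub by (auto simp: FF_def)
  have cover: "\<Union>FF = V"
  proof
    show "\<Union>FF \<subseteq> V" using FFV by blast
    show "V \<subseteq> \<Union>FF"
    proof
      fix i assume "i \<in> V"
      then have "{i} \<in> join FF {}" using sing \<Delta> by simp
      then show "i \<in> \<Union>FF" by (auto simp: join_def)
    qed
  qed
  \<comment> \<open>The number \<open>n choose c\<close> enters as the number of
    \<open>d\<close>-subsets of \<open>V\<close>, by the symmetry of binomial coefficients.\<close>
  have few: "card (missing V d FF) \<le> 2 * c - 1"
  proof -
    have "card (missing V d FF) = card {F. F \<subseteq> V \<and> card F = d} - card FF"
      unfolding missing_def using FFV fin\<Delta> by (intro card_Diff_subset) (auto simp: FF_def)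
    moreover have "card FF \<le> card {F. F \<subseteq> V \<and> card F = d}"
      using FFV V by (intro card_mono) auto
    moreover have "card {F. F \<subseteq> V \<and> card F = d} = n choose c"
      using n_subsets[OF V(1), of d] V(2) binomial_symmetric[of d n] \<open>d \<le> n\<close> assms(5) by simp
    ultimately have "real (card (missing V d FF)) = real (n choose c) - real (card FF)"
      by simp
    then have "real (card (missing V d FF)) + 1 \<le> 2 * real c" using mult by simp
    then have "card (missing V d FF) + 1 \<le> 2 * c" by linarith
    then show ?thesis by simp
  qed
  show ?thesis
    unfolding assms(2)
  proof (rule cohen_macaulay_stanley_reisner_ring[OF D dim])
    fix q :: "nat \<Rightarrow> 'k poly"
    assume q: "\<And>i. i \<in> {1..n} \<Longrightarrow> q i \<noteq> 0 \<and> coeff (q i) 0 = 0"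
    have "mpolys.wreg V (face_ideal V (join FF {}))
        (map (mpolys.esym (\<lambda>i. var_poly i (q i)) V) (rev [1..<Suc (d + card ({} :: nat set))]))"
    proof (rule wreg_few_missing[OF V(1)])
      show "q i \<noteq> 0 \<and> coeff (q i) 0 = 0" if "i \<in> V" for i using q that by (simp add: V_def)
      show "V \<subseteq> V" ..
      show "card V = d + c" using V n by simp
      show "F \<subseteq> V \<and> card F = d" if "F \<in> FF" for F using FFV[OF that] .
      show "FF \<noteq> {}" by fact
      show "\<Union>FF = V" by (rule cover)
      show "card (missing V d FF) \<le> 2 * c - 1" by (rule few)
    qed simp_all
    then show "mpolys.wreg {1..n} (face_ideal {1..n} \<Delta>)
        (map (mpolys.esym (\<lambda>i. var_poly i (q i)) {1..n}) (rev [1..<Suc d]))"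
      using \<Delta> by (simp only: V_def card.empty add_0_right)
  qed
qed

end
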